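(* Let $\alpha$ be an integer with $\alpha\notin\{0,1,2\}$ such that $m=v_2(\alpha-1)>1$, and let $J$ be the Sylow $2$-subgroup of the Macdonald group $G(\alpha)$. Then $Z_3(J)$ is abelian of order $2^{4m-2}$, with presentation $$\langle x,y,z\mid xy=yx,\ xz=zx,\ yz=zy,\ x^{2^{2m-2}}=z^{2^m},\ x^{2^{m-1}}y^{2^{m-1}}=1,\ x^{2^{2m-1}}=1\rangle;$$ $J/Z_3(J)\cong\mathrm{Heis}(\mathbb{Z}/2^{m}\mathbb{Z})/U$, where $U$ is the $2^{m-1}$th power of the center of $\mathrm{Heis}(\mathbb{Z}/2^{m}\mathbb{Z})$ (the subgroup generated by the $2^{m-1}$th powers of central elements); and $J$ has exponent $2^{3m-1}$.
   Context: For elements $a,b$ of a group, $[a,b]=a^{-1}b^{-1}ab$ and $b^a=a^{-1}ba$. For a group $T$, $Z_0(T)=1$ and $Z_{i+1}(T)/Z_i(T)$ is the center of $T/Z_i(T)$. $\mathrm{Heis}(R)$ is the Heisenberg group over the ring $R$ (upper unitriangular $3\times 3$ matrices over $R$). The Macdonald group is $G(\alpha)=\langle A,B\mid A^{[A,B]}=A^\alpha,\ B^{[B,A]}=B^\alpha\rangle$; for $\alpha\notin\{0,1,2\}$ it is finite and nilpotent, so it has a unique Sylow $2$-subgroup. $v_2$ denotes the $2$-adic valuation. *)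

theory Defs
  imports "HOL-Algebra.Algebra" "HOL-Number_Theory.Residues"
begin

section \<open>Free groups and presentations\<close>

text \<open>A word is a list of letters; \<open>(a, True)\<close> stands for the generator \<open>a\<close> and \<open>(a, False)\<close>
  for its formal inverse.\<close>

inductive cancel :: "('a \<times> bool) list \<Rightarrow> ('a \<times> bool) list \<Rightarrow> bool" where
  "cancel (u @ (a, e) # (a, \<not> e) # v) (u @ v)"

quotient_type 'a free_word = "('a \<times> bool) list" / "equivclp cancel"
  by (rule equivp_evquivclp)

lemma equivclp_map:
  assumes "equivclp r x y" and "\<And>x y. r x y \<Longrightarrow> equivclp s (f x) (f y)"
  shows "equivclp s (f x) (f y)"
  using assms(1)
proof (induction rule: equivclp_induct)
  case base
  show ?case by simp
next
  case (step y z)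
  then show ?case using assms(2) by (meson equivclp_sym equivclp_trans)
qed

lemma cancel_append_left: "cancel u v \<Longrightarrow> cancel (w @ u) (w @ v)"
  by (metis append.assoc cancel.simps)

lemma cancel_append_right: "cancel u v \<Longrightarrow> cancel (u @ w) (v @ w)"
  by (auto elim!: cancel.cases) (metis append.assoc append_Cons cancel.intros)

lift_definition fw_mult :: "'a free_word \<Rightarrow> 'a free_word \<Rightarrow> 'a free_word" is "(@)"
proof -
  fix u u' v v' :: "('a \<times> bool) list"
  assume u: "equivclp cancel u u'" and v: "equivclp cancel v v'"
  have "equivclp cancel (u @ v) (u' @ v)"
    using u by (rule equivclp_map[where f = "\<lambda>w. w @ v"]) (auto intro: cancel_append_right)
  moreover have "equivclp cancel (u' @ v) (u' @ v')"
    using v by (rule equivclp_map[where f = "\<lambda>w. u' @ w"]) (auto intro: cancel_append_left)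
  ultimately show "equivclp cancel (u @ v) (u' @ v')" by (rule equivclp_trans)
qed

lift_definition fw_one :: "'a free_word" is "[]" .

lift_definition fw_gen :: "'a \<Rightarrow> 'a free_word" is "\<lambda>a. [(a, True)]" .

text \<open>The free group on all elements of the type \<open>'a\<close>.\<close>

definition free_group :: "'a free_word monoid" where
  "free_group = \<lparr>carrier = UNIV, monoid.mult = fw_mult, one = fw_one\<rparr>"

lemma group_free_group: "group (free_group :: 'a free_word monoid)"
proof (rule groupI)
  fix x :: "'a free_word"
  assume "x \<in> carrier free_group"
  have "\<exists>y. fw_mult y x = fw_one"
  proof (transfer)
    fix w :: "('a \<times> bool) list"
    show "\<exists>v. equivclp cancel (v @ w) []"
    proof (induction w)
      case Nil
      show ?case by (intro exI[of _ "[]"]) simp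
    next
      case (Cons l w)
      then obtain v where v: "equivclp cancel (v @ w) []" by blast
      obtain a e where l: "l = (a, e)" by (cases l)
      have "cancel ((v @ [(a, \<not> e)]) @ l # w) (v @ w)"
        using cancel.intros[of v a "\<not> e" w] by (simp add: l)
      then show ?case
        using v by (meson r_into_equivclp equivclp_trans)
    qed
  qed
  then show "\<exists>y\<in>carrier free_group. y \<otimes>\<^bsub>free_group\<^esub> x = \<one>\<^bsub>free_group\<^esub>"
    by (simp add: free_group_def)
next
  fix x y z :: "'a free_word"
  show "x \<otimes>\<^bsub>free_group\<^esub> y \<otimes>\<^bsub>free_group\<^esub> z = x \<otimes>\<^bsub>free_group\<^esub> (y \<otimes>\<^bsub>free_group\<^esub> z)"
    by (simp add: free_group_def) (transfer, simp)
  show "\<one>\<^bsub>free_group\<^esub> \<otimes>\<^bsub>free_group\<^esub> x = x"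
    by (simp add: free_group_def) (transfer, simp)
qed (simp_all add: free_group_def)

definition normal_closure :: "('a, 'b) monoid_scheme \<Rightarrow> 'a set \<Rightarrow> 'a set" where
  "normal_closure G S = \<Inter>{N. N \<lhd> G \<and> S \<subseteq> N}"

text \<open>The group with all elements of the type \<open>'a\<close> as generators and a defining relation
  \<open>u = v\<close> for each \<open>(u, v) \<in> rels\<close>.\<close>

definition presented_group ::
    "('a free_word \<times> 'a free_word) set \<Rightarrow> 'a free_word set monoid" where
  "presented_group rels =
     free_group Mod normal_closure free_group
       {u \<otimes>\<^bsub>free_group\<^esub> inv\<^bsub>free_group\<^esub> v | u v. (u, v) \<in> rels}"

lemma (in group) normal_closure_normal:
  assumes "S \<subseteq> carrier G"
  shows "normal_closure G S \<lhd> G"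
proof -
  have carr: "carrier G \<lhd> G"
    using subgroup_self by (auto simp: normal_inv_iff)
  have "subgroup (normal_closure G S) G"
    unfolding normal_closure_def
    using carr assms by (intro subgroups_Inter) (auto simp: normal_imp_subgroup)
  then show ?thesis
    by (auto simp: normal_inv_iff normal_closure_def)
qed

lemma group_presented_group: "group (presented_group rels)"
  unfolding presented_group_def
  by (intro normal.factorgroup_is_group group.normal_closure_normal group_free_group)
    (simp add: free_group_def)


section \<open>Group-theoretic notions\<close>

definition commutator :: "('a, 'b) monoid_scheme \<Rightarrow> 'a \<Rightarrow> 'a \<Rightarrow> 'a" where
  "commutator G a b = inv\<^bsub>G\<^esub> a \<otimes>\<^bsub>G\<^esub> inv\<^bsub>G\<^esub> b \<otimes>\<^bsub>G\<^esub> a \<otimes>\<^bsub>G\<^esub> b"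

text \<open>\<open>conjugate G b a\<close> is \<open>b\<^sup>a\<close>.\<close>

definition conjugate :: "('a, 'b) monoid_scheme \<Rightarrow> 'a \<Rightarrow> 'a \<Rightarrow> 'a" where
  "conjugate G b a = inv\<^bsub>G\<^esub> a \<otimes>\<^bsub>G\<^esub> b \<otimes>\<^bsub>G\<^esub> a"

definition center :: "('a, 'b) monoid_scheme \<Rightarrow> 'a set" where
  "center G = {z \<in> carrier G. \<forall>g\<in>carrier G. z \<otimes>\<^bsub>G\<^esub> g = g \<otimes>\<^bsub>G\<^esub> z}"

primrec upper_central :: "('a, 'b) monoid_scheme \<Rightarrow> nat \<Rightarrow> 'a set" where
  "upper_central G 0 = {\<one>\<^bsub>G\<^esub>}"
| "upper_central G (Suc i) =
     {g \<in> carrier G. upper_central G i #>\<^bsub>G\<^esub> g \<in> center (G Mod upper_central G i)}"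

text \<open>Meant for finite groups; \<open>order G = 0\<close> if \<open>G\<close> is infinite.\<close>

definition sylow_subgroup :: "nat \<Rightarrow> ('a, 'b) monoid_scheme \<Rightarrow> 'a set \<Rightarrow> bool" where
  "sylow_subgroup p G H \<longleftrightarrow> subgroup H G \<and> card H = p ^ multiplicity p (order G)"

text \<open>The value is \<open>0\<close> if no positive power kills the whole group.\<close>

definition group_exponent :: "('a, 'b) monoid_scheme \<Rightarrow> nat" where
  "group_exponent G =
     (if \<exists>n::nat. n > 0 \<and> (\<forall>g\<in>carrier G. g [^]\<^bsub>G\<^esub> n = \<one>\<^bsub>G\<^esub>)
      then LEAST n::nat. n > 0 \<and> (\<forall>g\<in>carrier G. g [^]\<^bsub>G\<^esub> n = \<one>\<^bsub>G\<^esub>)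
      else 0)"


section \<open>Heisenberg groups\<close>

text \<open>An \<open>n \<times> n\<close> matrix over \<open>R\<close> is a function of two indices below \<open>n\<close>, equal to
  \<open>undefined\<close> outside this range.\<close>

definition unitriangular_group ::
    "nat \<Rightarrow> ('r, 'b) ring_scheme \<Rightarrow> (nat \<Rightarrow> nat \<Rightarrow> 'r) monoid" where
  "unitriangular_group n R =
     \<lparr>carrier = {M \<in> {..<n} \<rightarrow>\<^sub>E ({..<n} \<rightarrow>\<^sub>E carrier R).
        (\<forall>i<n. M i i = \<one>\<^bsub>R\<^esub>) \<and> (\<forall>i<n. \<forall>j<i. M i j = \<zero>\<^bsub>R\<^esub>)},
      monoid.mult = (\<lambda>M N. \<lambda>i\<in>{..<n}. \<lambda>j\<in>{..<n}. \<Oplus>\<^bsub>R\<^esub>k\<in>{..<n}. M i k \<otimes>\<^bsub>R\<^esub> N k j),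
      one = (\<lambda>i\<in>{..<n}. \<lambda>j\<in>{..<n}. if i = j then \<one>\<^bsub>R\<^esub> else \<zero>\<^bsub>R\<^esub>)\<rparr>"

abbreviation Heis :: "('r, 'b) ring_scheme \<Rightarrow> (nat \<Rightarrow> nat \<Rightarrow> 'r) monoid" where
  "Heis R \<equiv> unitriangular_group 3 R"


section \<open>Macdonald groups\<close>

datatype gens_AB = gA | gB

definition Macdonald :: "int \<Rightarrow> gens_AB free_word set monoid" where
  "Macdonald \<alpha> =
     (let F = free_group; A = fw_gen gA; B = fw_gen gB in
      presented_group
        {(conjugate F A (commutator F A B), A [^]\<^bsub>F\<^esub> \<alpha>),
         (conjugate F B (commutator F B A), B [^]\<^bsub>F\<^esub> \<alpha>)})"

datatype gens_xyz = gX | gY | gZ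

end

theory Submission
  imports Defs
begin

text \<open>Let \<open>C = [A, B]\<close> and \<open>\<alpha> = 1 + 2 p u\<close> with \<open>p = 2^(m - 1)\<close> and \<open>u\<close> odd. Conjugating \<open>B\<close> by \<open>A^\<alpha>\<close>
  in two ways shows that \<open>B^t\<close> is a power of \<open>A\<close> for some \<open>t\<close> of 2-adic valuation \<open>2 m - 1\<close>. Hence
  \<open>A^t\<close> and \<open>B^t\<close> are central, \<open>A^((\<alpha> - 1) t) = 1\<close>, and \<open>C^t\<close> is a power of \<open>A\<close>; since every element
  is a product \<open>A^i C^k B^j\<close>, the group is finite of order dividing \<open>(\<alpha> - 1) t^3\<close>, whose 2-part is
  \<open>2^(7 m - 3)\<close>. Conversely, right multiplication by the generators acts on the exponents \<open>(i, k, j)\<close>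
  by polynomial formulas, and these formulas define a group of permutations of order
  \<open>2^(7 m - 3)\<close> that satisfies the Macdonald relations. It is therefore isomorphic to \<open>J\<close>, so that
  equality of words \<open>A^i C^k B^j\<close> in \<open>J\<close> is known exactly, and the upper central series can be
  read off from the exponents of the conjugates of such a word by \<open>A\<close> and \<open>B\<close>.\<close>

section \<open>Conjugation and cyclic transversals\<close>

text \<open>The obstacle is the lower bound for the order: relations bound a group from above, and
  only a concrete example shows that it does not collapse further. The model stays polynomial
  because \<alpha> - 1 = 2 p u and exponents of A matter modulo 4 p^3 only, so every power of
  \<alpha> can be cut off after the square of 2 p u. The coefficients are binomials, hence
  \<open>tri\<close>, \<open>tet\<close> and the recurring division by 3. Parity enters in two ways:
  an odd factor next to 2 p^3 may be replaced by 1 modulo 4 p^3, and p is even because m > 1, so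
  that 2 p^4 vanishes as well. The order 16 p^7 is the product of 4 p^3, 2 p^2 and 2 p^2, the
  numbers of exponents of A, C and B. The Sylow subgroup enters only through an isomorphism: the
  Macdonald group maps onto the model with a kernel of odd order, which meets J trivially, and J
  inherits its generators from the model.\<close>

context group
begin

lemma inv_mult_cancel [simp]:
  assumes "x \<in> carrier G" "y \<in> carrier G"
  shows "inv x \<otimes> (x \<otimes> y) = y" "x \<otimes> (inv x \<otimes> y) = y"
  using assms by (simp_all add: m_assoc[symmetric])

lemma conjugate_closed [simp, intro]:
  "x \<in> carrier G \<Longrightarrow> a \<in> carrier G \<Longrightarrow> conjugate G x a \<in> carrier G"
  by (simp add: conjugate_def)

lemma conjugate_mult:
  "x \<in> carrier G \<Longrightarrow> y \<in> carrier G \<Longrightarrow> a \<in> carrier G \<Longrightarrow>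
    conjugate G (x \<otimes> y) a = conjugate G x a \<otimes> conjugate G y a"
  by (simp add: conjugate_def m_assoc)

lemma conjugate_inv:
  "x \<in> carrier G \<Longrightarrow> a \<in> carrier G \<Longrightarrow> conjugate G (inv x) a = inv (conjugate G x a)"
  by (simp add: conjugate_def m_assoc inv_mult_group)

lemma conjugate_one [simp]: "x \<in> carrier G \<Longrightarrow> conjugate G x \<one> = x"
  by (simp add: conjugate_def)

lemma conjugate_conjugate:
  "x \<in> carrier G \<Longrightarrow> a \<in> carrier G \<Longrightarrow> b \<in> carrier G \<Longrightarrow>
    conjugate G (conjugate G x a) b = conjugate G x (a \<otimes> b)"
  by (simp add: conjugate_def m_assoc inv_mult_group)

lemma conjugate_hom: "a \<in> carrier G \<Longrightarrow> (\<lambda>x. conjugate G x a) \<in> hom G G"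
  by (auto simp: hom_def conjugate_mult)

lemma conjugate_int_pow:
  assumes "x \<in> carrier G" "a \<in> carrier G"
  shows "conjugate G (x [^] (i::int)) a = conjugate G x a [^] i"
  using hom_int_pow[OF conjugate_hom[OF assms(2)] assms(1)] is_group by simp

lemma conjugate_eq_iff_commute:
  "x \<in> carrier G \<Longrightarrow> a \<in> carrier G \<Longrightarrow> conjugate G x a = x \<longleftrightarrow> x \<otimes> a = a \<otimes> x"
  unfolding conjugate_def
  by (metis inv_closed inv_mult_cancel m_assoc m_closed)

lemma conjugate_inverse_cancel:
  "x \<in> carrier G \<Longrightarrow> a \<in> carrier G \<Longrightarrow> conjugate G (conjugate G x a) (inv a) = x"
  "x \<in> carrier G \<Longrightarrow> a \<in> carrier G \<Longrightarrow> conjugate G (conjugate G x (inv a)) a = x"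
  by (simp_all add: conjugate_conjugate)

lemma int_pow_commute:
  assumes "x \<in> carrier G" "y \<in> carrier G" "x \<otimes> y = y \<otimes> x"
  shows "x [^] (i::int) \<otimes> y = y \<otimes> x [^] i"
proof -
  have "conjugate G x y = x" using assms by (simp add: conjugate_eq_iff_commute)
  then have "conjugate G (x [^] i) y = x [^] i" using assms by (simp add: conjugate_int_pow)
  then show ?thesis using assms by (simp add: conjugate_eq_iff_commute)
qed

lemma int_pow_commute2:
  assumes "x \<in> carrier G" "y \<in> carrier G" "x \<otimes> y = y \<otimes> x"
  shows "x [^] (i::int) \<otimes> y [^] (j::int) = y [^] j \<otimes> x [^] i"
  using assms by (metis int_pow_closed int_pow_commute)

lemma int_pow_eq_one_mult:
  "x \<in> carrier G \<Longrightarrow> x [^] (n::int) = \<one> \<Longrightarrow> x [^] (n * i) = \<one>"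
  by (metis int_pow_one int_pow_pow)

lemma int_pow_cong:
  assumes "x \<in> carrier G" "x [^] (n::int) = \<one>" "[i = j] (mod n)"
  shows "x [^] i = x [^] j"
proof -
  obtain k where "i = j + n * k" using assms(3) by (metis cong_iff_lin cong_sym mult.commute)
  then show ?thesis using assms by (simp add: int_pow_mult int_pow_eq_one_mult)
qed

text \<open>The cosets of the powers of b exhaust the group, and two of them agree exactly when the
  exponents differ by a multiple of the least d > 0 with b^d in H. So y is the index of H, and every
  exponent l with b^l in H that is found later bounds the order from above.\<close>

lemma index_cyclic_transversal:
  assumes H: "subgroup H G" and fin: "finite (carrier G)" and b: "b \<in> carrier G"
    and dec: "\<And>g. g \<in> carrier G \<Longrightarrow> \<exists>h\<in>H. \<exists>j::int. g = h \<otimes> b [^] j"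
  obtains y where "order G = card H * y" and "\<And>l::int. b [^] l \<in> H \<Longrightarrow> int y dvd l"
proof -
  interpret H: subgroup H G by fact
  define P where "P = (\<lambda>n. n > 0 \<and> b [^] int n \<in> H)"
  have "P (order G)"
    using fin b H.one_closed order_gt_0_iff_finite pow_order_eq_1 by (simp add: P_def int_pow_int)
  define d where "d = (LEAST n. P n)"
  have d: "d > 0" "b [^] int d \<in> H" and least: "\<And>n. P n \<Longrightarrow> d \<le> n"
    using LeastI[of P, OF \<open>P (order G)\<close>] Least_le[of P] by (auto simp: d_def P_def)
  have dpow: "b [^] (int d * k) \<in> H" for k
    using d(2) b H by (metis int_pow_pow subgroup_int_pow_closed)
  have dvd: "int d dvd l" if "b [^] l \<in> H" for l
  proof -
    have "b [^] (l mod int d) = b [^] l \<otimes> inv (b [^] (int d * (l div int d)))"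
      using b by (simp add: int_pow_diff[symmetric] minus_mult_div_eq_mod)
    then have mem: "b [^] (l mod int d) \<in> H" using that dpow by simp
    have "l mod int d < int d" "0 \<le> l mod int d" using d by simp_all
    then have "\<not> P (nat (l mod int d))" using least[of "nat (l mod int d)"] by linarith
    then have "l mod int d = 0"
      using mem \<open>0 \<le> l mod int d\<close> by (auto simp: P_def)
    then show ?thesis by blast
  qed
  have eq_iff: "H #> b [^] i = H #> b [^] j \<longleftrightarrow> int d dvd i - j" for i j :: int
  proof -
    have "H #> b [^] i = H #> b [^] j \<longleftrightarrow> b [^] i \<otimes> inv (b [^] j) \<in> H"
      using b H rcos_self[OF _ H] repr_independence[OF _ _ H] H.rcos_module[OF is_group]
      by (metis int_pow_closed)
    also have "\<dots> \<longleftrightarrow> b [^] (i - j) \<in> H" using b by (simp add: int_pow_diff)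
    also have "\<dots> \<longleftrightarrow> int d dvd i - j" using dvd dpow by (auto elim!: dvdE)
    finally show ?thesis .
  qed
  have "bij_betw (\<lambda>n. H #> b [^] int n) {..<d} (rcosets H)"
  proof (rule bij_betw_imageI)
    show "inj_on (\<lambda>n. H #> b [^] int n) {..<d}"
    proof (rule inj_onI)
      fix i j assume ij: "i \<in> {..<d}" "j \<in> {..<d}" "H #> b [^] int i = H #> b [^] int j"
      then have "int i mod int d = int j mod int d" by (simp only: eq_iff mod_eq_dvd_iff)
      then show "i = j" using ij by simp
    qed
    show "(\<lambda>n. H #> b [^] int n) ` {..<d} = rcosets H"
    proof
      show "(\<lambda>n. H #> b [^] int n) ` {..<d} \<subseteq> rcosets H"
        using b by (auto simp: RCOSETS_def)
      show "rcosets H \<subseteq> (\<lambda>n. H #> b [^] int n) ` {..<d}"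
      proof
        fix K assume "K \<in> rcosets H"
        then obtain g where g: "g \<in> carrier G" "K = H #> g" by (auto simp: RCOSETS_def)
        obtain h j where h: "h \<in> H" "g = h \<otimes> b [^] (j::int)" using dec g by blast
        have "K = H #> b [^] j"
          using h g(2) b H.mem_carrier[OF h(1)] coset_join2[OF _ H h(1)]
            coset_mult_assoc[OF H.subset, of h "b [^] j"] by simp
        also have "\<dots> = H #> b [^] (j mod int d)"
          unfolding eq_iff by (simp add: minus_mod_eq_mult_div)
        also have "\<dots> = H #> b [^] int (nat (j mod int d))" using d by simp
        finally show "K \<in> (\<lambda>n. H #> b [^] int n) ` {..<d}"
          by (rule image_eqI) (use d in \<open>simp add: nat_less_iff\<close>)
      qed
    qed
  qed
  then have "card (rcosets H) = d" by (simp add: bij_betw_same_card[symmetric])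
  then have "order G = card H * d"
    using lagrange_finite[OF fin H] by (simp add: mult.commute)
  then show ?thesis using that dvd by blast
qed

end

section \<open>Consequences of the Macdonald relations\<close>

primrec geom_sum :: "int \<Rightarrow> nat \<Rightarrow> int" where
  "geom_sum \<alpha> 0 = 0"
| "geom_sum \<alpha> (Suc n) = 1 + \<alpha> * geom_sum \<alpha> n"

lemma geom_sum_eq: "(\<alpha> - 1) * geom_sum \<alpha> n = \<alpha> ^ n - 1"
  by (induction n) (simp_all add: algebra_simps)

text \<open>This is the exponent t of the overview. The two branches are what the two computations
  in \<open>central_exp_relation\<close> leave over, since conjugated powers are expanded for
  natural exponents only.\<close>

definition central_exp :: "int \<Rightarrow> int" where
  "central_exp \<alpha> =
     (if \<alpha> \<ge> 0 then \<alpha> ^ nat \<alpha> - geom_sum \<alpha> (nat \<alpha>) else 1 + geom_sum \<alpha> (nat (- \<alpha>)))"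

locale macdonald = group G for G (structure) +
  fixes A B :: 'a and \<alpha> :: int
  assumes A [simp, intro]: "A \<in> carrier G" and B [simp, intro]: "B \<in> carrier G"
    and rel_A: "conjugate G A (commutator G A B) = A [^] \<alpha>"
    and rel_B: "conjugate G B (commutator G B A) = B [^] \<alpha>"
    and generated: "carrier G = generate G {A, B}"
begin

definition C where "C = commutator G A B"

lemma C_closed [simp, intro]: "C \<in> carrier G"
  by (simp add: C_def commutator_def)

lemma commutator_BA: "commutator G B A = inv C"
  by (simp add: C_def commutator_def inv_mult_group m_assoc)

end

text \<open>The relations are symmetric in A and B up to inverting C, so every fact about A and C
  has a mirror image about B and \<open>inv C\<close>.\<close>

sublocale macdonald \<subseteq> swap: macdonald G B A \<alpha>
  rewrites "macdonald.C G B A = inv C"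
proof -
  show *: "macdonald G B A \<alpha>"
    using rel_A rel_B generated
    by (intro macdonald.intro macdonald_axioms.intro is_group A B) (simp_all only: insert_commute)
  show "macdonald.C G B A = inv C"
    by (simp add: macdonald.C_def[OF *] commutator_BA)
qed

section \<open>Conjugates of powers of A, B and C\<close>

context macdonald
begin

lemma conj_A_C: "conjugate G (A [^] (i::int)) C = A [^] (\<alpha> * i)"
  using rel_A by (simp add: conjugate_int_pow C_def[symmetric] int_pow_pow)

end

context macdonald
begin

lemma conj_B_inv_C: "conjugate G (B [^] (i::int)) (inv C) = B [^] (\<alpha> * i)"
  by (rule swap.conj_A_C)

text \<open>\<open>rel_B\<close> describes conjugation by the inverse of C, so conjugation by C
  takes \<alpha>-th roots. As long as \<alpha> is not known to be invertible modulo the order of B,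
  only exponents that are multiples of \<alpha> can be treated.\<close>

lemma conj_B_C: "conjugate G (B [^] (\<alpha> * i)) C = B [^] (i::int)"
  by (simp add: conj_B_inv_C[symmetric] conjugate_inverse_cancel)

lemma conj_A_C_pow: "conjugate G (A [^] (i::int)) (C [^] (k::nat)) = A [^] (\<alpha> ^ k * i)"
proof (induction k)
  case (Suc k)
  have "conjugate G (A [^] i) (C [^] Suc k) = conjugate G (conjugate G (A [^] i) (C [^] k)) C"
    by (simp add: conjugate_conjugate)
  then show ?case using Suc by (simp add: conj_A_C mult.assoc)
qed simp

end

context macdonald
begin

lemma conj_B_C_pow: "conjugate G (B [^] (\<alpha> ^ k * i)) (C [^] (k::nat)) = B [^] (i::int)"
proof -
  have "conjugate G (B [^] i) (inv (C [^] k)) = B [^] (\<alpha> ^ k * i)"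
    using swap.conj_A_C_pow[of i k] by (simp add: nat_pow_inv)
  then show ?thesis by (metis B C_closed conjugate_inverse_cancel(2) int_pow_closed nat_pow_closed)
qed

lemma conj_A_B: "conjugate G A B = A \<otimes> C"
  by (simp add: conjugate_def C_def commutator_def m_assoc)

lemma A_C: "A [^] i \<otimes> C = C \<otimes> A [^] (\<alpha> * (i::int))"
  using conj_A_C[of i] by (simp add: conjugate_def m_assoc) (metis A C_closed int_pow_closed inv_mult_cancel(2) m_closed)

lemma A_C_pow: "A [^] i \<otimes> C [^] k = C [^] k \<otimes> A [^] (\<alpha> ^ k * (i::int))" for k :: nat
  using conj_A_C_pow[of i k] by (simp add: conjugate_def m_assoc) (metis A C_closed int_pow_closed inv_mult_cancel(2) m_closed nat_pow_closed)

text \<open>The conjugate of A by B is A C, and in (A C)^n each C that is moved to the left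
  multiplies the exponents of the A it passes by \<alpha>. The result is the sum \<alpha> + ... +
  \<alpha>^n.\<close>

lemma conj_A_pow_B:
  "conjugate G (A [^] int n) B = C [^] int n \<otimes> A [^] (\<alpha> * geom_sum \<alpha> n)"
proof (induction n)
  case 0
  show ?case by (simp add: conjugate_def)
next
  case (Suc n)
  have "conjugate G (A [^] int (Suc n)) B = conjugate G (A [^] int n) B \<otimes> conjugate G A B"
    using int_pow_mult[of A "int n" 1] by (simp add: conjugate_mult add.commute)
  also have "\<dots> = C [^] int n \<otimes> (A [^] (\<alpha> * geom_sum \<alpha> n + 1) \<otimes> C)"
    using Suc by (simp add: conj_A_B m_assoc int_pow_mult)
  also have "\<dots> = C [^] int n \<otimes> (C \<otimes> A [^] (\<alpha> * geom_sum \<alpha> (Suc n)))"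
    unfolding A_C by (simp add: algebra_simps)
  also have "\<dots> = C [^] int (Suc n) \<otimes> A [^] (\<alpha> * geom_sum \<alpha> (Suc n))"
    using int_pow_mult[of C "int n" 1] by (simp add: m_assoc add.commute del: geom_sum.simps)
  finally show ?case .
qed

end

context macdonald
begin

lemma conj_B_pow_A:
  "conjugate G (B [^] int n) A = C [^] (- int n) \<otimes> B [^] (\<alpha> * geom_sum \<alpha> n)"
  using swap.conj_A_pow_B[of n] by (simp add: int_pow_inv int_pow_neg)

text \<open>Conjugating by A^\<alpha> = C^(-1) A C means conjugating by C^(-1), A and C in turn, and
  the first of these turns B into B^\<alpha>.\<close>

lemma conj_B_A_pow:
  "conjugate G B (A [^] \<alpha>) = conjugate G (conjugate G (B [^] \<alpha>) A) C"
proof -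
  have "conjugate G B (A [^] \<alpha>) = conjugate G (conjugate G (conjugate G B (inv C)) A) C"
    using rel_A by (simp add: conjugate_conjugate C_def[symmetric] conjugate_def m_assoc inv_mult_group)
      (simp add: rel_A[symmetric] C_def[symmetric] conjugate_def m_assoc inv_mult_group)
  then show ?thesis using conj_B_inv_C[of 1] by simp
qed

text \<open>Both sides come from computing \<open>B\<close> conjugated by \<open>A [^] \<alpha>\<close> in two ways: through
  \<open>A [^] \<alpha> = inv C \<otimes> A \<otimes> C\<close>, and through the conjugate of \<open>A [^] \<alpha>\<close> by \<open>B\<close>.\<close>

lemma central_exp_relation:
  "A [^] (\<alpha> * central_exp \<alpha>) = conjugate G (B [^] (- central_exp \<alpha>)) (C [^] nat \<bar>\<alpha>\<bar>)"
proof -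
  define n where "n = nat \<bar>\<alpha>\<bar>"
  define s where "s = geom_sum \<alpha> n"
  have sC: "conjugate G (B [^] (\<alpha> * s)) C = B [^] s" by (rule conj_B_C)
  have CC: "conjugate G (C [^] i) C = C [^] i" for i :: int
    by (simp add: conjugate_int_pow) (simp add: conjugate_def m_assoc)
  have BC: "conjugate G (B [^] (\<alpha> ^ n)) (C [^] n) = B"
    using conj_B_C_pow[of n 1] by simp
  \<comment> \<open>The second computation: x^(-1) B x is B times the inverse of B^(-1) x B times x,
    here with x = A^\<alpha>.\<close>
  have X2: "conjugate G B (A [^] \<alpha>) = B \<otimes> inv (conjugate G (A [^] \<alpha>) B) \<otimes> A [^] \<alpha>"
    by (simp add: conjugate_def m_assoc inv_mult_group)
  show ?thesis
  proof (cases "\<alpha> \<ge> 0")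
    case True
    then have n: "int n = \<alpha>" "\<alpha> \<ge> 0" and t: "central_exp \<alpha> = \<alpha> ^ n - s"
      by (simp_all add: n_def s_def central_exp_def)
    have "conjugate G B (A [^] \<alpha>) = C [^] (- \<alpha>) \<otimes> B [^] s"
      using conj_B_pow_A[of n] n sC CC by (simp add: conj_B_A_pow conjugate_mult s_def)
    moreover have "conjugate G (A [^] \<alpha>) B = C [^] \<alpha> \<otimes> A [^] (\<alpha> * s)"
      using conj_A_pow_B[of n] n by (simp add: s_def)
    ultimately have eq: "C [^] (- \<alpha>) \<otimes> B [^] s = B \<otimes> A [^] (- \<alpha> * s) \<otimes> C [^] (- \<alpha>) \<otimes> A [^] \<alpha>"
      using X2 by (simp add: inv_mult_group int_pow_neg m_assoc)
    \<comment> \<open>\<open>eq\<close> mixes powers of A, B and C. Its factor C^(-\<alpha>)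
      A^\<alpha>, completed by C^n, is a conjugate of a power of A; this separates A from B.\<close>
    have "A [^] (\<alpha> * (\<alpha> ^ n - s)) = A [^] (- \<alpha> * s) \<otimes> conjugate G (A [^] \<alpha>) (C [^] n)"
      unfolding conj_A_C_pow by (simp add: int_pow_mult[symmetric] algebra_simps)
    also have "\<dots> = inv B \<otimes> (B \<otimes> A [^] (- \<alpha> * s) \<otimes> C [^] (- \<alpha>) \<otimes> A [^] \<alpha>) \<otimes> C [^] n"
      using n by (simp add: conjugate_def m_assoc int_pow_neg) (metis int_pow_int)
    also have "\<dots> = inv B \<otimes> conjugate G (B [^] s) (C [^] n)"
      unfolding eq[symmetric] using n by (simp add: conjugate_def m_assoc int_pow_neg) (metis int_pow_int)
    also have "\<dots> = conjugate G (B [^] (- (\<alpha> ^ n - s))) (C [^] n)"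
    proof -
      have "- (\<alpha> ^ n - s) = - (\<alpha> ^ n) + s" by simp
      then have "conjugate G (B [^] (- (\<alpha> ^ n - s))) (C [^] n)
          = conjugate G (B [^] (- (\<alpha> ^ n))) (C [^] n) \<otimes> conjugate G (B [^] s) (C [^] n)"
        using int_pow_mult[of B "- (\<alpha> ^ n)" s]
        by (simp only: conjugate_mult B int_pow_closed C_closed nat_pow_closed)
      then show ?thesis by (simp add: int_pow_neg conjugate_inv BC)
    qed
    finally show ?thesis using t n_def by simp
  next
    case False
    \<comment> \<open>The expansions are used for the positive exponent n = -\<alpha> and then
      inverted, which moves the power of C to the other side of the powers of A and B.\<close>
    then have n: "int n = - \<alpha>" and t: "central_exp \<alpha> = 1 + s"
      by (simp_all add: n_def s_def central_exp_def)
    have neg: "x [^] \<alpha> = inv (x [^] int n)" if "x \<in> carrier G" for x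
      unfolding n using that by (simp add: int_pow_neg)
    have "conjugate G B (A [^] \<alpha>) = inv (conjugate G (conjugate G (B [^] int n) A) C)"
      unfolding conj_B_A_pow neg[OF B] by (simp only: conjugate_inv conjugate_closed A B C_closed int_pow_closed)
    also have "conjugate G (conjugate G (B [^] int n) A) C = C [^] (- int n) \<otimes> B [^] s"
      unfolding conj_B_pow_A s_def[symmetric] by (simp add: conjugate_mult CC sC)
    finally have "conjugate G B (A [^] \<alpha>) = B [^] (- s) \<otimes> C [^] n"
      by (simp add: inv_mult_group int_pow_neg int_pow_int)
    moreover have "inv (conjugate G (A [^] \<alpha>) B) = C [^] n \<otimes> A [^] (\<alpha> * s)"
      unfolding neg[OF A] using conj_A_pow_B[of n] by (simp add: conjugate_inv s_def int_pow_int)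
    ultimately have eq: "B [^] (- s) \<otimes> C [^] n = B \<otimes> C [^] n \<otimes> A [^] (\<alpha> * s) \<otimes> A [^] \<alpha>"
      using X2 by (simp add: m_assoc)
    have "A [^] (\<alpha> * (1 + s)) = A [^] (\<alpha> * s) \<otimes> A [^] \<alpha>"
      by (simp add: int_pow_mult[symmetric] algebra_simps)
    also have "\<dots> = inv (C [^] n) \<otimes> inv B \<otimes> (B \<otimes> C [^] n \<otimes> A [^] (\<alpha> * s) \<otimes> A [^] \<alpha>)"
      by (simp add: m_assoc)
    also have "\<dots> = inv (C [^] n) \<otimes> (B [^] (- 1 - s)) \<otimes> C [^] n"
      unfolding eq[symmetric] using int_pow_mult[of B "- 1" "- s"]
      by (simp add: m_assoc int_pow_neg)
    finally show ?thesis using t n_def by (simp add: conjugate_def)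
  qed
qed

text \<open>In \<open>central_exp_relation\<close> the power of B is still conjugated by C^n with n
  = |\<alpha>|. Raising to the power \<alpha>^n produces an exponent for which
  \<open>conj_B_C_pow\<close> undoes the conjugation.\<close>

lemma B_central_exp:
  "B [^] central_exp \<alpha> = A [^] (- (central_exp \<alpha> * \<alpha> ^ Suc (nat \<bar>\<alpha>\<bar>)))"
proof -
  define n where "n = nat \<bar>\<alpha>\<bar>"
  define t where "t = central_exp \<alpha>"
  have "A [^] (\<alpha> * t * \<alpha> ^ n) = conjugate G (B [^] (- t)) (C [^] n) [^] \<alpha> ^ n"
    unfolding n_def t_def central_exp_relation[symmetric] by (simp add: int_pow_pow)
  also have "\<dots> = conjugate G (B [^] (\<alpha> ^ n * (- t))) (C [^] n)"
    by (simp add: conjugate_int_pow[symmetric] int_pow_pow mult.commute)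
  also have "\<dots> = B [^] (- t)" by (rule conj_B_C_pow)
  finally have "B [^] t = inv (A [^] (\<alpha> * t * \<alpha> ^ n))" by (simp add: int_pow_neg)
  then show ?thesis by (simp add: t_def n_def int_pow_neg[symmetric] mult_ac)
qed

lemma central_generated:
  assumes "z \<in> carrier G" "z \<otimes> A = A \<otimes> z" "z \<otimes> B = B \<otimes> z" "g \<in> carrier G"
  shows "z \<otimes> g = g \<otimes> z"
proof -
  have "g \<in> generate G {A, B}" using assms(4) generated by simp
  then show ?thesis
  proof (induction rule: generate.induct)
    case (inv h)
    then have "conjugate G h z = h" using assms conjugate_eq_iff_commute by auto
    then have "conjugate G (inv h) z = inv h" using inv assms by (auto simp: conjugate_inv)
    then show ?case using inv assms conjugate_eq_iff_commute[of "inv h" z] by auto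
  next
    case (eng h1 h2)
    then have "h1 \<in> carrier G" "h2 \<in> carrier G" using generated by auto
    then show ?case using eng assms(1) by (metis m_assoc)
  qed (use assms in auto)
qed

text \<open>B^t is also a power of A, hence commutes with both generators.\<close>

lemma B_central_exp_central:
  assumes "g \<in> carrier G"
  shows "B [^] central_exp \<alpha> \<otimes> g = g \<otimes> B [^] central_exp \<alpha>"
proof (rule central_generated)
  show "B [^] central_exp \<alpha> \<otimes> A = A \<otimes> B [^] central_exp \<alpha>"
    unfolding B_central_exp by (rule int_pow_commute) simp_all
  show "B [^] central_exp \<alpha> \<otimes> B = B \<otimes> B [^] central_exp \<alpha>"
    by (rule int_pow_commute) simp_all
qed (use assms in simp_all)

text \<open>Conjugation by the inverse of C fixes the central element B^t but also raises powers of
  B to the power \<alpha>.\<close>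

lemma B_pow_one: "B [^] ((\<alpha> - 1) * central_exp \<alpha>) = \<one>"
proof -
  let ?t = "central_exp \<alpha>"
  have "conjugate G (B [^] ?t) (inv C) = B [^] ?t"
    by (subst conjugate_eq_iff_commute) (simp_all add: B_central_exp_central)
  then have "B [^] (\<alpha> * ?t) = B [^] ?t" by (simp add: conj_B_inv_C)
  then show ?thesis
    by (simp add: left_diff_distrib int_pow_diff)
qed

end

context macdonald
begin

lemmas A_central_exp_central = swap.B_central_exp_central
lemmas A_pow_one = swap.B_pow_one

end

section \<open>A normal form and the order\<close>

context macdonald
begin

text \<open>If B fixes A^n, the expansion \<open>conj_A_pow_B\<close> becomes an equation that can
  be solved for C^n.\<close>

lemma C_pow_eq_A_pow:
  assumes "A [^] int n \<otimes> B = B \<otimes> A [^] int n"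
  shows "C [^] int n = A [^] (int n - \<alpha> * geom_sum \<alpha> n)"
proof -
  have "A [^] int n = C [^] int n \<otimes> A [^] (\<alpha> * geom_sum \<alpha> n)"
    using assms conj_A_pow_B[of n] by (simp only: conjugate_eq_iff_commute[THEN iffD2] A B int_pow_closed)
  then have "A [^] int n \<otimes> inv (A [^] (\<alpha> * geom_sum \<alpha> n)) = C [^] int n"
    by (metis A C_closed int_pow_closed inv_solve_right)
  then show ?thesis by (simp add: int_pow_diff)
qed

lemma C_central_exp: "C [^] central_exp \<alpha> \<in> generate G {A}"
proof -
  define n where "n = nat \<bar>central_exp \<alpha>\<bar>"
  have sgn: "central_exp \<alpha> = int n \<or> central_exp \<alpha> = - int n" by (auto simp: n_def)
  have "conjugate G (A [^] central_exp \<alpha>) B = A [^] central_exp \<alpha>"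
    by (subst conjugate_eq_iff_commute) (simp_all add: A_central_exp_central)
  then have "conjugate G (A [^] int n) B = A [^] int n"
    using sgn by (auto simp: int_pow_neg conjugate_inv)
  then have *: "C [^] int n = A [^] (int n - \<alpha> * geom_sum \<alpha> n)"
    by (intro C_pow_eq_A_pow) (simp add: conjugate_eq_iff_commute del: int_pow_int)
  then have "C [^] (- int n) = A [^] (- (int n - \<alpha> * geom_sum \<alpha> n))"
    by (simp only: int_pow_neg A C_closed)
  then show ?thesis using * sgn by (auto simp: generate_pow[OF A])
qed

text \<open>The exponent of C is natural because moving a power of A to the right past C^k
  multiplies its exponent by \<alpha>^k. Closure under inverses has to wait for torsion.\<close>

definition CA where "CA = {C [^] (k::nat) \<otimes> A [^] (i::int) | k i. True}"

lemma C_A_mult: "C [^] k \<otimes> A [^] i \<otimes> (C [^] k' \<otimes> A [^] i') = C [^] (k + k') \<otimes> A [^] (\<alpha> ^ k' * i + i')"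
  for k k' :: nat and i i' :: int
proof -
  have "C [^] k \<otimes> A [^] i \<otimes> (C [^] k' \<otimes> A [^] i') = C [^] k \<otimes> (A [^] i \<otimes> C [^] k') \<otimes> A [^] i'"
    by (simp add: m_assoc)
  then show ?thesis unfolding A_C_pow by (simp add: m_assoc int_pow_mult nat_pow_mult[symmetric])
qed

end

text \<open>A common exponent replaces negative exponents by natural ones, for which the conjugation
  formulas are available.\<close>

locale macdonald_torsion = macdonald +
  fixes e :: nat
  assumes e_pos: "e > 0" and A_e: "A [^] e = \<one>" and B_e: "B [^] e = \<one>" and C_e: "C [^] e = \<one>"
begin

lemma int_pow_nonneg:
  assumes "x \<in> carrier G" "x [^] e = \<one>"
  obtains n :: nat where "x [^] (i::int) = x [^] n"
proof -
  have "x [^] i = x [^] (i mod int e)"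
    using assms by (intro int_pow_cong[of _ "int e"]) (simp_all add: int_pow_int)
  also have "\<dots> = x [^] nat (i mod int e)"
    using e_pos by (simp flip: int_pow_int)
  finally show ?thesis using that by blast
qed

lemma A_C_in_CA: "A [^] i \<otimes> C [^] (l::int) \<in> CA" for i :: int
proof -
  obtain k where "C [^] l = C [^] (k::nat)" using int_pow_nonneg[OF C_closed C_e] .
  then show ?thesis by (auto simp: CA_def A_C_pow)
qed

lemma subgroup_CA: "subgroup CA G"
proof (rule subgroupI)
  show "CA \<subseteq> carrier G" by (auto simp: CA_def)
  have "C [^] (0::nat) \<otimes> A [^] (0::int) \<in> CA" unfolding CA_def by blast
  then show "CA \<noteq> {}" by blast
  show "inv x \<in> CA" if "x \<in> CA" for x
  proof -
    obtain k i where "x = C [^] (k::nat) \<otimes> A [^] (i::int)" using \<open>x \<in> CA\<close> by (auto simp: CA_def)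
    then have "inv x = A [^] (- i) \<otimes> C [^] (- int k)"
      by (simp add: inv_mult_group int_pow_neg int_pow_int)
    then show ?thesis by (simp only: A_C_in_CA)
  qed
  show "x \<otimes> y \<in> CA" if "x \<in> CA" "y \<in> CA" for x y
    using that C_A_mult unfolding CA_def by blast
qed

lemma generate_A_subset_CA: "generate G {A} \<subseteq> CA"
  using A_C_in_CA[of _ 0] by (auto simp: generate_pow)

lemma CA_decomp: "x \<in> CA \<Longrightarrow> \<exists>(i::int) (l::int). x = A [^] i \<otimes> C [^] l"
proof -
  assume "x \<in> CA"
  then have "inv x \<in> CA" "x \<in> carrier G"
    using subgroup_CA by (auto simp: subgroup.m_inv_closed subgroup.mem_carrier)
  then obtain k i where "inv x = C [^] (k::nat) \<otimes> A [^] (i::int)" by (auto simp: CA_def)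
  then have "inv (inv x) = A [^] (- i) \<otimes> C [^] (- int k)"
    by (simp add: inv_mult_group int_pow_neg int_pow_int)
  then show ?thesis using \<open>x \<in> carrier G\<close> by (metis inv_inv)
qed

text \<open>The products x B^j with x in \<open>CA\<close> contain 1 and are closed under right
  multiplication by the generators and their inverses, hence they are everything.\<close>

lemma normal_form_CA_B:
  assumes "g \<in> carrier G"
  shows "\<exists>x\<in>CA. \<exists>j::int. g = x \<otimes> B [^] j"
proof -
  interpret CA: subgroup CA G by (rule subgroup_CA)
  define L where "L = {x \<otimes> B [^] (j::int) | x j. x \<in> CA}"
  have L_closed: "L \<subseteq> carrier G" by (auto simp: L_def CA.mem_carrier)
  have right_B: "y \<otimes> B [^] (l::int) \<in> L" if y: "y \<in> L" for y l
  proof -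
    obtain x j where "x \<in> CA" "y = x \<otimes> B [^] (j::int)" using y unfolding L_def by blast
    then have "y \<otimes> B [^] l = x \<otimes> B [^] (j + l)"
      by (simp add: m_assoc CA.mem_carrier int_pow_mult)
    then show ?thesis using \<open>x \<in> CA\<close> unfolding L_def by blast
  qed
  have right_A: "y \<otimes> A \<in> L" if y: "y \<in> L" for y
  proof -
    obtain x j where x: "x \<in> CA" "y = x \<otimes> B [^] (j::int)" using y unfolding L_def by blast
    obtain n where n: "B [^] j = B [^] (n::nat)" using int_pow_nonneg[OF B B_e] .
    \<comment> \<open>Pushing A to the left through B^n leaves C^(-n) and a power of B
      behind.\<close>
    have "B [^] n \<otimes> A = A \<otimes> conjugate G (B [^] int n) A"
      by (simp add: conjugate_def m_assoc int_pow_int)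
    also have "\<dots> = A [^] (1::int) \<otimes> C [^] (- int n) \<otimes> B [^] (\<alpha> * geom_sum \<alpha> n)"
      unfolding conj_B_pow_A by (simp add: m_assoc)
    finally have "y \<otimes> A = (x \<otimes> (A [^] (1::int) \<otimes> C [^] (- int n))) \<otimes> B [^] (\<alpha> * geom_sum \<alpha> n)"
      using x n by (simp add: m_assoc CA.mem_carrier)
    then show ?thesis using x A_C_in_CA[of 1 "- int n"] unfolding L_def by blast
  qed
  have right_A_pow: "y \<otimes> A [^] (n::nat) \<in> L" if "y \<in> L" for y n
  proof (induction n)
    case (Suc n)
    then show ?case using right_A[OF Suc] that L_closed by (auto simp: m_assoc)
  qed (use that L_closed in auto)
  have "\<forall>y\<in>L. y \<otimes> g \<in> L"
  proof -
    have "g \<in> generate G {A, B}" using assms generated by simp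
    then show ?thesis
    proof (induction rule: generate.induct)
      case (incl h)
      then show ?case using right_A right_B[of _ 1] by auto
    next
      case (inv h)
      obtain n where "A [^] (- 1::int) = A [^] (n::nat)" using int_pow_nonneg[OF A A_e] .
      then have "inv A = A [^] n" by (simp add: int_pow_neg)
      moreover have "inv B = B [^] (- 1::int)" by (simp add: int_pow_neg)
      ultimately show ?case using inv right_A_pow[of _ n] right_B[of _ "- 1"] by auto
    next
      case (eng h1 h2)
      then have "h1 \<in> carrier G" "h2 \<in> carrier G" using generated by auto
      then show ?case using eng L_closed by (metis m_assoc subset_iff)
    qed (use L_closed in auto)
  qed
  moreover have "\<one> \<in> L"
  proof -
    have "\<one> = \<one> \<otimes> B [^] (0::int)" by simp
    then show ?thesis unfolding L_def using CA.one_closed by blast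
  qed
  ultimately have "\<one> \<otimes> g \<in> L" by blast
  then show ?thesis using assms unfolding L_def by auto
qed

lemma normal_form:
  assumes "g \<in> carrier G"
  shows "\<exists>(i::int) (k::int) (j::int). g = A [^] i \<otimes> C [^] k \<otimes> B [^] j"
proof -
  obtain x j where x: "x \<in> CA" "g = x \<otimes> B [^] (j::int)" using normal_form_CA_B[OF assms] by blast
  then show ?thesis using CA_decomp[OF x(1)] by blast
qed

lemma finite_carrier: "finite (carrier G)"
proof -
  have fin: "finite (generate G {x})" if x: "x \<in> carrier G" "x [^] e = \<one>" for x
  proof -
    have "generate G {x} \<subseteq> (\<lambda>n. x [^] int n) ` {..<e}"
    proof
      fix y assume "y \<in> generate G {x}"
      then obtain i where "y = x [^] (i::int)" unfolding generate_pow[OF x(1)] by blast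
      moreover have "x [^] i = x [^] (i mod int e)"
        by (rule int_pow_cong[OF x(1), of "int e"]) (simp_all add: int_pow_int x(2))
      ultimately have "y = x [^] int (nat (i mod int e))" using e_pos by simp
      then show "y \<in> (\<lambda>n. x [^] int n) ` {..<e}"
        using e_pos by (intro image_eqI[of _ _ "nat (i mod int e)"]) (simp_all add: nat_less_iff)
    qed
    then show ?thesis by (rule finite_subset) simp
  qed
  have "carrier G \<subseteq> (\<lambda>(x, y, z). x \<otimes> y \<otimes> z) `
      (generate G {A} \<times> generate G {C} \<times> generate G {B})"
  proof
    fix g assume "g \<in> carrier G"
    then obtain i k j :: int where "g = A [^] i \<otimes> C [^] k \<otimes> B [^] j"
      using normal_form by blast
    then show "g \<in> (\<lambda>(x, y, z). x \<otimes> y \<otimes> z) `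
        (generate G {A} \<times> generate G {C} \<times> generate G {B})"
      by (intro image_eqI[of _ _ "(A [^] i, C [^] k, B [^] j)"]) (auto simp: generate_pow)
  qed
  moreover have "finite (generate G {A} \<times> generate G {C} \<times> generate G {B})"
    using fin A_e B_e C_e by simp
  ultimately show ?thesis using finite_surj by blast
qed

text \<open>Two applications of the transversal count along the chain \<open>generate G {A}\<close>,
  \<open>CA\<close>, G; x and y are the two indices. A power of B in the first subgroup also lies in
  the second.\<close>

lemma order_decomp:
  obtains x y where "order G = ord A * x * y"
    and "\<And>l::int. C [^] l \<in> generate G {A} \<Longrightarrow> int x dvd l"
    and "\<And>l::int. B [^] l \<in> generate G {A} \<Longrightarrow> int y dvd l"
proof -
  interpret CA: subgroup CA G by (rule subgroup_CA)
  obtain y where y: "order G = card CA * y" "\<And>l::int. B [^] l \<in> CA \<Longrightarrow> int y dvd l"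
    using index_cyclic_transversal[OF subgroup_CA finite_carrier B normal_form_CA_B] by blast
  let ?K = "G\<lparr>carrier := CA\<rparr>"
  have K: "group ?K" by (rule CA.subgroup_is_group) (rule is_group)
  have C_CA: "C \<in> CA" using A_C_in_CA[of 0 1] by simp
  have "subgroup (generate G {A}) ?K"
    using generate_A_subset_CA by (intro subgroup_incl subgroup_CA generate_is_subgroup) auto
  moreover have "finite (carrier ?K)" using finite_carrier CA.subset finite_subset by auto
  moreover have "\<exists>h\<in>generate G {A}. \<exists>j::int. g = h \<otimes>\<^bsub>?K\<^esub> C [^]\<^bsub>?K\<^esub> j" if "g \<in> carrier ?K" for g
    using CA_decomp[of g] that
    by (auto simp: generate_pow int_pow_consistent[OF subgroup_CA C_CA, symmetric])
  ultimately obtain x where x: "order ?K = card (generate G {A}) * x"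
      "\<And>l::int. C [^]\<^bsub>?K\<^esub> l \<in> generate G {A} \<Longrightarrow> int x dvd l"
    using group.index_cyclic_transversal[OF K, of "generate G {A}" C] C_CA by auto
  show ?thesis
  proof
    show "order G = ord A * x * y"
      using x(1) y(1) by (simp add: order_def generate_pow_card)
  qed (use x(2) y(2) generate_A_subset_CA in
      \<open>auto simp: int_pow_consistent[OF subgroup_CA C_CA, symmetric]\<close>)
qed

end

lemma (in macdonald) torsion:
  assumes "\<alpha> \<noteq> 1" "central_exp \<alpha> \<noteq> 0"
  shows "\<exists>e. macdonald_torsion G A B \<alpha> e"
proof -
  \<comment> \<open>C^t is a power of A and A^((\<alpha> - 1) t) = 1, so (\<alpha> - 1) t^2 kills A,
    B and C alike.\<close>
  define e' where "e' = nat \<bar>(\<alpha> - 1) * central_exp \<alpha> * central_exp \<alpha>\<bar>"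
  have abs_one: "x [^] nat \<bar>n\<bar> = \<one>" if "x \<in> carrier G" "x [^] n = \<one>" for x and n :: int
    using that by (cases "n \<ge> 0") (auto simp: int_pow_neg simp flip: int_pow_int)
  have eq: "(\<alpha> - 1) * central_exp \<alpha> * central_exp \<alpha> = central_exp \<alpha> * ((\<alpha> - 1) * central_exp \<alpha>)"
    by (simp add: mult_ac)
  have "A [^] e' = \<one>" "B [^] e' = \<one>"
    unfolding e'_def by (intro abs_one int_pow_eq_one_mult A_pow_one B_pow_one; simp)+
  moreover have "C [^] e' = \<one>"
  proof -
    obtain i where "C [^] central_exp \<alpha> = A [^] (i::int)"
      using C_central_exp by (auto simp: generate_pow)
    then have "C [^] (central_exp \<alpha> * ((\<alpha> - 1) * central_exp \<alpha>)) = A [^] ((\<alpha> - 1) * central_exp \<alpha> * i)"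
      by (simp add: int_pow_pow[symmetric]) (simp add: int_pow_pow mult_ac)
    then show ?thesis unfolding e'_def eq using int_pow_eq_one_mult[OF A A_pow_one]
      by (intro abs_one) simp_all
  qed
  moreover have "e' > 0" using assms by (simp add: e'_def)
  ultimately show ?thesis by (intro exI[of _ e'] macdonald_torsion.intro macdonald_torsion_axioms.intro macdonald_axioms)
qed

section \<open>Arithmetic of the permutation model\<close>

lemmas poly_simps = algebra_simps power2_eq_square power3_eq_cube

text \<open>The binomials n + 1 over 2 and n + 1 over 3, extended to all integers because they are
  applied to exponents of either sign. For natural n they are the sums of s and of s over 2 for s =
  1, ..., n.\<close>

definition tri :: "int \<Rightarrow> int" where "tri n = n * (n + 1) div 2"
definition tet :: "int \<Rightarrow> int" where "tet n = (n - 1) * n * (n + 1) div 6"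

lemma two_tri: "2 * tri n = n * (n + 1)"
  by (simp add: tri_def)

lemma six_tet: "6 * tet n = (n - 1) * n * (n + 1)"
proof -
  have "3 dvd n - 1 \<or> 3 dvd n \<or> 3 dvd n + 1" by presburger
  then have "3 dvd (n - 1) * n * (n + 1)" by (meson dvd_mult dvd_mult2)
  moreover have "even ((n - 1) * n * (n + 1))" by simp
  ultimately have "2 * 3 dvd (n - 1) * n * (n + 1)"
    by (intro divides_mult) auto
  then show ?thesis by (simp add: tet_def)
qed

lemma tri_double: "tri (2 * a) = a * (2 * a + 1)"
  using two_tri[of "2 * a"] by simp

lemma tri_0 [simp]: "tri 0 = 0" and tet_0 [simp]: "tet 0 = 0"
  by (simp_all add: tri_def tet_def)

section \<open>Binomial expansions up to third order\<close>

lemma choose_2_Suc: "int (Suc n choose 2) = int (n choose 2) + int n"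
  and choose_3_Suc: "int (Suc n choose 3) = int (n choose 3) + int (n choose 2)"
  by (simp_all add: numeral_2_eq_2 numeral_3_eq_3)

lemma two_choose_2: "2 * int (n choose 2) = int n * (int n - 1)"
  by (induction n) (simp_all add: choose_2_Suc algebra_simps)

lemma six_choose_3: "6 * int (n choose 3) = int n * (int n - 1) * (int n - 2)"
proof (induction n)
  case (Suc n)
  then show ?case using two_choose_2[of n] by (simp add: choose_3_Suc algebra_simps)
qed simp

text \<open>The cubic remainder stays unspecified: for g = 2 p u it is a multiple of 8 p^3 and drops
  out modulo 4 p^3.\<close>

lemma power_expansion:
  fixes g :: int
  shows "\<exists>z. (1 + g) ^ n = 1 + int n * g + int (n choose 2) * g ^ 2 + z * g ^ 3"
proof (induction n)
  case (Suc n)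
  then obtain z where "(1 + g) ^ n = 1 + int n * g + int (n choose 2) * g ^ 2 + z * g ^ 3" by blast
  then have "(1 + g) ^ Suc n = 1 + int (Suc n) * g + int (Suc n choose 2) * g ^ 2
      + (int (n choose 2) + z + z * g) * g ^ 3"
    by (simp add: choose_2_Suc poly_simps)
  then show ?case by blast
qed (auto intro: exI[of _ 0])

lemma geom_sum_expansion:
  fixes g :: int
  shows "\<exists>z. (1 + g) * geom_sum (1 + g) n = int n + g * tri (int n) + g ^ 2 * tet (int n) + z * g ^ 3"
proof (induction n)
  case (Suc n)
  then obtain z where z: "(1 + g) * geom_sum (1 + g) n
      = int n + g * tri (int n) + g ^ 2 * tet (int n) + z * g ^ 3" by blast
  have tri: "tri (int (Suc n)) = tri (int n) + int n + 1"
    using two_tri[of "int (Suc n)"] two_tri[of "int n"] by (simp add: algebra_simps)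
  have tet: "tet (int (Suc n)) = tet (int n) + tri (int n)"
    using six_tet[of "int (Suc n)"] six_tet[of "int n"] two_tri[of "int n"] by (simp add: algebra_simps)
  have "(1 + g) * geom_sum (1 + g) (Suc n) = (1 + g) * (1 + (1 + g) * geom_sum (1 + g) n)" by simp
  also have "\<dots> = int (Suc n) + g * tri (int (Suc n)) + g ^ 2 * tet (int (Suc n)) + (tet (int n) + z + z * g) * g ^ 3"
    unfolding z tri tet by (simp add: poly_simps)
  finally show ?case by blast
qed (auto intro: exI[of _ 0])

text \<open>Multiplication by g = \<alpha> - 1 turns the geometric sum into \<alpha>^n - 1. In the
  third-order expansion everything below c^3 cancels, and as g is even the cofactor of 4 c^3 is
  odd.\<close>

lemma central_exp_valuation:
  assumes "c \<noteq> 0"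
  shows "\<exists>\<tau>. odd \<tau> \<and> central_exp (1 + 2 * c) = 2 * c ^ 2 * \<tau>"
proof -
  define g where "g = 2 * c"
  define t where "t = central_exp (1 + g)"
  have "\<exists>\<tau>. odd \<tau> \<and> g * t = 4 * c ^ 3 * \<tau>"
  proof (cases "1 + g \<ge> 0")
    case True
    define n where "n = nat (1 + g)"
    have n: "int n = 1 + g" using True by (simp add: n_def)
    obtain z where z: "(1 + g) ^ n = 1 + int n * g + int (n choose 2) * g ^ 2 + z * g ^ 3"
      using power_expansion by blast
    have n2: "int (n choose 2) = (1 + g) * c"
      using two_choose_2[of n] by (simp add: n g_def)
    have "g * t = (g - 1) * (1 + g) ^ n + 1"
      using True geom_sum_eq[of "1 + g" n] by (simp add: t_def central_exp_def n_def algebra_simps)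
    also have "\<dots> = 4 * c ^ 3 * (2 + (g - 1) * (1 + g + 2 * z))"
      unfolding z n2 n by (simp add: g_def poly_simps)
    finally show ?thesis by (intro exI conjI) (auto simp: g_def)
  next
    case False
    define n where "n = nat (- (1 + g))"
    have n: "int n = - 1 - g" using False by (simp add: n_def)
    obtain z where z: "(1 + g) ^ n = 1 + int n * g + int (n choose 2) * g ^ 2 + z * g ^ 3"
      using power_expansion by blast
    have n2: "int (n choose 2) = (1 + g) * (1 + c)"
      using two_choose_2[of n] by (simp add: n g_def algebra_simps)
    have "g * t = g + (1 + g) ^ n - 1"
      using False geom_sum_eq[of "1 + g" n] by (simp add: t_def central_exp_def n_def algebra_simps)
    also have "\<dots> = 4 * c ^ 3 * (3 + g + 2 * z)"
      unfolding z n2 n by (simp add: g_def poly_simps)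
    finally show ?thesis by (intro exI conjI) (auto simp: g_def)
  qed
  then obtain \<tau> where "odd \<tau>" "g * t = 4 * c ^ 3 * \<tau>" by blast
  then have "2 * c * t = 2 * c * (2 * c ^ 2 * \<tau>)"
    by (simp add: g_def power2_eq_square power3_eq_cube)
  then have "t = 2 * c ^ 2 * \<tau>" using assms by (simp only: mult_cancel_left) simp
  then show ?thesis using \<open>odd \<tau>\<close> by (auto simp: t_def g_def)
qed

text \<open>Here c = m - 1. That p = 2 * r records the evenness of p, which holds because m > 1; r
  is the witness whenever 2 p^4 is written as a multiple of 4 p^3.\<close>

locale model_params =
  fixes p u r :: int and c :: nat
  assumes p_def: "p = 2 * r" and p_power: "p = 2 ^ c" and odd_u: "odd u"
begin

lemma p_pos: "p > 0" by (simp add: p_power)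

lemma M_power: "4 * p ^ 3 = 2 ^ (3 * c + 2)" and q_power: "2 * p ^ 2 = 2 ^ (2 * c + 1)"
  by (simp_all add: p_power power_add power_mult mult.commute[of _ c] flip: power_mult)

lemma p_dvd_cancel_3: "p dvd 3 * x \<Longrightarrow> p dvd x"
proof -
  assume "p dvd 3 * x"
  moreover have "coprime p 3" unfolding p_power by (simp add: coprime_commute)
  ultimately show ?thesis by (simp add: coprime_dvd_mult_right_iff)
qed

text \<open>Six times the difference is a multiple of 2 p by expansion; the 2 takes care of the even
  part of the denominator, and 3 is cancelled because p is a power of 2.\<close>

lemma tet_shift: "\<exists>w. tet (j + 2 * p * h) = tet j + p * w"
proof -
  have "3 * (tet (j + 2 * p * h) - tet j) = p * (h * (3 * j ^ 2 - 1 + 6 * p * j * h + 4 * p ^ 2 * h ^ 2))"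
    using six_tet[of "j + 2 * p * h"] six_tet[of j]
    by (simp add: poly_simps)
  then have "p dvd tet (j + 2 * p * h) - tet j" using p_dvd_cancel_3 by (metis dvd_triv_left)
  then show ?thesis by (metis add_diff_cancel_left' diff_add_cancel dvdE add.commute)
qed

lemma tri_shift: "tri (j + 2 * p * h) = tri j + p * h * (2 * j + 1) + 2 * p ^ 2 * h ^ 2"
  using two_tri[of "j + 2 * p * h"] two_tri[of j] by (simp add: algebra_simps power2_eq_square)

text \<open>A triple \<open>(i, k, j)\<close> stands for the word \<open>A^i C^k B^j\<close>; \<open>fa\<close>, \<open>fb\<close> and \<open>fd\<close> are right
  multiplication by \<open>A\<close>, by \<open>B\<close> and by the inverse of \<open>C\<close>. Two triples have the same \<open>key\<close> if their
  words agree modulo \<open>A^(4 p^3) = 1\<close>, \<open>C^(2 p^2) = A^(2 p^3)\<close> and \<open>B^(2 p^2) = A^(- 2 p^2)\<close>. For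
  \<open>\<alpha> = 1 + 2 p u\<close>, the polynomials \<open>sig j\<close> and \<open>einv k\<close> are \<open>\<alpha> + \<alpha>^2 + \<dots> + \<alpha>^j\<close> and \<open>\<alpha>^(- k)\<close>
  modulo \<open>4 p^3\<close>.\<close>

definition sig :: "int \<Rightarrow> int" where
  "sig j = j + 2 * p * u * tri j + 4 * p ^ 2 * u ^ 2 * tet j"

definition einv :: "int \<Rightarrow> int" where
  "einv k = 1 - 2 * p * u * k + 4 * p ^ 2 * u ^ 2 * tri k"

definition key :: "int \<times> int \<times> int \<Rightarrow> int \<times> int \<times> int" where
  "key = (\<lambda>(i, k, j). ((i - j + p * k) mod (4 * p ^ 3), k mod (2 * p ^ 2), j mod (2 * p ^ 2)))"

abbreviation sim :: "int \<times> int \<times> int \<Rightarrow> int \<times> int \<times> int \<Rightarrow> bool" where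
  "sim v w \<equiv> key v = key w"

definition fa :: "int \<times> int \<times> int \<Rightarrow> int \<times> int \<times> int" where
  "fa = (\<lambda>(i, k, j). (i + einv k, k - j, sig j))"
definition fb :: "int \<times> int \<times> int \<Rightarrow> int \<times> int \<times> int" where
  "fb = (\<lambda>(i, k, j). (i, k, j + 1))"
definition fd :: "int \<times> int \<times> int \<Rightarrow> int \<times> int \<times> int" where
  "fd = (\<lambda>(i, k, j). (i, k - 1, (1 + 2 * p * u) * j))"

section \<open>Compatibility of the right multiplications with \<open>sim\<close>\<close>

lemma simI:
  assumes "i - i' = (j - j') - p * (k - k') + 4 * p ^ 3 * z" "k - k' = 2 * p ^ 2 * x" "j - j' = 2 * p ^ 2 * y"
  shows "sim (i, k, j) (i', k', j')"
proof -
  have "i - j + p * k - (i' - j' + p * k') = 4 * p ^ 3 * z" using assms(1) by (simp add: algebra_simps)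
  then show ?thesis using assms(2,3) by (auto simp: key_def mod_eq_dvd_iff)
qed

lemma simE:
  assumes "sim (i, k, j) (i', k', j')"
  obtains x y z where "k = k' + 2 * p ^ 2 * x" "j = j' + 2 * p ^ 2 * y"
    "i = i' + 2 * p ^ 2 * y - 2 * p ^ 3 * x + 4 * p ^ 3 * z"
proof -
  from assms have "2 * p ^ 2 dvd k - k'" "2 * p ^ 2 dvd j - j'"
    "4 * p ^ 3 dvd i - j + p * k - (i' - j' + p * k')"
    by (simp_all add: key_def mod_eq_dvd_iff)
  then obtain x y z where xyz: "k - k' = 2 * p ^ 2 * x" "j - j' = 2 * p ^ 2 * y"
    and z: "i - j + p * k - (i' - j' + p * k') = 4 * p ^ 3 * z"
    by (elim dvdE) blast
  have k: "k = k' + 2 * p ^ 2 * x" and j: "j = j' + 2 * p ^ 2 * y" using xyz by simp_all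
  have "i = i' + 2 * p ^ 2 * y - 2 * p ^ 3 * x + 4 * p ^ 3 * z"
    using z unfolding k j by (simp add: poly_simps)
  with k j show ?thesis by (rule that)
qed

lemma fa_respects: "sim v v' \<Longrightarrow> sim (fa v) (fa v')"
proof -
  assume "sim v v'"
  moreover obtain i k j i' k' j' where v: "v = (i, k, j)" "v' = (i', k', j')" by (metis prod_cases3)
  ultimately obtain x y z where xyz: "k = k' + 2 * p ^ 2 * x" "j = j' + 2 * p ^ 2 * y"
    "i = i' + 2 * p ^ 2 * y - 2 * p ^ 3 * x + 4 * p ^ 3 * z" using simE by metis
  obtain e where e: "u = 2 * e + 1" using odd_u by (rule oddE)
  have k: "k = k' + 2 * p * (p * x)" and j: "j = j' + 2 * p * (p * y)"
    using xyz by (simp_all add: power2_eq_square)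
  obtain w where w: "tet j = tet j' + p * w" unfolding j using tet_shift by blast
  have tk: "tri k = tri k' + p * (p * x) * (2 * k' + 1) + 2 * p ^ 2 * (p * x) ^ 2"
    unfolding k by (rule tri_shift)
  have tj: "tri j = tri j' + p * (p * y) * (2 * j' + 1) + 2 * p ^ 2 * (p * y) ^ 2"
    unfolding j by (rule tri_shift)
  have E: "einv k - einv k' = 4 * p ^ 3 * (- u * x + p * u ^ 2 * x * (2 * k' + 1) + 2 * p ^ 3 * u ^ 2 * x ^ 2)"
    unfolding einv_def tk unfolding xyz by (simp add: poly_simps)
  have S: "sig j - sig j' = 2 * p ^ 2 * y + 2 * p ^ 3 * u * y + 4 * p ^ 3 * (u * y * j' + p ^ 2 * u * y ^ 2 + u ^ 2 * w)"
    unfolding sig_def tj w unfolding xyz by (simp add: poly_simps)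
  have "sim (i + einv k, k - j, sig j) (i' + einv k', k' - j', sig j')"
  proof (rule simI)
    show "k - j - (k' - j') = 2 * p ^ 2 * (x - y)" using xyz by (simp add: algebra_simps)
    show "sig j - sig j' = 2 * p ^ 2 * (y + p * u * y + 2 * p * (u * y * j' + p ^ 2 * u * y ^ 2 + u ^ 2 * w))"
      unfolding S by (simp add: poly_simps)
    have ii: "i + einv k - (i' + einv k') = (einv k - einv k') + (i - i')" by simp
    show "i + einv k - (i' + einv k') = sig j - sig j' - p * (k - j - (k' - j')) +
      4 * p ^ 3 * (z + (- u * x + p * u ^ 2 * x * (2 * k' + 1) + 2 * p ^ 3 * u ^ 2 * x ^ 2)
        - (u * y * j' + p ^ 2 * u * y ^ 2 + u ^ 2 * w) - (1 + e) * y)"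
      unfolding ii E S unfolding xyz by (simp add: e poly_simps)
  qed
  then show ?thesis by (simp add: fa_def v)
qed

lemma fb_respects: "sim v v' \<Longrightarrow> sim (fb v) (fb v')"
proof -
  assume "sim v v'"
  moreover obtain i k j i' k' j' where v: "v = (i, k, j)" "v' = (i', k', j')" by (metis prod_cases3)
  ultimately obtain x y z where xyz: "k = k' + 2 * p ^ 2 * x" "j = j' + 2 * p ^ 2 * y"
    "i = i' + 2 * p ^ 2 * y - 2 * p ^ 3 * x + 4 * p ^ 3 * z" using simE by metis
  have "sim (i, k, j + 1) (i', k', j' + 1)"
    by (rule simI[where x = x and y = y and z = z])
      (simp_all add: xyz poly_simps)
  then show ?thesis by (simp add: fb_def v)
qed

lemma fd_respects: "sim v v' \<Longrightarrow> sim (fd v) (fd v')"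
proof -
  assume "sim v v'"
  moreover obtain i k j i' k' j' where v: "v = (i, k, j)" "v' = (i', k', j')" by (metis prod_cases3)
  ultimately obtain x y z where xyz: "k = k' + 2 * p ^ 2 * x" "j = j' + 2 * p ^ 2 * y"
    "i = i' + 2 * p ^ 2 * y - 2 * p ^ 3 * x + 4 * p ^ 3 * z" using simE by metis
  have "sim (i, k - 1, (1 + 2 * p * u) * j) (i', k' - 1, (1 + 2 * p * u) * j')"
    by (rule simI[where x = x and y = "(1 + 2 * p * u) * y" and z = "z - u * y"])
      (simp_all add: xyz poly_simps)
  then show ?thesis by (simp add: fd_def v)
qed

text \<open>Reflection makes the induced map on keys injective. For \<open>fa\<close> it is obtained
  later from the finite order of \<open>fa\<close>.\<close>

lemma fb_reflects: "sim (fb v) (fb v') \<Longrightarrow> sim v v'"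
proof -
  assume "sim (fb v) (fb v')"
  moreover obtain i k j i' k' j' where v: "v = (i, k, j)" "v' = (i', k', j')" by (metis prod_cases3)
  ultimately have "sim (i, k, j + 1) (i', k', j' + 1)" by (simp add: fb_def)
  then obtain x y z where xyz: "k = k' + 2 * p ^ 2 * x" "j + 1 = j' + 1 + 2 * p ^ 2 * y"
    "i = i' + 2 * p ^ 2 * y - 2 * p ^ 3 * x + 4 * p ^ 3 * z" using simE by metis
  have "sim (i, k, j) (i', k', j')"
    by (rule simI[where x = x and y = y and z = z])
      (use xyz in \<open>simp_all add: poly_simps\<close>)
  then show ?thesis by (simp add: v)
qed

text \<open>The inverse of \<open>1 + 2 p u\<close> modulo \<open>4 p^3\<close> is \<open>1 - 2 p u + 4 p^2 u^2\<close>.\<close>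

lemma fd_reflects: "sim (fd v) (fd v') \<Longrightarrow> sim v v'"
proof -
  assume "sim (fd v) (fd v')"
  moreover obtain i k j i' k' j' where v: "v = (i, k, j)" "v' = (i', k', j')" by (metis prod_cases3)
  ultimately have s: "sim (i, k - 1, (1 + 2 * p * u) * j) (i', k' - 1, (1 + 2 * p * u) * j')"
    by (simp add: fd_def)
  obtain x y z where xyz: "k - 1 = k' - 1 + 2 * p ^ 2 * x"
    "(1 + 2 * p * u) * j = (1 + 2 * p * u) * j' + 2 * p ^ 2 * y"
    "i = i' + 2 * p ^ 2 * y - 2 * p ^ 3 * x + 4 * p ^ 3 * z" using simE[OF s] by metis
  define b where "b = 1 - 2 * p * u + 4 * p ^ 2 * u ^ 2"
  have "b * ((1 + 2 * p * u) * (j - j')) = b * (2 * p ^ 2 * y)" using xyz by (simp add: algebra_simps)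
  then have "j - j' = 2 * p ^ 2 * (b * y - 4 * p * u ^ 3 * (j - j'))"
    unfolding b_def by (simp add: poly_simps)
  then obtain y' where y': "j - j' = 2 * p ^ 2 * y'" by blast
  then have "(1 + 2 * p * u) * (2 * p ^ 2 * y') = 2 * p ^ 2 * y" using xyz by (simp add: algebra_simps)
  then have eq: "(2 * p ^ 2) * y = (2 * p ^ 2) * ((1 + 2 * p * u) * y')" by (simp only: mult_ac)
  have "2 * p ^ 2 \<noteq> 0" using p_pos by simp
  from mult_left_cancel[OF this, THEN iffD1, OF eq] have yy: "y = (1 + 2 * p * u) * y'" .
  have "sim (i, k, j) (i', k', j')"
    by (rule simI[where x = x and y = y' and z = "z + u * y'"])
      (use xyz y' in \<open>simp_all add: yy poly_simps\<close>)
  then show ?thesis by (simp add: v)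
qed

text \<open>The exponents of \<open>fa ^^ n\<close>, found by iterating \<open>fa\<close> and dropping all terms that \<open>sim\<close> ignores.\<close>

definition T where
  "T n j = int n + 2 * p * u * j * int (n choose 2)
    + 4 * p ^ 2 * u ^ 2 * ((tri j + j ^ 2) * int (n choose 3) + int (n choose 2) * tri (j - 1))"
definition K where
  "K n j = int n * j + 2 * p * u * int (n choose 2) * tri j + 2 * p ^ 2 * int (n choose 3) * tri j"
definition F where
  "F n j = j + 2 * p * u * int n * tri j + 4 * p ^ 2 * u ^ 2 * int n * tet j
    + 2 * p ^ 2 * u ^ 2 * int (n choose 2) * tri j * (2 * j + 1) + 2 * p ^ 3 * int (n choose 3) * tri j"

text \<open>The step from n to n + 1 in the third component. Iterating \<open>sig\<close> puts the
  odd factor u^3 (2 j + 1)^2 on a term with 2 p^3; modulo 4 p^3 such a factor may be replaced by 1,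
  hence the simple last term of \<open>F\<close>.\<close>

lemma sig_F: "\<exists>z. sig (F n j) = F (Suc n) j + 4 * p ^ 3 * z"
proof -
  define n2 where "n2 = int (n choose 2)"
  define n3 where "n3 = int (n choose 3)"
  define h where "h = u * int n * tri j + 2 * p * u ^ 2 * int n * tet j
    + p * u ^ 2 * n2 * tri j * (2 * j + 1) + p ^ 2 * n3 * tri j"
  have F: "F n j = j + 2 * p * h"
    by (simp add: F_def h_def n2_def n3_def poly_simps)
  obtain w where w: "tet (j + 2 * p * h) = tet j + p * w" using tet_shift by blast
  have "odd (u ^ 3 * (2 * j + 1) ^ 2)" using odd_u by simp
  then obtain e where e: "u ^ 3 * (2 * j + 1) ^ 2 = 2 * e + 1" by (rule oddE)
  have "sig (F n j) - F (Suc n) j = 4 * p ^ 3 * (u * h ^ 2 + u ^ 2 * w + u ^ 3 * int n * tet j * (2 * j + 1))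
      + 2 * p ^ 3 * n2 * tri j * (u ^ 3 * (2 * j + 1) ^ 2 - 1) + 2 * p ^ 4 * u * n3 * tri j * (2 * j + 1)"
    unfolding sig_def F tri_shift w unfolding F_def choose_2_Suc choose_3_Suc n2_def[symmetric] n3_def[symmetric]
    unfolding h_def by (simp add: poly_simps power4_eq_xxxx)
  also have "\<dots> = 4 * p ^ 3 * (u * h ^ 2 + u ^ 2 * w + u ^ 3 * int n * tet j * (2 * j + 1)
      + n2 * tri j * e + r * u * n3 * tri j * (2 * j + 1))"
    unfolding e p_def by (simp add: poly_simps power4_eq_xxxx)
  finally show ?thesis by (metis diff_add_cancel add.commute)
qed

text \<open>The modulus is 4 p^2 and not 2 p^2: the second component enters the first entry of
  \<open>key\<close> with a factor p, and that entry is taken modulo 4 p^3.\<close>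

lemma K_F: "\<exists>z. K n j + F n j = K (Suc n) j + 4 * p ^ 2 * z"
proof -
  define n2 where "n2 = int (n choose 2)"
  define n3 where "n3 = int (n choose 3)"
  have "odd (u ^ 2 * (2 * j + 1))" using odd_u by simp
  then obtain e where e: "u ^ 2 * (2 * j + 1) = 2 * e + 1" by (rule oddE)
  have "K n j + F n j - K (Suc n) j = 2 * p ^ 2 * n2 * tri j * (u ^ 2 * (2 * j + 1) - 1)
      + 4 * p ^ 2 * u ^ 2 * int n * tet j + 2 * p ^ 3 * n3 * tri j"
    unfolding K_def F_def choose_2_Suc choose_3_Suc n2_def[symmetric] n3_def[symmetric]
    by (simp add: poly_simps)
  also have "\<dots> = 4 * p ^ 2 * (n2 * tri j * e + u ^ 2 * int n * tet j + r * n3 * tri j)"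
    unfolding e p_def by (simp add: poly_simps)
  finally show ?thesis by (metis diff_add_cancel add.commute)
qed

lemma tri_minus: "tri (a - 2 * b) = tri a - 2 * a * b + b * (2 * b - 1)"
  using two_tri[of "a - 2 * b"] two_tri[of a] by (simp add: algebra_simps)

text \<open>As \<open>einv k\<close> imitates \<alpha>^(-k), the increment of \<open>T\<close> has
  to imitate \<alpha>^(K n j).\<close>

lemma einv_K: "\<exists>z. einv (k - K n j) = einv k * (T (Suc n) j - T n j) + 4 * p ^ 3 * z"
proof -
  define N where "N = int n"
  define n2 where "n2 = int (n choose 2)"
  define n3 where "n3 = int (n choose 3)"
  define x where "x = k - N * j"
  define y where "y = n2 * j ^ 2 + N * tri (j - 1)"
  define s where "s = u * n2 * tri j + p * n3 * tri j"
  have kK: "k - K n j = x - 2 * (p * s)"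
    by (simp add: K_def x_def N_def s_def n2_def n3_def algebra_simps power2_eq_square)
  have n2: "2 * n2 = N * (N - 1)" unfolding n2_def N_def by (rule two_choose_2)
  have "2 * tri x = 2 * (tri k - k * N * j + y)"
  proof -
    have "2 * y = (2 * n2) * j ^ 2 + N * (2 * tri (j - 1))" by (simp add: y_def algebra_simps)
    also have "\<dots> = N * j * (N * j - 1)"
      unfolding n2 two_tri by (simp add: algebra_simps power2_eq_square)
    finally show ?thesis using two_tri[of x] two_tri[of k] by (simp add: x_def algebra_simps)
  qed
  then have x: "tri x = tri k - k * N * j + y" by simp
  have T: "T (Suc n) j - T n j = 1 + 2 * p * u * j * N + 4 * p ^ 2 * u ^ 2 * (tri j * n2 + y)"
    unfolding T_def choose_2_Suc choose_3_Suc n2_def[symmetric] n3_def[symmetric] y_def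
    by (simp add: N_def algebra_simps)
  have "einv (k - K n j) - einv k * (T (Suc n) j - T n j)
    = 4 * p ^ 3 * (u * n3 * tri j + u ^ 2 * (s * (2 * p * s - 1) - 2 * s * x)
      - 2 * (u ^ 3 * tri k * j * N + 2 * p * u ^ 4 * tri k * (tri j * n2 + y) - u ^ 3 * k * (tri j * n2 + y)))"
    unfolding kK T einv_def tri_minus x unfolding x_def s_def
    by (simp add: poly_simps power4_eq_xxxx)
  then show ?thesis by (metis diff_add_cancel add.commute)
qed

text \<open>Induction by the three recursions above, whose errors are multiples of 4 p^3, 4 p^2 and
  4 p^3 and vanish in \<open>key\<close>.\<close>

lemma fa_pow: "sim ((fa ^^ n) (i, k, j)) (i + einv k * T n j, k - K n j, F n j)"
proof (induction n)
  case 0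
  show ?case by (simp add: T_def K_def F_def binomial_eq_0)
next
  case (Suc n)
  obtain z1 where z1: "sig (F n j) = F (Suc n) j + 4 * p ^ 3 * z1" using sig_F by blast
  obtain z2 where z2: "K n j + F n j = K (Suc n) j + 4 * p ^ 2 * z2" using K_F by blast
  obtain z3 where z3: "einv (k - K n j) = einv k * (T (Suc n) j - T n j) + 4 * p ^ 3 * z3"
    using einv_K by blast
  have "sim ((fa ^^ Suc n) (i, k, j)) (fa (i + einv k * T n j, k - K n j, F n j))"
    using fa_respects[OF Suc] by simp
  also have "fa (i + einv k * T n j, k - K n j, F n j)
    = (i + einv k * T n j + einv (k - K n j), k - K n j - F n j, sig (F n j))"
    by (simp add: fa_def)
  also have "sim \<dots> (i + einv k * T (Suc n) j, k - K (Suc n) j, F (Suc n) j)"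
  proof (rule simI)
    show "k - K n j - F n j - (k - K (Suc n) j) = 2 * p ^ 2 * (- 2 * z2)" using z2 by simp
    show "sig (F n j) - F (Suc n) j = 2 * p ^ 2 * (2 * p * z1)"
      using z1 by (simp add: power2_eq_square power3_eq_cube)
    have d: "k - K n j - F n j - (k - K (Suc n) j) = - 4 * p ^ 2 * z2" using z2 by simp
    show "i + einv k * T n j + einv (k - K n j) - (i + einv k * T (Suc n) j)
      = sig (F n j) - F (Suc n) j - p * (k - K n j - F n j - (k - K (Suc n) j))
        + 4 * p ^ 3 * (z3 - z1 - z2)"
      unfolding d z1 z3 by (simp add: poly_simps)
  qed
  finally show ?case .
qed

section \<open>The defining relations for the right multiplications\<close>

lemma sig_Suc: "\<exists>z. sig (j + 1) = (1 + 2 * p * u) * (sig j + 1) + 4 * p ^ 3 * z"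
proof -
  have tri: "tri (j + 1) = tri j + j + 1"
    using two_tri[of "j + 1"] two_tri[of j] by (simp add: algebra_simps)
  have tet: "tet (j + 1) = tet j + tri j"
    using six_tet[of "j + 1"] six_tet[of j] two_tri[of j] by (simp add: algebra_simps)
  have "sig (j + 1) = (1 + 2 * p * u) * (sig j + 1) + 4 * p ^ 3 * (- 2 * u ^ 3 * tet j)"
    unfolding sig_def tri tet by (simp add: poly_simps)
  then show ?thesis by blast
qed

text \<open>In terms of words this is A B C^(-1) = B A, the definition of C; the innermost map is
  the first letter.\<close>

lemma rel_ab: "sim (fd (fb (fa v))) (fa (fb v))"
proof -
  obtain i k j where v: "v = (i, k, j)" by (metis prod_cases3)
  obtain z where z: "sig (j + 1) = (1 + 2 * p * u) * (sig j + 1) + 4 * p ^ 3 * z" using sig_Suc by blast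
  have "sim (i + einv k, k - j - 1, (1 + 2 * p * u) * (sig j + 1)) (i + einv k, k - (j + 1), sig (j + 1))"
    by (rule simI[where x = 0 and y = "- 2 * p * z" and z = z])
      (unfold z, simp_all add: poly_simps)
  then show ?thesis by (simp add: fd_def fb_def fa_def v)
qed

lemma fb_pow: "(fb ^^ n) (i, k, j) = (i, k, j + int n)"
  by (induction n) (simp_all add: fb_def)

lemma fd_pow: "(fd ^^ n) (i, k, 0) = (i, k - int n, 0)"
  by (induction n) (simp_all add: fd_def)

lemma fa_pow_0: "(fa ^^ n) (i, 0, 0) = (i + int n, 0, 0)"
  by (induction n) (simp_all add: fa_def einv_def sig_def)

text \<open>In terms of words: B C^(-1) = C^(-1) B^\<alpha>, the relation for B.\<close>

lemma rel_bd:
  assumes "int n = 1 + 2 * p * u"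
  shows "fd (fb v) = (fb ^^ n) (fd v)"
proof -
  obtain i k j where v: "v = (i, k, j)" by (metis prod_cases3)
  show ?thesis by (simp add: v fd_def fb_pow assms) (simp add: fb_def algebra_simps)
qed

text \<open>In terms of words: C^(-1) A = A^\<alpha> C^(-1), the relation for A. It is the only one
  of the three that uses the closed form of \<open>fa ^^ n\<close>.\<close>

lemma rel_da:
  assumes n: "int n = 1 + 2 * p * u"
  shows "sim (fa (fd v)) (fd ((fa ^^ n) v))"
proof -
  obtain i k j where v: "v = (i, k, j)" by (metis prod_cases3)
  define a where "a = 1 + 2 * p * u"
  define f where "f = tri j"
  have n2: "int (n choose 2) = a * p * u"
    using two_choose_2[of n] by (simp add: n a_def)
  \<comment> \<open>As n - 1 = 2 p u, the binomial n over 3 is a multiple of p, so each term of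
    \<open>T\<close>, \<open>K\<close> and \<open>F\<close> that contains it gains a factor
    p.\<close>
  have "3 * int (n choose 3) = p * (a * u * (2 * p * u - 1))"
    using six_choose_3[of n] by (simp add: n a_def algebra_simps)
  then obtain w where n3: "int (n choose 3) = p * w" using p_dvd_cancel_3 by (metis dvdE dvd_triv_left)
  have jj: "j ^ 2 = 2 * f - j" using two_tri[of j] by (simp add: f_def power2_eq_square algebra_simps)
  have ta: "tri (a * j) = a * (f + p * u * j ^ 2)"
    using two_tri[of "a * j"] two_tri[of j] by (simp add: f_def a_def algebra_simps power2_eq_square)
  have "6 * tet (a * j) - a * (6 * tet j) = 2 * (p * (2 * u * (1 + p * u) * a * j ^ 3))"
    unfolding six_tet by (simp add: a_def poly_simps)
  then have "3 * (tet (a * j) - a * tet j) = p * (2 * u * (1 + p * u) * a * j ^ 3)"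
    by (simp only: right_diff_distrib)
  then have "p dvd tet (a * j) - a * tet j" using p_dvd_cancel_3 by (metis dvd_triv_left)
  then obtain w' where "tet (a * j) - a * tet j = p * w'" by blast
  then have wa: "tet (a * j) = a * tet j + p * w'" by simp
  have tk: "tri (k - 1) = tri k - k"
    using two_tri[of "k - 1"] two_tri[of k] by (simp add: algebra_simps)
  have "odd (u ^ 2)" "odd (u ^ 3 * a ^ 2 * (2 * j + 1))" using odd_u by (simp_all add: a_def)
  then obtain e e' where e: "u ^ 2 = 2 * e + 1" and e': "u ^ 3 * a ^ 2 * (2 * j + 1) = 2 * e' + 1"
    by (elim oddE) blast
  define t where "t = u ^ 2 * ((f + j ^ 2) * w + a * u * tri (j - 1))"
  define x where "x = - u * k + 2 * p * u ^ 2 * tri k"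
  \<comment> \<open>The cofactors of 4 p^3 in the differences of the first component, of p times the
    second, and of the third. What is left, -2 p^2 u^2 j and multiples of 2 p^3 f, cancels in
    \<open>key\<close> up to 4 p^3 f.\<close>
  define zi where "zi = - (u ^ 3 * j) - x * u ^ 2 * a * j - t * (1 + 2 * p * x) - 2 * u ^ 3 * tri k"
  define zk where "zk = e * f + p * u ^ 3 * f + r * w * f"
  define zj where "zj = - (u ^ 3 * j) - e' * f - 2 * u ^ 3 * a * tet j + u ^ 2 * w' - r * a * w * f"
  have T: "T n j = a + 2 * p ^ 2 * u ^ 2 * a * j + 4 * p ^ 3 * t"
    unfolding T_def n2 n3 t_def f_def n a_def by (simp add: poly_simps)
  have ek: "einv k = 1 + 2 * p * x" unfolding einv_def x_def by (simp add: algebra_simps power2_eq_square)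
  have ek1: "einv (k - 1) = einv k * a - 8 * p ^ 3 * u ^ 3 * tri k"
    unfolding einv_def tk a_def by (simp add: poly_simps)
  have I: "einv (k - 1) - einv k * T n j = - 2 * p ^ 2 * u ^ 2 * j + 4 * p ^ 3 * zi"
    unfolding ek1 T unfolding ek zi_def a_def by (simp add: poly_simps)
  have K0: "K n j - a * j = 2 * p ^ 2 * (u ^ 2 * f + 2 * p * u ^ 3 * f + p * w * f)"
    unfolding K_def n2 n3 n a_def f_def by (simp add: poly_simps)
  then have K: "p * (K n j - a * j) = 2 * p ^ 3 * f + 4 * p ^ 3 * zk"
    unfolding K0 e zk_def by (simp add: p_def poly_simps)
  have "sig (a * j) - a * F n j = - 2 * p ^ 2 * u ^ 2 * a * (2 * f - j ^ 2) - 2 * p ^ 3 * f * (u ^ 3 * a ^ 2 * (2 * j + 1))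
     + 4 * p ^ 3 * (- 2 * u ^ 3 * a * tet j + u ^ 2 * w') - 2 * p ^ 4 * a * w * f"
    unfolding sig_def ta wa F_def n2 n3 n f_def[symmetric] a_def[symmetric]
    by (simp add: a_def poly_simps power4_eq_xxxx)
  also have "\<dots> = - 2 * p ^ 2 * u ^ 2 * j - 2 * p ^ 3 * f + 4 * p ^ 3 * zj"
    unfolding e' jj zj_def by (simp add: a_def p_def poly_simps power4_eq_xxxx)
  finally have J: "sig (a * j) - a * F n j = - 2 * p ^ 2 * u ^ 2 * j - 2 * p ^ 3 * f + 4 * p ^ 3 * zj" .
  have "sim (i + einv (k - 1), k - 1 - a * j, sig (a * j)) (i + einv k * T n j, k - K n j - 1, a * F n j)"
  proof (rule simI)
    show "k - 1 - a * j - (k - K n j - 1) = 2 * p ^ 2 * (u ^ 2 * f + 2 * p * u ^ 3 * f + p * w * f)"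
      using K0 by simp
    show "sig (a * j) - a * F n j = 2 * p ^ 2 * (- (u ^ 2 * j) - p * f + 2 * p * zj)"
      unfolding J by (simp add: poly_simps)
    have "i + einv (k - 1) - (i + einv k * T n j) = einv (k - 1) - einv k * T n j" by simp
    moreover have "p * (k - 1 - a * j - (k - K n j - 1)) = p * (K n j - a * j)" by simp
    ultimately show "i + einv (k - 1) - (i + einv k * T n j) = sig (a * j) - a * F n j
        - p * (k - 1 - a * j - (k - K n j - 1)) + 4 * p ^ 3 * (zi - zj + zk + f)"
      by (simp only: I J K) (simp add: algebra_simps)
  qed
  also have "(i + einv k * T n j, k - K n j - 1, a * F n j) = fd (i + einv k * T n j, k - K n j, F n j)"
    by (simp add: fd_def a_def)
  also have "sim \<dots> (fd ((fa ^^ n) v))"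
    unfolding v by (rule fd_respects, rule sym, rule fa_pow)
  finally show ?thesis by (simp add: fa_def fd_def v a_def)
qed

text \<open>For this n even n over 3 is divisible by 4 p^3, since 3 is invertible modulo a power of
  2, and all terms of the closed form but the starting triple disappear under \<open>sim\<close>.
  The result gives A^(4 p^3) = 1 in the model and also an inverse of \<open>fa\<close>.\<close>

lemma fa_pow_exponent:
  assumes n: "int n = 4 * p ^ 3"
  shows "sim ((fa ^^ n) v) v"
proof -
  obtain i k j where v: "v = (i, k, j)" by (metis prod_cases3)
  have n2: "int (n choose 2) = 2 * p ^ 3 * (4 * p ^ 3 - 1)"
    using two_choose_2[of n] by (simp add: n)
  define b where "b = (4 * p ^ 3 - 1) * (2 * p ^ 3 - 1)"
  have "3 * int (n choose 3) = 4 * p ^ 3 * b"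
    using six_choose_3[of n] by (simp add: n b_def algebra_simps)
  moreover have "coprime (4 * p ^ 3) 3" unfolding M_power coprime_power_left_iff by simp
  ultimately have "4 * p ^ 3 dvd int (n choose 3)"
    by (metis coprime_dvd_mult_right_iff dvd_triv_left)
  then obtain w where n3: "int (n choose 3) = 4 * p ^ 3 * w" by blast
  define t where "t = 1 + p * u * j * (4 * p ^ 3 - 1)
    + u ^ 2 * (4 * p ^ 2 * w * (tri j + j ^ 2) + 2 * p ^ 2 * (4 * p ^ 3 - 1) * tri (j - 1))"
  define x where "x = p * j + p ^ 2 * u * (4 * p ^ 3 - 1) * tri j + 2 * p ^ 3 * w * tri j"
  define y where "y = 2 * p * u * tri j + 4 * p ^ 2 * u ^ 2 * tet j
    + p ^ 2 * u ^ 2 * (4 * p ^ 3 - 1) * tri j * (2 * j + 1) + 2 * p ^ 3 * w * tri j"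
  have T: "T n j = 4 * p ^ 3 * t"
    unfolding T_def n2 n3 n t_def by (simp add: poly_simps)
  have K: "K n j = 2 * p ^ 2 * (2 * x)"
    unfolding K_def n2 n3 n x_def by (simp add: poly_simps)
  have F: "F n j = j + 2 * p ^ 2 * (2 * p * y)"
    unfolding F_def n2 n3 n y_def by (simp add: poly_simps)
  have "sim (i + einv k * T n j, k - K n j, F n j) (i, k, j)"
    by (rule simI[where x = "- 2 * x" and y = "2 * p * y" and z = "einv k * t - y - x"])
      (simp_all add: T K F poly_simps)
  then show ?thesis using fa_pow[of n i k j] by (simp add: v)
qed

end

section \<open>The permutation model\<close>

text \<open>Right multiplications compose in the opposite order, so a, b and d satisfy the relations
  between A, B and C^(-1) in the opposite group. Passing to inverses restores the order, and d
  becomes the commutator of the new generators.\<close>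

lemma (in group) macdonald_of_inverses:
  assumes a: "a \<in> carrier G" and b: "b \<in> carrier G" and d: "d \<in> carrier G"
    and ab: "d \<otimes> b \<otimes> a = a \<otimes> b" and bd: "d \<otimes> b = b [^] (\<alpha>::int) \<otimes> d" and ad: "a \<otimes> d = d \<otimes> a [^] \<alpha>"
  shows "macdonald (G\<lparr>carrier := generate G {inv a, inv b}\<rparr>) (inv a) (inv b) \<alpha>"
proof -
  let ?K = "generate G {inv a, inv b}"
  let ?P = "G\<lparr>carrier := ?K\<rparr>"
  have K: "subgroup ?K G" using a b by (intro generate_is_subgroup) auto
  interpret K: subgroup ?K G by (rule K)
  have mem: "inv a \<in> ?K" "inv b \<in> ?K" by (auto intro: generate.incl)
  have d_eq: "d = a \<otimes> b \<otimes> inv a \<otimes> inv b"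
    using a b d by (simp add: ab[symmetric] m_assoc)
  have comm: "commutator G (inv a) (inv b) = d" "commutator G (inv b) (inv a) = inv d"
    using a b by (simp_all add: commutator_def d_eq inv_mult_group m_assoc)
  have "inv d \<otimes> a \<otimes> d = a [^] \<alpha>" "d \<otimes> b \<otimes> inv d = b [^] \<alpha>"
    using a b d ad bd by (simp_all add: m_assoc)
  then have "conjugate G (inv a) d = inv (a [^] \<alpha>)" "conjugate G (inv b) (inv d) = inv (b [^] \<alpha>)"
    using a b d by (simp_all add: conjugate_inv) (simp_all add: conjugate_def)
  then have rel: "conjugate G (inv a) (commutator G (inv a) (inv b)) = inv a [^] \<alpha>"
    "conjugate G (inv b) (commutator G (inv b) (inv a)) = inv b [^] \<alpha>"
    using a b by (simp_all add: comm int_pow_inv)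
  have inv_P: "inv\<^bsub>?P\<^esub> x = inv x" if "x \<in> ?K" for x
    using K that by (rule m_inv_consistent)
  have comm_P: "commutator ?P x y = commutator G x y" if "x \<in> ?K" "y \<in> ?K" for x y
    using that by (simp add: commutator_def inv_P)
  have conj_P: "conjugate ?P x y = conjugate G x y" if "x \<in> ?K" "y \<in> ?K" for x y
    using that by (simp add: conjugate_def inv_P)
  have comm_mem: "commutator G x y \<in> ?K" if "x \<in> ?K" "y \<in> ?K" for x y
    using that by (simp add: commutator_def)
  have "group ?P" by (rule K.subgroup_is_group) (rule is_group)
  then show ?thesis
  proof (intro macdonald.intro macdonald_axioms.intro)
    show "carrier ?P = generate ?P {inv a, inv b}"
      using generate_consistent[of "{inv a, inv b}" ?K] K mem by simp
  qed (use mem in \<open>simp_all add: comm_P conj_P comm_mem rel int_pow_consistent[OF K, symmetric]\<close>)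
qed

section \<open>Permutations of the set of keys\<close>

context model_params
begin

definition box :: "(int \<times> int \<times> int) set" where
  "box = {0..<4 * p ^ 3} \<times> {0..<2 * p ^ 2} \<times> {0..<2 * p ^ 2}"

text \<open>A section of \<open>key\<close>: it undoes the linear change of the first
  coordinate.\<close>

definition sec :: "int \<times> int \<times> int \<Rightarrow> int \<times> int \<times> int" where
  "sec = (\<lambda>(w, k, j). (w + j - p * k, k, j))"

definition act :: "(int \<times> int \<times> int \<Rightarrow> int \<times> int \<times> int) \<Rightarrow> int \<times> int \<times> int \<Rightarrow> int \<times> int \<times> int" where
  "act f = (\<lambda>x\<in>box. key (f (sec x)))"

lemma key_in_box [simp, intro]: "key v \<in> box"
  using p_pos by (simp add: key_def box_def split: prod.splits)

lemma key_sec: "x \<in> box \<Longrightarrow> key (sec x) = x"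
  by (auto simp: key_def box_def sec_def)

lemma finite_box: "finite box"
  by (simp add: box_def)

lemma card_box: "card box = 16 * nat p ^ 7"
proof -
  have "p = int (nat p)" using p_pos by simp
  then have "nat (4 * p ^ 3) = 4 * nat p ^ 3" "nat (2 * p ^ 2) = 2 * nat p ^ 2"
    by (metis nat_int of_nat_mult of_nat_numeral of_nat_power)+
  then show ?thesis
    by (simp add: box_def card_cartesian_product power_add[symmetric] flip: power_add)
qed

lemma act_key:
  assumes "\<And>v w. sim v w \<Longrightarrow> sim (f v) (f w)"
  shows "act f (key v) = key (f v)"
  using assms[of "sec (key v)" v] by (simp add: act_def key_sec)

lemma act_Bij:
  assumes resp: "\<And>v w. sim v w \<Longrightarrow> sim (f v) (f w)" and refl: "\<And>v w. sim (f v) (f w) \<Longrightarrow> sim v w"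
  shows "act f \<in> Bij box"
proof -
  have "inj_on (act f) box"
  proof (rule inj_onI)
    fix x y assume xy: "x \<in> box" "y \<in> box" "act f x = act f y"
    then have "sim (f (sec x)) (f (sec y))" by (simp add: act_def)
    then have "sim (sec x) (sec y)" by (rule refl)
    then show "x = y" using xy by (simp add: key_sec)
  qed
  moreover have "act f ` box \<subseteq> box" by (auto simp: act_def)
  ultimately have "bij_betw (act f) box box"
    using finite_box by (simp add: bij_betw_def endo_inj_surj)
  then show ?thesis by (simp add: Bij_def act_def)
qed

lemma fa_pow_respects: "sim v w \<Longrightarrow> sim ((fa ^^ n) v) ((fa ^^ n) w)"
proof (induction n)
  case (Suc n)
  then show ?case unfolding funpow.simps o_apply by (intro fa_respects)
qed simp

text \<open>By \<open>fa_pow_exponent\<close>, another 4 p^3 - 1 applications of \<open>fa\<close>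
  undo the first one up to \<open>sim\<close>.\<close>

lemma fa_reflects:
  assumes "sim (fa v) (fa w)"
  shows "sim v w"
proof -
  define n where "n = nat (4 * p ^ 3) - 1"
  have n: "int (Suc n) = 4 * p ^ 3" using p_pos by (simp add: n_def)
  have "sim ((fa ^^ n) (fa v)) ((fa ^^ n) (fa w))" using assms by (rule fa_pow_respects)
  then have "sim ((fa ^^ Suc n) v) ((fa ^^ Suc n) w)" by (simp only: funpow_Suc_right o_apply)
  then show ?thesis using fa_pow_exponent[OF n] by simp
qed

abbreviation symg :: "(int \<times> int \<times> int \<Rightarrow> int \<times> int \<times> int) monoid" where
  "symg \<equiv> BijGroup box"

lemma act_fa [simp, intro]: "act fa \<in> carrier symg"
  and act_fb [simp, intro]: "act fb \<in> carrier symg"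
  and act_fd [simp, intro]: "act fd \<in> carrier symg"
  using act_Bij[of fa, OF fa_respects fa_reflects] act_Bij[of fb, OF fb_respects fb_reflects]
    act_Bij[of fd, OF fd_respects fd_reflects] by (simp_all add: BijGroup_def)

lemma sym_eqI:
  assumes "f \<in> carrier symg" "g \<in> carrier symg" "\<And>v. f (key v) = g (key v)"
  shows "f = g"
proof (rule extensionalityI[of _ box])
  fix x assume "x \<in> box"
  then show "f x = g x" using assms(3)[of "sec x"] by (simp add: key_sec)
qed (use assms in \<open>simp_all add: BijGroup_def Bij_def\<close>)

lemma sym_mult: "f \<in> carrier symg \<Longrightarrow> g \<in> carrier symg \<Longrightarrow> (f \<otimes>\<^bsub>symg\<^esub> g) (key v) = f (g (key v))"
  by (simp add: BijGroup_def compose_def)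

lemma sym_one: "\<one>\<^bsub>symg\<^esub> (key v) = key v"
  by (simp add: BijGroup_def)

lemmas act_simps = act_key[of fa, OF fa_respects] act_key[of fb, OF fb_respects] act_key[of fd, OF fd_respects]

lemma sym_pow:
  assumes "act f \<in> carrier symg" "\<And>v w. sim v w \<Longrightarrow> sim (f v) (f w)"
  shows "(act f [^]\<^bsub>symg\<^esub> (n::nat)) (key v) = key ((f ^^ n) v)"
proof -
  interpret H: group "BijGroup box" by (rule group_BijGroup)
  have key_f: "act f (key v) = key (f v)" for v by (rule act_key) (rule assms(2))
  show ?thesis
  proof (induction n arbitrary: v)
    case 0
    show ?case by (simp add: sym_one)
  next
    case (Suc n)
    have "(act f [^]\<^bsub>symg\<^esub> Suc n) (key v) = (act f [^]\<^bsub>symg\<^esub> n) (key (f v))"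
      using assms(1) by (simp add: sym_mult key_f)
    also have "\<dots> = key ((f ^^ Suc n) v)"
      unfolding Suc by (simp add: funpow_swap1)
    finally show ?case .
  qed
qed

lemmas act_pow = sym_pow[OF act_fa fa_respects] sym_pow[OF act_fb fb_respects] sym_pow[OF act_fd fd_respects]

text \<open>Composition in \<open>BijGroup\<close> is a left action, so the generators are the inverses of the right
  multiplications.\<close>

definition model :: "(int \<times> int \<times> int \<Rightarrow> int \<times> int \<times> int) monoid" where
  "model = symg\<lparr>carrier := generate symg {inv\<^bsub>symg\<^esub> act fa, inv\<^bsub>symg\<^esub> act fb}\<rparr>"

text \<open>\<alpha> is a natural number here because powers of right multiplications are computed
  as iterates; \<open>macdonald_2_exists\<close> covers the general case.\<close>

lemma macdonald_model:
  assumes n: "int n = 1 + 2 * p * u"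
  shows "macdonald model (inv\<^bsub>symg\<^esub> act fa) (inv\<^bsub>symg\<^esub> act fb) (1 + 2 * p * u)"
proof -
  interpret H: group "BijGroup box" by (rule group_BijGroup)
  show ?thesis
    unfolding model_def n[symmetric]
  proof (rule H.macdonald_of_inverses)
    show "act fd \<otimes>\<^bsub>symg\<^esub> act fb \<otimes>\<^bsub>symg\<^esub> act fa = act fa \<otimes>\<^bsub>symg\<^esub> act fb"
      by (rule sym_eqI) (simp_all add: sym_mult act_simps rel_ab)
    show "act fd \<otimes>\<^bsub>symg\<^esub> act fb = act fb [^]\<^bsub>symg\<^esub> int n \<otimes>\<^bsub>symg\<^esub> act fd"
      by (rule sym_eqI) (simp_all add: int_pow_int sym_mult act_simps act_pow rel_bd[OF n])
    show "act fa \<otimes>\<^bsub>symg\<^esub> act fd = act fd \<otimes>\<^bsub>symg\<^esub> act fa [^]\<^bsub>symg\<^esub> int n"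
      by (rule sym_eqI) (simp_all add: int_pow_int sym_mult act_simps act_pow rel_da[OF n])
  qed simp_all
qed

lemma model_pow:
  "inv\<^bsub>symg\<^esub> act fa [^]\<^bsub>model\<^esub> nat (4 * p ^ 3) = \<one>\<^bsub>model\<^esub>"
  "inv\<^bsub>symg\<^esub> act fb [^]\<^bsub>model\<^esub> nat (4 * p ^ 3) = \<one>\<^bsub>model\<^esub>"
proof -
  interpret H: group "BijGroup box" by (rule group_BijGroup)
  define n where "n = nat (4 * p ^ 3)"
  have n: "int n = 4 * p ^ 3" using p_pos by (simp add: n_def)
  have fb: "sim ((fb ^^ n) v) v" for v
  proof -
    obtain i k j where v: "v = (i, k, j)" by (metis prod_cases3)
    have "sim (i, k, j + int n) (i, k, j)"
      by (rule simI[where x = 0 and y = "2 * p" and z = "- 1"])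
        (simp_all add: n power2_eq_square power3_eq_cube)
    then show ?thesis by (simp add: v fb_pow)
  qed
  have "act fa [^]\<^bsub>symg\<^esub> n = \<one>\<^bsub>symg\<^esub>" "act fb [^]\<^bsub>symg\<^esub> n = \<one>\<^bsub>symg\<^esub>"
    by (rule sym_eqI; simp add: act_pow sym_one fa_pow_exponent[OF n] fb)+
  then show "inv\<^bsub>symg\<^esub> act fa [^]\<^bsub>model\<^esub> nat (4 * p ^ 3) = \<one>\<^bsub>model\<^esub>"
    "inv\<^bsub>symg\<^esub> act fb [^]\<^bsub>model\<^esub> nat (4 * p ^ 3) = \<one>\<^bsub>model\<^esub>"
    by (simp_all add: model_def n_def nat_pow_def H.nat_pow_inv[unfolded nat_pow_def])
qed

text \<open>The orbit of the point \<open>key (0, 0, 0)\<close> is the whole box.\<close>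

lemma order_model_ge:
  assumes "finite (carrier model)" "int n = 1 + 2 * p * u"
  shows "16 * nat p ^ 7 \<le> order model"
proof -
  interpret H: group "BijGroup box" by (rule group_BijGroup)
  let ?K = "generate symg {inv\<^bsub>symg\<^esub> act fa, inv\<^bsub>symg\<^esub> act fb}"
  have K: "subgroup ?K symg" by (rule H.generate_is_subgroup) simp
  have "inv\<^bsub>symg\<^esub> act fa \<in> ?K" "inv\<^bsub>symg\<^esub> act fb \<in> ?K" by (auto intro: generate.incl)
  then have fa: "act fa \<in> ?K" and fb: "act fb \<in> ?K"
    using subgroup.m_inv_closed[OF K] by fastforce+
  have "act fd = act fa \<otimes>\<^bsub>symg\<^esub> act fb \<otimes>\<^bsub>symg\<^esub> inv\<^bsub>symg\<^esub> act fa \<otimes>\<^bsub>symg\<^esub> inv\<^bsub>symg\<^esub> act fb"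
  proof -
    have "act fd \<otimes>\<^bsub>symg\<^esub> act fb \<otimes>\<^bsub>symg\<^esub> act fa = act fa \<otimes>\<^bsub>symg\<^esub> act fb"
      by (rule sym_eqI) (simp_all add: sym_mult act_simps rel_ab)
    then show ?thesis by (metis act_fa act_fb act_fd H.inv_solve_right H.m_closed)
  qed
  then have fd: "act fd \<in> ?K"
    using fa fb K by (simp add: subgroup.m_closed subgroup.m_inv_closed)
  have pow: "x [^]\<^bsub>symg\<^esub> (n::nat) \<in> ?K" if "x \<in> ?K" for x n
    using K that by (metis int_pow_int H.subgroup_int_pow_closed)
  have "box \<subseteq> (\<lambda>f. f (key (0, 0, 0))) ` ?K"
  proof
    fix x assume "x \<in> box"
    then obtain w k j where x: "x = (w, k, j)" "0 \<le> k" "k < 2 * p ^ 2" "0 \<le> j" "j < 2 * p ^ 2"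
      by (auto simp: box_def)
    define i where "i = (w + j - p * k) mod (4 * p ^ 3)"
    have i: "i \<ge> 0" using p_pos by (simp add: i_def)
    \<comment> \<open>Only C^(-1) acts by an explicit formula, so C^k is reached as C^(-l). The
      discrepancy 4 p^2 is harmless because C^(4 p^2) = A^(4 p^3) = 1.\<close>
    define l where "l = 4 * p ^ 2 - k"
    have l: "l \<ge> 0" using x p_pos by (simp add: l_def)
    obtain i' j' l' where nat: "i = int i'" "j = int j'" "l = int l'"
      using i x l by (metis nonneg_int_cases)
    \<comment> \<open>The rightmost factor acts first, which spells the word A^i C^(-l) B^j. The
      third entry stays 0 until the powers of B, so all iterates are exact.\<close>
    define f where "f = act fb [^]\<^bsub>symg\<^esub> j' \<otimes>\<^bsub>symg\<^esub> (act fd [^]\<^bsub>symg\<^esub> l' \<otimes>\<^bsub>symg\<^esub> act fa [^]\<^bsub>symg\<^esub> i')"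
    have "f (key (0, 0, 0)) = key (i, - l, j)"
      unfolding f_def nat by (simp add: sym_mult act_pow fa_pow_0 fd_pow fb_pow)
    also have "\<dots> = key (sec x)"
    proof -
      have "i = w + j - p * k - 4 * p ^ 3 * ((w + j - p * k) div (4 * p ^ 3))"
        unfolding i_def by (simp only: minus_mult_div_eq_mod)
      then show ?thesis
        unfolding x sec_def
        by (simp, intro simI[where x = "- 2" and y = 0 and z = "- ((w + j - p * k) div (4 * p ^ 3)) - 1"])
          (simp_all add: l_def poly_simps)
    qed
    finally have "f (key (0, 0, 0)) = x" using \<open>x \<in> box\<close> by (simp add: key_sec)
    moreover have "f \<in> ?K"
      unfolding f_def using fa fb fd K pow by (simp add: subgroup.m_closed)
    ultimately show "x \<in> (\<lambda>f. f (key (0, 0, 0))) ` ?K" by blast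
  qed
  then have "card box \<le> card ?K"
    using assms by (intro surj_card_le) (simp_all add: model_def)
  then show ?thesis by (simp add: card_box order_def model_def)
qed

end

section \<open>Presented groups\<close>

primrec word_eval :: "('b, 'c) monoid_scheme \<Rightarrow> ('a \<Rightarrow> 'b) \<Rightarrow> ('a \<times> bool) list \<Rightarrow> 'b" where
  "word_eval H f [] = \<one>\<^bsub>H\<^esub>"
| "word_eval H f (l # w) =
     (if snd l then f (fst l) else inv\<^bsub>H\<^esub> f (fst l)) \<otimes>\<^bsub>H\<^esub> word_eval H f w"

definition fw_eval :: "('b, 'c) monoid_scheme \<Rightarrow> ('a \<Rightarrow> 'b) \<Rightarrow> 'a free_word \<Rightarrow> 'b" where
  "fw_eval H f x = word_eval H f (rep_free_word x)"

definition pres_class :: "('a free_word \<times> 'a free_word) set \<Rightarrow> 'a free_word \<Rightarrow> 'a free_word set" where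
  "pres_class rels w = normal_closure free_group
     {u \<otimes>\<^bsub>free_group\<^esub> inv\<^bsub>free_group\<^esub> v | u v. (u, v) \<in> rels} #>\<^bsub>free_group\<^esub> w"

section \<open>Evaluation of words and the universal property\<close>

lemma carrier_free_group [simp]: "carrier free_group = UNIV"
  by (simp add: free_group_def)

lemma mult_free_group: "x \<otimes>\<^bsub>free_group\<^esub> y = fw_mult x y"
  by (simp add: free_group_def)

context group
begin

lemma word_eval_closed: "range f \<subseteq> carrier G \<Longrightarrow> word_eval G f w \<in> carrier G"
  by (induction w) auto

lemma word_eval_append:
  assumes "range f \<subseteq> carrier G"
  shows "word_eval G f (u @ v) = word_eval G f u \<otimes> word_eval G f v"
proof -
  have f: "f a \<in> carrier G" for a using assms by auto
  show ?thesis
    by (induction u) (simp_all add: word_eval_closed[OF assms] m_assoc f)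
qed

lemma word_eval_cancel:
  assumes "range f \<subseteq> carrier G" "cancel u v"
  shows "word_eval G f u = word_eval G f v"
  using assms(2)
proof cases
  case (1 u a e v)
  have "f a \<in> carrier G" using assms(1) by auto
  then show ?thesis using assms(1) by (simp add: 1 word_eval_append word_eval_closed)
qed

lemma word_eval_equivclp:
  assumes "range f \<subseteq> carrier G" "equivclp cancel u v"
  shows "word_eval G f u = word_eval G f v"
  using assms(2) by (induction rule: equivclp_induct) (auto dest: word_eval_cancel[OF assms(1)])

lemma fw_eval_abs:
  assumes "range f \<subseteq> carrier G"
  shows "fw_eval G f (abs_free_word w) = word_eval G f w"
  unfolding fw_eval_def
  by (intro word_eval_equivclp assms rep_abs_rsp_left[OF Quotient3_free_word equivclp_refl])

lemma fw_eval_closed: "range f \<subseteq> carrier G \<Longrightarrow> fw_eval G f x \<in> carrier G"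
  by (simp add: fw_eval_def word_eval_closed)

lemma fw_eval_hom:
  assumes "range f \<subseteq> carrier G"
  shows "fw_eval G f \<in> hom free_group G"
proof (rule homI)
  fix x y :: "'c free_word"
  show "fw_eval G f (x \<otimes>\<^bsub>free_group\<^esub> y) = fw_eval G f x \<otimes> fw_eval G f y"
    by (induction x; induction y)
      (simp add: mult_free_group fw_mult.abs_eq fw_eval_abs[OF assms] word_eval_append[OF assms])
qed (simp add: fw_eval_closed[OF assms])

lemma fw_eval_gen:
  assumes "range f \<subseteq> carrier G"
  shows "fw_eval G f (fw_gen a) = f a"
proof -
  have "f a \<in> carrier G" using assms by auto
  then show ?thesis by (simp add: fw_gen.abs_eq fw_eval_abs[OF assms])
qed

end

lemma pres_normal:
  "normal_closure free_group {u \<otimes>\<^bsub>free_group\<^esub> inv\<^bsub>free_group\<^esub> v | u v. (u, v) \<in> rels} \<lhd> free_group"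
  by (intro group.normal_closure_normal group_free_group) simp

lemma pres_class_hom: "pres_class rels \<in> hom free_group (presented_group rels)"
  unfolding pres_class_def presented_group_def by (rule normal.r_coset_hom_Mod[OF pres_normal])

lemma carrier_presented_group: "carrier (presented_group rels) = range (pres_class rels)"
  by (simp add: presented_group_def carrier_FactGroup pres_class_def)

lemma pres_class_eq:
  assumes "(u, v) \<in> rels"
  shows "pres_class rels u = pres_class rels v"
proof -
  let ?N = "normal_closure free_group {u \<otimes>\<^bsub>free_group\<^esub> inv\<^bsub>free_group\<^esub> v | u v. (u, v) \<in> rels}"
  interpret F: group free_group by (rule group_free_group)
  have N: "subgroup ?N free_group" using pres_normal by (rule normal_imp_subgroup)
  have "u \<otimes>\<^bsub>free_group\<^esub> inv\<^bsub>free_group\<^esub> v \<in> ?N"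
    using assms by (auto simp: normal_closure_def)
  then have "u \<in> ?N #>\<^bsub>free_group\<^esub> v"
    using subgroup.rcos_module[OF N group_free_group] by simp
  then show ?thesis using F.repr_independence[OF _ _ N] by (simp add: pres_class_def)
qed

lemma generate_presented_group:
  fixes rels :: "('a free_word \<times> 'a free_word) set"
  shows "carrier (presented_group rels) = generate (presented_group rels) (range (\<lambda>a. pres_class rels (fw_gen a)))"
    (is "_ = generate ?P ?X")
proof -
  interpret F: group free_group by (rule group_free_group)
  interpret P: group ?P by (rule group_presented_group)
  interpret h: group_hom free_group ?P "pres_class rels"
    by unfold_locales (rule pres_class_hom)
  have X: "?X \<subseteq> carrier ?P" by (auto simp: carrier_presented_group)
  have gens: "pres_class rels (abs_free_word w) \<in> generate ?P ?X" for w
  proof (induction w)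
    case Nil
    have "(abs_free_word [] :: 'a free_word) = \<one>\<^bsub>free_group\<^esub>" by (simp add: free_group_def fw_one.abs_eq)
    then show ?case using h.hom_one by (simp add: generate.one)
  next
    case (Cons l w)
    obtain a e where l: "l = (a, e)" by (cases l)
    have gen: "pres_class rels (fw_gen a) \<in> ?X" by simp
    have "abs_free_word [(a, e)] = (if e then fw_gen a else inv\<^bsub>free_group\<^esub> fw_gen a)"
    proof (cases e)
      case False
      have "fw_mult (abs_free_word [(a, False)]) (fw_gen a) = fw_one"
        using cancel.intros[of "[]" a False "[]"]
        by (simp add: fw_gen.abs_eq fw_mult.abs_eq fw_one.abs_eq free_word.abs_eq_iff r_into_equivclp)
      then have "inv\<^bsub>free_group\<^esub> fw_gen a = abs_free_word [(a, False)]"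
        by (intro F.inv_equality) (simp_all add: free_group_def)
      then show ?thesis using False by simp
    qed (simp add: fw_gen.abs_eq)
    then have "pres_class rels (abs_free_word [(a, e)]) \<in> generate ?P ?X"
      using generate.incl[OF gen, of ?P] generate.inv[OF gen, of ?P] by (cases e) (simp_all add: h.hom_inv)
    moreover have "abs_free_word (l # w) = abs_free_word [(a, e)] \<otimes>\<^bsub>free_group\<^esub> abs_free_word w"
      by (simp add: l mult_free_group fw_mult.abs_eq)
    ultimately show ?case using Cons by (simp add: generate.eng)
  qed
  have "pres_class rels x \<in> generate ?P ?X" for x
    by (induction x) (rule gens)
  then show ?thesis using P.generate_incl[OF X] by (auto simp: carrier_presented_group)
qed

text \<open>Evaluation kills the relators, hence their normal closure, and so factors through the
  presented group.\<close>

theorem presented_group_universal: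
  assumes "group H" and f: "range f \<subseteq> carrier H"
    and rels: "\<And>u v. (u, v) \<in> rels \<Longrightarrow> fw_eval H f u = fw_eval H f v"
  obtains h where "h \<in> hom (presented_group rels) H" "\<And>a. h (pres_class rels (fw_gen a)) = f a"
proof -
  let ?S = "{u \<otimes>\<^bsub>free_group\<^esub> inv\<^bsub>free_group\<^esub> v | u v. (u, v) \<in> rels}"
  let ?N = "normal_closure free_group ?S"
  interpret F: group free_group by (rule group_free_group)
  interpret H: group H by fact
  interpret e: group_hom free_group H "fw_eval H f"
    by unfold_locales (rule H.fw_eval_hom[OF f])
  have "?S \<subseteq> kernel free_group H (fw_eval H f)"
    using H.fw_eval_closed[OF f] by (auto simp: kernel_def rels)
  then have N: "?N \<subseteq> kernel free_group H (fw_eval H f)"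
    using e.normal_kernel by (auto simp: normal_closure_def)
  show ?thesis
  proof (rule FactGroup_universal[OF H.fw_eval_hom[OF f] pres_normal[of rels]])
    fix x y assume eq: "?N #>\<^bsub>free_group\<^esub> x = ?N #>\<^bsub>free_group\<^esub> y"
    have sub: "subgroup ?N free_group" using pres_normal by (rule normal_imp_subgroup)
    have "x \<in> ?N #>\<^bsub>free_group\<^esub> y" using F.rcos_self[OF _ sub, of x] eq by simp
    then obtain n where "n \<in> ?N" "x = n \<otimes>\<^bsub>free_group\<^esub> y" by (auto simp: r_coset_def)
    then show "fw_eval H f x = fw_eval H f y"
      using N H.fw_eval_closed[OF f] by (auto simp: kernel_def)
  next
    fix h assume "h \<in> hom (free_group Mod ?N) H"
      and "\<And>x. x \<in> carrier free_group \<Longrightarrow> h (?N #>\<^bsub>free_group\<^esub> x) = fw_eval H f x"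
    then show thesis
      by (intro that[of h]) (simp_all add: presented_group_def pres_class_def H.fw_eval_gen[OF f])
  qed
qed

lemma (in group_hom) hom_commutator:
  "x \<in> carrier G \<Longrightarrow> y \<in> carrier G \<Longrightarrow> h (commutator G x y) = commutator H (h x) (h y)"
  by (simp add: commutator_def)

lemma (in group_hom) hom_conjugate:
  "x \<in> carrier G \<Longrightarrow> y \<in> carrier G \<Longrightarrow> h (conjugate G x y) = conjugate H (h x) (h y)"
  by (simp add: conjugate_def)

lemma (in group) commutator_closed [simp, intro]:
  "x \<in> carrier G \<Longrightarrow> y \<in> carrier G \<Longrightarrow> commutator G x y \<in> carrier G"
  by (simp add: commutator_def)

section \<open>The Macdonald group as a presented group\<close>

definition Macdonald_rels :: "int \<Rightarrow> (gens_AB free_word \<times> gens_AB free_word) set" where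
  "Macdonald_rels \<alpha> = (let F = free_group; A = fw_gen gA; B = fw_gen gB in
        {(conjugate F A (commutator F A B), A [^]\<^bsub>F\<^esub> \<alpha>),
         (conjugate F B (commutator F B A), B [^]\<^bsub>F\<^esub> \<alpha>)})"

lemma Macdonald_eq: "Macdonald \<alpha> = presented_group (Macdonald_rels \<alpha>)"
  by (simp add: Macdonald_def Macdonald_rels_def Let_def)

lemma range_gens_AB: "range f = {f gA, f gB}"
proof -
  have U: "UNIV = {gA, gB}" using gens_AB.exhaust by blast
  show ?thesis unfolding U by simp
qed

lemma macdonald_Macdonald:
  "macdonald (Macdonald \<alpha>) (pres_class (Macdonald_rels \<alpha>) (fw_gen gA)) (pres_class (Macdonald_rels \<alpha>) (fw_gen gB)) \<alpha>"
    (is "macdonald ?G ?A ?B _")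
proof -
  interpret F: group free_group by (rule group_free_group)
  interpret G: group ?G unfolding Macdonald_eq by (rule group_presented_group)
  interpret h: group_hom free_group ?G "pres_class (Macdonald_rels \<alpha>)"
    by unfold_locales (simp add: Macdonald_eq pres_class_hom)
  let ?a = "fw_gen gA" and ?b = "fw_gen gB"
  have "pres_class (Macdonald_rels \<alpha>) (conjugate free_group ?a (commutator free_group ?a ?b))
      = pres_class (Macdonald_rels \<alpha>) (?a [^]\<^bsub>free_group\<^esub> \<alpha>)"
    "pres_class (Macdonald_rels \<alpha>) (conjugate free_group ?b (commutator free_group ?b ?a))
      = pres_class (Macdonald_rels \<alpha>) (?b [^]\<^bsub>free_group\<^esub> \<alpha>)"
    by (auto intro!: pres_class_eq simp: Macdonald_rels_def Let_def)
  then have "conjugate ?G ?A (commutator ?G ?A ?B) = ?A [^]\<^bsub>?G\<^esub> \<alpha>"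
    "conjugate ?G ?B (commutator ?G ?B ?A) = ?B [^]\<^bsub>?G\<^esub> \<alpha>"
    by (simp_all add: h.hom_conjugate h.hom_commutator h.hom_int_pow)
  moreover have "carrier ?G = generate ?G {?A, ?B}"
    using generate_presented_group[of "Macdonald_rels \<alpha>"] by (simp add: Macdonald_eq range_gens_AB)
  moreover have "?A \<in> carrier ?G" "?B \<in> carrier ?G" by (simp_all add: h.hom_closed)
  ultimately show ?thesis
    by (intro macdonald.intro macdonald_axioms.intro G.is_group)
qed

lemma (in macdonald) Macdonald_surj:
  obtains h where "h \<in> hom (Macdonald \<alpha>) G" "h ` carrier (Macdonald \<alpha>) = carrier G"
proof -
  interpret F: group free_group by (rule group_free_group)
  define f where "f = (\<lambda>g. case g of gA \<Rightarrow> A | gB \<Rightarrow> B)"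
  have f: "range f \<subseteq> carrier G" by (auto simp: f_def split: gens_AB.split)
  interpret e: group_hom free_group G "fw_eval G f"
    by unfold_locales (rule fw_eval_hom[OF f])
  have f_gens: "f gA = A" "f gB = B" by (simp_all add: f_def)
  have "fw_eval G f u = fw_eval G f v" if "(u, v) \<in> Macdonald_rels \<alpha>" for u v
    using that rel_A rel_B
    by (auto simp: Macdonald_rels_def Let_def e.hom_conjugate e.hom_commutator e.hom_int_pow
        fw_eval_gen[OF f] f_gens)
  from presented_group_universal[OF is_group f this] obtain h where
    h: "h \<in> hom (Macdonald \<alpha>) G" "\<And>a. h (pres_class (Macdonald_rels \<alpha>) (fw_gen a)) = f a"
    by (metis Macdonald_eq)
  interpret M: macdonald "Macdonald \<alpha>" "pres_class (Macdonald_rels \<alpha>) (fw_gen gA)"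
    "pres_class (Macdonald_rels \<alpha>) (fw_gen gB)" \<alpha>
    by (rule macdonald_Macdonald)
  interpret h: group_hom "Macdonald \<alpha>" G h by unfold_locales (rule h)
  have "h ` carrier (Macdonald \<alpha>) = generate G {A, B}"
    unfolding M.generated by (subst h.generate_img[symmetric]) (simp_all add: h f_gens)
  with h(1) show ?thesis by (intro that) (simp_all only: generated)
qed

section \<open>The Sylow subgroup\<close>

lemma (in macdonald_torsion) order_dvd:
  assumes "A [^] (a::int) = \<one>" "C [^] (x::int) \<in> generate G {A}" "C [^] (x'::int) \<in> generate G {A}"
    "B [^] (y::int) \<in> generate G {A}" "B [^] (y'::int) \<in> generate G {A}"
  shows "int (order G) dvd a * gcd x x' * gcd y y'"
proof -
  obtain k l where kl: "order G = ord A * k * l" "\<And>j::int. C [^] j \<in> generate G {A} \<Longrightarrow> int k dvd j"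
    "\<And>j::int. B [^] j \<in> generate G {A} \<Longrightarrow> int l dvd j"
    by (rule order_decomp) blast
  have "int (ord A) dvd a" using assms(1) int_pow_eq_id by blast
  moreover have "int k dvd gcd x x'" "int l dvd gcd y y'" using kl assms by (auto intro: gcd_greatest)
  ultimately show ?thesis by (simp add: kl(1) mult_dvd_mono)
qed

lemma (in macdonald) B_central_exp_in: "B [^] central_exp \<alpha> \<in> generate G {A}"
  unfolding B_central_exp generate_pow[OF A] by blast

lemma (in macdonald) finite_order_dvd:
  assumes "\<alpha> \<noteq> 1" "central_exp \<alpha> \<noteq> 0"
  shows "finite (carrier G)" "int (order G) dvd (\<alpha> - 1) * central_exp \<alpha> ^ 3"
proof -
  obtain e where "macdonald_torsion G A B \<alpha> e" using torsion[OF assms] ..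
  then interpret macdonald_torsion G A B \<alpha> e .
  show "finite (carrier G)" by (rule finite_carrier)
  have "int (order G) dvd (\<alpha> - 1) * central_exp \<alpha> * \<bar>central_exp \<alpha>\<bar> * \<bar>central_exp \<alpha>\<bar>"
    using order_dvd[OF A_pow_one C_central_exp C_central_exp B_central_exp_in B_central_exp_in] by simp
  moreover have "(\<alpha> - 1) * central_exp \<alpha> * \<bar>central_exp \<alpha>\<bar> * \<bar>central_exp \<alpha>\<bar> = (\<alpha> - 1) * central_exp \<alpha> ^ 3"
    by (simp add: power3_eq_cube mult.assoc)
  ultimately show "int (order G) dvd (\<alpha> - 1) * central_exp \<alpha> ^ 3" by simp
qed

text \<open>The relations alone give A^n = B^n = 1 for n = \<alpha> - 1 times the central exponent;
  4 p^3 is the 2-part of this n, so the two assumptions discard the odd part.\<close>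

locale macdonald_2 = macdonald G A B "1 + 2 * p * u" + model_params p u r c
  for G (structure) and A B :: 'a and p u r :: int and c :: nat +
  assumes A_M: "A [^] (4 * p ^ 3) = \<one>" and B_M: "B [^] (4 * p ^ 3) = \<one>"

context model_params
begin

abbreviation "\<alpha> \<equiv> 1 + 2 * p * u"
abbreviation "\<sigma> n \<equiv> \<alpha> * geom_sum \<alpha> n"

lemma central_exp_alpha: "\<exists>\<tau>. odd \<tau> \<and> central_exp \<alpha> = 2 * p ^ 2 * \<tau>"
proof -
  have "p * u \<noteq> 0" using p_pos odd_u by auto
  then obtain \<tau> where "odd \<tau>" "central_exp \<alpha> = 2 * (p * u) ^ 2 * \<tau>"
    using central_exp_valuation[of "p * u"] by (auto simp: mult.assoc)
  then show ?thesis using odd_u by (intro exI[of _ "u ^ 2 * \<tau>"]) (simp add: power_mult_distrib)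
qed

text \<open>The central exponent is 2 p^2 times an odd number, and the gcd removes the odd
  factor.\<close>

lemma gcd_central_exp_M: "gcd (central_exp \<alpha>) (4 * p ^ 3) = 2 * p ^ 2"
proof -
  obtain \<tau> where \<tau>: "odd \<tau>" "central_exp \<alpha> = 2 * p ^ 2 * \<tau>" using central_exp_alpha by blast
  have "coprime \<tau> (2 * p)" using \<tau> by (simp add: p_power flip: power_Suc)
  then have "gcd \<tau> (2 * p) = 1" by simp
  moreover have "4 * p ^ 3 = 2 * p ^ 2 * (2 * p)" by (simp add: power2_eq_square power3_eq_cube)
  moreover have "gcd (2 * p ^ 2 * \<tau>) (2 * p ^ 2 * (2 * p)) = \<bar>2 * p ^ 2\<bar> * gcd \<tau> (2 * p)"
    by (simp only: gcd_mult_left) simp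
  ultimately show ?thesis using \<tau> p_pos by simp
qed

lemma geom_sum_alpha: "\<exists>z. \<sigma> n = int n + 2 * p * u * tri (int n) + 4 * p ^ 2 * u ^ 2 * tet (int n) + 4 * p ^ 3 * z"
proof -
  obtain z where "\<sigma> n = int n + 2 * p * u * tri (int n) + (2 * p * u) ^ 2 * tet (int n) + z * (2 * p * u) ^ 3"
    using geom_sum_expansion[of "2 * p * u" n] by blast
  then show ?thesis by (intro exI[of _ "2 * u ^ 3 * z"]) (simp add: power_mult_distrib)
qed

lemma alpha_ne_1: "\<alpha> \<noteq> 1"
  using p_pos odd_u by auto

end

section \<open>The order of the 2-part from above\<close>

context macdonald_2
begin

text \<open>For n = 4 p^3 the element A^n = 1 commutes with B, so C^n is A to the power n -
  \<open>\<sigma> n\<close>, and this exponent is again a multiple of 4 p^3.\<close>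

lemma C_M: "C [^] (4 * p ^ 3) = \<one>"
proof -
  define n where "n = nat (4 * p ^ 3)"
  have n: "int n = 4 * p ^ 3" using p_pos by (simp add: n_def)
  obtain z where z: "\<sigma> n = int n + 2 * p * u * tri (int n) + 4 * p ^ 2 * u ^ 2 * tet (int n) + 4 * p ^ 3 * z"
    using geom_sum_alpha by blast
  have tri: "tri (int n) = 2 * p ^ 2 * (p * (4 * p ^ 3 + 1))"
    using two_tri[of "int n"] by (simp add: n power2_eq_square power3_eq_cube)
  have "0 + 2 * p * (2 * p ^ 2) = int n"
    by (simp add: n power2_eq_square power3_eq_cube)
  then obtain w where w: "tet (int n) = p * w" using tet_shift[of 0 "2 * p ^ 2"] by auto
  have "int n - \<sigma> n = 4 * p ^ 3 * (- p * u * (4 * p ^ 3 + 1) - u ^ 2 * w - z)"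
    unfolding z tri w by (simp add: poly_simps)
  then have "A [^] (int n - \<sigma> n) = \<one>"
    using int_pow_eq_one_mult[OF A A_M] by presburger
  then show ?thesis using C_pow_eq_A_pow[of n] n A_M by simp
qed

sublocale macdonald_torsion G A B \<alpha> "nat (4 * p ^ 3)"
proof
  have "x [^] nat (4 * p ^ 3) = \<one>" if "x [^] (4 * p ^ 3) = \<one>" for x
    using that p_pos by (simp flip: int_pow_int)
  then show "A [^] nat (4 * p ^ 3) = \<one>" "B [^] nat (4 * p ^ 3) = \<one>" "C [^] nat (4 * p ^ 3) = \<one>"
    using A_M B_M C_M by blast+
qed (use p_pos in simp)

lemma order_dvd_2: "order G dvd 16 * nat p ^ 7"
proof -
  have "x [^] (4 * p ^ 3) \<in> generate G {A}" if "x [^] (4 * p ^ 3) = \<one>" for x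
    using that generate.one by metis
  then have "int (order G) dvd 4 * p ^ 3 * (2 * p ^ 2) * (2 * p ^ 2)"
    using order_dvd[OF A_M C_central_exp _ B_central_exp_in, of "4 * p ^ 3" "4 * p ^ 3"] B_M C_M
    by (simp add: gcd_central_exp_M)
  also have "\<dots> = int (16 * nat p ^ 7)"
    using p_pos by (simp flip: power_add)
  finally show ?thesis by (simp only: of_nat_dvd_iff)
qed

end

lemma (in model_params) macdonald_2_model:
  assumes n: "int n = \<alpha>"
  shows "macdonald_2 model (inv\<^bsub>symg\<^esub> act fa) (inv\<^bsub>symg\<^esub> act fb) p u r c"
    and "order model = 16 * nat p ^ 7"
proof -
  interpret P: macdonald model "inv\<^bsub>symg\<^esub> act fa" "inv\<^bsub>symg\<^esub> act fb" \<alpha>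
    by (rule macdonald_model[OF n])
  have M: "x [^]\<^bsub>model\<^esub> (4 * p ^ 3) = x [^]\<^bsub>model\<^esub> nat (4 * p ^ 3)" for x
    using p_pos by (simp flip: int_pow_int)
  show P2: "macdonald_2 model (inv\<^bsub>symg\<^esub> act fa) (inv\<^bsub>symg\<^esub> act fb) p u r c"
    using model_pow by unfold_locales (simp_all only: M)
  then interpret P2: macdonald_2 model "inv\<^bsub>symg\<^esub> act fa" "inv\<^bsub>symg\<^esub> act fb" p u r c .
  show "order model = 16 * nat p ^ 7"
    using dvd_imp_le[OF P2.order_dvd_2] order_model_ge[OF P2.finite_carrier n] p_pos
    by simp
qed

text \<open>\<alpha> may be negative, but the generators of the model have orders dividing 4 p^3. So
  the model for the residue of \<alpha> modulo 4 p^3 satisfies the original relations too; passing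
  to this residue changes u by an even number.\<close>

lemma (in model_params) macdonald_2_exists:
  obtains P :: "(int \<times> int \<times> int \<Rightarrow> int \<times> int \<times> int) monoid" and a b
  where "macdonald_2 P a b p u r c" "order P = 16 * nat p ^ 7"
proof -
  define z where "z = \<alpha> div (4 * p ^ 3)"
  define u' where "u' = u - 2 * p ^ 2 * z"
  interpret M: model_params p u' r c
    by (intro model_params.intro p_def p_power) (simp add: u'_def odd_u)
  have "1 + 2 * p * u' = \<alpha> - 4 * p ^ 3 * z"
    by (simp add: u'_def poly_simps)
  also have "\<dots> = \<alpha> mod (4 * p ^ 3)" by (simp only: z_def minus_mult_div_eq_mod)
  finally have mod: "1 + 2 * p * u' = \<alpha> mod (4 * p ^ 3)" .
  then have "int (nat (1 + 2 * p * u')) = 1 + 2 * p * u'" using p_pos by simp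
  note M = M.macdonald_2_model[OF this]
  let ?a = "inv\<^bsub>M.symg\<^esub> M.act M.fa" and ?b = "inv\<^bsub>M.symg\<^esub> M.act M.fb"
  interpret P: macdonald_2 M.model ?a ?b p u' r c by (rule M(1))
  have cong: "[1 + 2 * p * u' = \<alpha>] (mod 4 * p ^ 3)" unfolding mod by (simp add: cong_def)
  have "macdonald M.model ?a ?b \<alpha>"
  proof (intro macdonald.intro macdonald_axioms.intro P.is_group P.A P.B P.generated)
    show "conjugate M.model ?a (commutator M.model ?a ?b) = ?a [^]\<^bsub>M.model\<^esub> \<alpha>"
      unfolding P.rel_A by (rule P.int_pow_cong[OF P.A P.A_M cong])
    show "conjugate M.model ?b (commutator M.model ?b ?a) = ?b [^]\<^bsub>M.model\<^esub> \<alpha>"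
      unfolding P.rel_B by (rule P.int_pow_cong[OF P.B P.B_M cong])
  qed
  then have "macdonald_2 M.model ?a ?b p u r c"
    by (intro macdonald_2.intro macdonald_2_axioms.intro model_params_axioms P.A_M P.B_M)
  then show ?thesis using that M(2) by blast
qed

section \<open>Transport of the relations to the Sylow subgroup\<close>

lemma macdonald_transfer:
  assumes J: "group J" and h: "h \<in> hom J P" and bij: "bij_betw h (carrier J) (carrier P)"
    and a: "a \<in> carrier J" and b: "b \<in> carrier J" and P: "macdonald P (h a) (h b) \<alpha>"
  shows "macdonald J a b \<alpha>"
proof -
  interpret J: group J by fact
  interpret P: macdonald P "h a" "h b" \<alpha> by fact
  interpret h: group_hom J P h by unfold_locales (rule h)
  have inj: "x = y" if "h x = h y" "x \<in> carrier J" "y \<in> carrier J" for x y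
    using bij that by (auto simp: bij_betw_def inj_on_def)
  show ?thesis
  proof (intro macdonald.intro macdonald_axioms.intro J a b)
    show "conjugate J a (commutator J a b) = a [^]\<^bsub>J\<^esub> \<alpha>"
      by (rule inj) (use a b P.rel_A in \<open>simp_all add: h.hom_conjugate h.hom_commutator h.hom_int_pow\<close>)
    show "conjugate J b (commutator J b a) = b [^]\<^bsub>J\<^esub> \<alpha>"
      by (rule inj) (use a b P.rel_B in \<open>simp_all add: h.hom_conjugate h.hom_commutator h.hom_int_pow\<close>)
    have sub: "generate J {a, b} \<subseteq> carrier J" using a b by (intro J.generate_incl) auto
    have "h ` carrier J = h ` generate J {a, b}"
      using h.generate_img[of "{a, b}"] a b P.generated bij by (simp add: bij_betw_def)
    then show "carrier J = generate J {a, b}"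
      using bij sub by (metis bij_betw_def inj_on_image_eq_iff subset_refl)
  qed
qed

lemma macdonald_2_transfer:
  assumes J: "group J" and h: "h \<in> hom J P" and bij: "bij_betw h (carrier J) (carrier P)"
    and P: "macdonald_2 P a b p u r c"
  shows "\<exists>a b. macdonald_2 J a b p u r c"
proof -
  interpret J: group J by fact
  interpret P: macdonald_2 P a b p u r c by fact
  interpret h: group_hom J P h by unfold_locales (rule h)
  obtain a' b' where ab: "a' \<in> carrier J" "h a' = a" "b' \<in> carrier J" "h b' = b"
    using bij P.A P.B by (metis bij_betw_def imageE)
  have "macdonald J a' b' P.\<alpha>"
    using ab P.macdonald_axioms by (intro macdonald_transfer[OF J h bij]) simp_all
  moreover have "x [^]\<^bsub>J\<^esub> (4 * p ^ 3) = \<one>\<^bsub>J\<^esub>"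
    if x: "x \<in> carrier J" "h x [^]\<^bsub>P\<^esub> (4 * p ^ 3) = \<one>\<^bsub>P\<^esub>" for x
  proof -
    have "h (x [^]\<^bsub>J\<^esub> (4 * p ^ 3)) = h \<one>\<^bsub>J\<^esub>" using x by (simp add: h.hom_int_pow)
    then show ?thesis using bij x by (auto simp: bij_betw_def inj_on_def)
  qed
  ultimately show ?thesis
    using ab P.A_M P.B_M P.model_params_axioms
    by (blast intro: macdonald_2.intro macdonald_2_axioms.intro)
qed

text \<open>The Macdonald group maps onto the model P with a kernel of odd order. So P carries the
  full 2-part of the order, the Sylow subgroup maps isomorphically onto P, and its generators are
  the preimages of those of P.\<close>

theorem (in model_params) sylow_Macdonald:
  assumes sylow: "sylow_subgroup 2 (Macdonald \<alpha>) S" and J: "J = (Macdonald \<alpha>)\<lparr>carrier := S\<rparr>"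
  shows "\<exists>a b. macdonald_2 J a b p u r c" "order J = 16 * nat p ^ 7"
proof -
  interpret G: macdonald "Macdonald \<alpha>" "pres_class (Macdonald_rels \<alpha>) (fw_gen gA)"
    "pres_class (Macdonald_rels \<alpha>) (fw_gen gB)" \<alpha>
    by (rule macdonald_Macdonald)
  let ?G = "Macdonald \<alpha>"
  obtain P :: "(int \<times> int \<times> int \<Rightarrow> int \<times> int \<times> int) monoid" and a b
    where P2: "macdonald_2 P a b p u r c" and order_P: "order P = 16 * nat p ^ 7"
    by (rule macdonald_2_exists)
  interpret P: macdonald_2 P a b p u r c by (rule P2)
  obtain h where h: "h \<in> hom ?G P" "h ` carrier ?G = carrier P" by (rule P.Macdonald_surj)
  interpret h: group_hom ?G P h by unfold_locales (rule h)
  define K where "K = kernel ?G P h"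
  have K: "subgroup K ?G" unfolding K_def by (rule h.subgroup_kernel)
  obtain \<tau> where \<tau>: "odd \<tau>" "central_exp \<alpha> = 2 * p ^ 2 * \<tau>" using central_exp_alpha by blast
  then have t: "central_exp \<alpha> \<noteq> 0" using p_pos by auto
  have "card (carrier (?G Mod K)) = order P"
    using h.FactGroup_iso_set[OF h(2)] unfolding K_def iso_def order_def by (auto dest: bij_betw_same_card)
  then have order_G: "order ?G = 16 * nat p ^ 7 * card K"
    using G.lagrange[OF K] order_P by (simp add: FactGroup_def)
  have "odd (card K)"
  proof -
    \<comment> \<open>The upper bound (\<alpha> - 1) t^3 equals 16 p^7 times the odd number u
      \<tau>^3, and P already accounts for 16 p^7.\<close>
    have "int (16 * nat p ^ 7 * card K) dvd 2 * p * u * (2 * p ^ 2 * \<tau>) ^ 3"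
      using G.finite_order_dvd(2)[OF alpha_ne_1 t] \<tau> order_G by simp
    also have "\<dots> = int (16 * nat p ^ 7) * (u * \<tau> ^ 3)"
      using p_pos by (simp add: power_mult_distrib flip: power_mult) (simp flip: power_Suc power_add)
    finally have "int (16 * nat p ^ 7) * int (card K) dvd int (16 * nat p ^ 7) * (u * \<tau> ^ 3)" by simp
    then have "int (card K) dvd u * \<tau> ^ 3" using p_pos by (subst (asm) dvd_mult_cancel_left) simp
    moreover have "odd (u * \<tau> ^ 3)" using odd_u \<tau> by simp
    ultimately show ?thesis by (meson dvd_trans even_of_nat)
  qed
  have pow: "16 * nat p ^ 7 = 2 ^ (4 + 7 * c)"
    by (simp add: p_power nat_power_eq power_add power_mult mult.commute[of 7] flip: power_mult)
  have S: "subgroup S ?G" and card_S: "card S = 2 ^ multiplicity 2 (order ?G)"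
    using sylow by (auto simp: sylow_subgroup_def)
  have "multiplicity 2 (order ?G) = 4 + 7 * c"
    using \<open>odd (card K)\<close> by (intro multiplicity_decomposeI[of _ _ _ "card K"]) (simp_all add: order_G pow)
  then have S_card: "card S = 16 * nat p ^ 7" using card_S pow by simp
  then show order_J: "order J = 16 * nat p ^ 7" by (simp add: J order_def)
  have gJ: "group J" unfolding J using S by (rule G.subgroup_imp_group)
  have hJ: "h \<in> hom J P" using subgroup.mem_carrier[OF S] by (intro homI) (simp_all add: J)
  interpret hJ: group_hom J P h
    using gJ hJ by (simp add: group_hom_def group_hom_axioms_def P.is_group)
  \<comment> \<open>The order of this kernel divides a power of 2, the order of J, and an odd
    number, the order of K.\<close>
  have "kernel J P h = {\<one>\<^bsub>J\<^esub>}"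
  proof -
    have eq: "kernel J P h = S \<inter> K"
      using subgroup.subset[OF S] by (auto simp: kernel_def K_def J)
    have "card (kernel J P h) dvd card S"
      using group.lagrange[OF gJ hJ.subgroup_kernel] order_J S_card by (metis dvd_triv_right)
    moreover have "card (kernel J P h) dvd card K"
    proof -
      have "subgroup (S \<inter> K) (?G\<lparr>carrier := K\<rparr>)"
        using G.subgroups_Inter_pair[OF S K] K by (intro G.subgroup_incl) auto
      from group.lagrange[OF G.subgroup_imp_group[OF K] this]
      have "card (rcosets\<^bsub>?G\<lparr>carrier := K\<rparr>\<^esub> (S \<inter> K)) * card (S \<inter> K) = card K"
        by (simp add: order_def)
      then show ?thesis unfolding eq by (metis dvd_triv_right)
    qed
    moreover have "coprime (card S) (card K)"
      unfolding S_card pow using \<open>odd (card K)\<close> by simp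
    ultimately have "card (kernel J P h) = 1" by (meson coprime_common_divisor_nat)
    moreover have "\<one>\<^bsub>J\<^esub> \<in> kernel J P h" by (simp add: kernel_def)
    ultimately show ?thesis by (metis card_1_singletonE singletonD)
  qed
  then have "inj_on h (carrier J)" by (simp add: hJ.inj_iff_trivial_ker)
  moreover have "h ` carrier J = carrier P"
  proof (rule card_subset_eq)
    show "card (h ` carrier J) = card (carrier P)"
      using \<open>inj_on h (carrier J)\<close> order_J order_P by (simp add: card_image order_def)
  qed (use P.finite_carrier hJ.hom_closed in auto)
  ultimately have "bij_betw h (carrier J) (carrier P)" by (simp add: bij_betw_def)
  then show "\<exists>a b. macdonald_2 J a b p u r c"
    by (rule macdonald_2_transfer[OF gJ hJ _ P2])
qed

section \<open>The upper central series\<close>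

context group
begin

lemma upper_central_Suc_iff:
  assumes "upper_central G i \<lhd> G"
  shows "g \<in> upper_central G (Suc i) \<longleftrightarrow>
    g \<in> carrier G \<and> (\<forall>x\<in>carrier G. g \<otimes> x \<in> upper_central G i #> (x \<otimes> g))"
proof -
  interpret N: normal "upper_central G i" G by fact
  have eq: "(upper_central G i #> g) <#> (upper_central G i #> x) = (upper_central G i #> x) <#> (upper_central G i #> g)
      \<longleftrightarrow> g \<otimes> x \<in> upper_central G i #> (x \<otimes> g)" if "g \<in> carrier G" "x \<in> carrier G" for x
  proof -
    have "upper_central G i #> (g \<otimes> x) = upper_central G i #> (x \<otimes> g)
        \<longleftrightarrow> g \<otimes> x \<in> upper_central G i #> (x \<otimes> g)"
      using that rcos_self[OF _ N.subgroup_axioms, of "g \<otimes> x"]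
        repr_independence[OF _ _ N.subgroup_axioms, of "g \<otimes> x" "x \<otimes> g"] by auto
    then show ?thesis using that by (simp only: N.rcos_sum)
  qed
  show ?thesis
    using eq by (auto simp: center_def carrier_FactGroup)
qed

lemma upper_central_normal: "upper_central G i \<lhd> G"
proof (induction i)
  case 0
  show ?case by (simp add: one_is_normal)
next
  case (Suc i)
  let ?N = "upper_central G i"
  interpret N: normal ?N G by fact
  \<comment> \<open>With commutators in place of cosets, the subgroup and normality conditions turn
    into conjugations inside \<open>?N\<close>.\<close>
  define Z where "Z = {g \<in> carrier G. \<forall>x\<in>carrier G. g \<otimes> x \<otimes> inv g \<otimes> inv x \<in> ?N}"
  have mem: "g \<otimes> x \<in> ?N #> (x \<otimes> g) \<longleftrightarrow> g \<otimes> x \<otimes> inv g \<otimes> inv x \<in> ?N"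
    if "g \<in> carrier G" "x \<in> carrier G" for g x
    using that N.rcos_module[OF is_group, of "x \<otimes> g" "g \<otimes> x"] by (simp add: inv_mult_group m_assoc)
  have conj: "y \<otimes> n \<otimes> inv y \<in> ?N" if "y \<in> carrier G" "n \<in> ?N" for y n
    using that by (rule N.inv_op_closed2)
  have Z: "upper_central G (Suc i) = Z"
    using upper_central_Suc_iff[OF Suc] mem by (auto simp: Z_def simp del: upper_central.simps)
  have "subgroup Z G"
  proof (rule subgroupI)
    show "Z \<subseteq> carrier G" by (auto simp: Z_def)
    have "\<one> \<in> Z" by (simp add: Z_def N.one_closed)
    then show "Z \<noteq> {}" by blast
    fix g assume g: "g \<in> Z"
    then have gG: "g \<in> carrier G" by (simp add: Z_def)
    show "inv g \<in> Z"
    proof -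
      have "inv g \<otimes> x \<otimes> inv (inv g) \<otimes> inv x \<in> ?N" if x: "x \<in> carrier G" for x
      proof -
        have "g \<otimes> x \<otimes> inv g \<otimes> inv x \<in> ?N" using g x by (simp add: Z_def)
        from conj[OF _ N.m_inv_closed[OF this], of "inv g"] gG x show ?thesis
          by (simp add: m_assoc inv_mult_group)
      qed
      then show ?thesis using gG by (simp add: Z_def)
    qed
    fix h assume h: "h \<in> Z"
    then have hG: "h \<in> carrier G" by (simp add: Z_def)
    have "g \<otimes> h \<otimes> x \<otimes> inv (g \<otimes> h) \<otimes> inv x \<in> ?N" if x: "x \<in> carrier G" for x
    proof -
      have "h \<otimes> x \<otimes> inv h \<otimes> inv x \<in> ?N" "g \<otimes> x \<otimes> inv g \<otimes> inv x \<in> ?N"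
        using g h x by (simp_all add: Z_def)
      from N.m_closed[OF conj[OF gG this(1)] this(2)] show ?thesis
        using gG hG x by (simp add: m_assoc inv_mult_group)
    qed
    then show "g \<otimes> h \<in> Z" using gG hG by (simp add: Z_def)
  qed
  moreover have "y \<otimes> g \<otimes> inv y \<in> Z" if y: "y \<in> carrier G" and g: "g \<in> Z" for y g
  proof -
    have gG: "g \<in> carrier G" using g by (simp add: Z_def)
    have "y \<otimes> g \<otimes> inv y \<otimes> x \<otimes> inv (y \<otimes> g \<otimes> inv y) \<otimes> inv x \<in> ?N" if x: "x \<in> carrier G" for x
    proof -
      have "g \<otimes> (inv y \<otimes> x \<otimes> y) \<otimes> inv g \<otimes> inv (inv y \<otimes> x \<otimes> y) \<in> ?N"
        using g x y by (simp add: Z_def)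
      from conj[OF y this] show ?thesis
        using gG x y by (simp add: m_assoc inv_mult_group)
    qed
    then show ?thesis using gG y by (simp add: Z_def)
  qed
  ultimately show ?case unfolding Z by (simp add: normal_inv_iff)
qed

end

text \<open>The elements x for which conjugation by x preserves the coset of g form a subgroup, so
  testing the generators suffices.\<close>

lemma (in macdonald) upper_central_Suc_generators:
  "g \<in> upper_central G (Suc i) \<longleftrightarrow> g \<in> carrier G \<and>
     conjugate G g A \<in> upper_central G i #> g \<and> conjugate G g B \<in> upper_central G i #> g"
proof -
  let ?N = "upper_central G i"
  interpret N: normal ?N G by (rule upper_central_normal)
  show ?thesis
  proof (cases "g \<in> carrier G")
    case True
    have iff: "g \<otimes> x \<in> ?N #> (x \<otimes> g) \<longleftrightarrow> conjugate G g x \<in> ?N #> g" if x: "x \<in> carrier G" for x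
    proof -
      have "g \<otimes> x \<in> ?N #> (x \<otimes> g) \<longleftrightarrow> g \<otimes> x \<otimes> inv g \<otimes> inv x \<in> ?N"
        using True x N.rcos_module[OF is_group, of "x \<otimes> g" "g \<otimes> x"] by (simp add: inv_mult_group m_assoc)
      also have "\<dots> \<longleftrightarrow> inv x \<otimes> g \<otimes> x \<otimes> inv g \<in> ?N"
      proof
        assume "g \<otimes> x \<otimes> inv g \<otimes> inv x \<in> ?N"
        from N.inv_op_closed1[OF x this] True x show "inv x \<otimes> g \<otimes> x \<otimes> inv g \<in> ?N"
          by (simp add: m_assoc)
      next
        assume "inv x \<otimes> g \<otimes> x \<otimes> inv g \<in> ?N"
        from N.inv_op_closed2[OF x this] True x show "g \<otimes> x \<otimes> inv g \<otimes> inv x \<in> ?N"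
          by (simp add: m_assoc)
      qed
      also have "\<dots> \<longleftrightarrow> conjugate G g x \<in> ?N #> g"
        using True x N.rcos_module[OF is_group, of g "conjugate G g x"] by (simp add: conjugate_def)
      finally show ?thesis .
    qed
    define D where "D = {x \<in> carrier G. conjugate G g x \<in> ?N #> g}"
    have D_eq: "D = {x \<in> carrier G. ?N #> conjugate G g x = ?N #> g}"
    proof -
      have "?N #> a = ?N #> g \<longleftrightarrow> a \<in> ?N #> g" if "a \<in> carrier G" for a
        using that True rcos_self[OF _ N.subgroup_axioms, of a]
          repr_independence[OF _ _ N.subgroup_axioms, of a g] by auto
      then show ?thesis using True by (auto simp: D_def)
    qed
    have coset: "?N #> conjugate G z x = ?N #> conjugate G w x"
      if "?N #> z = ?N #> w" "x \<in> carrier G" "z \<in> carrier G" "w \<in> carrier G" for z w x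
    proof -
      have "z \<in> ?N #> w" using that rcos_self[OF _ N.subgroup_axioms, of z] by simp
      then have "z \<otimes> inv w \<in> ?N" using that N.rcos_module[OF is_group] by simp
      from N.inv_op_closed1[OF that(2) this] have "conjugate G z x \<otimes> inv (conjugate G w x) \<in> ?N"
        using that by (simp add: conjugate_def m_assoc inv_mult_group)
      then have "conjugate G z x \<in> ?N #> conjugate G w x"
        using that N.rcos_module[OF is_group] by simp
      then show ?thesis using repr_independence[OF _ _ N.subgroup_axioms] that by simp
    qed
    have "x \<in> D" if "A \<in> D" "B \<in> D" "x \<in> carrier G" for x
    proof -
      have D: "y \<in> D \<longleftrightarrow> y \<in> carrier G \<and> ?N #> conjugate G g y = ?N #> g" for y
        unfolding D_eq by simp
      have "x \<in> generate G {A, B}" using that(3) generated by simp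
      then show ?thesis
      proof (induction rule: generate.induct)
        case one
        show ?case using True by (simp add: D)
      next
        case (incl h)
        then show ?case using that by auto
      next
        case (inv h)
        then have h: "h \<in> carrier G" "?N #> conjugate G g h = ?N #> g" using that by (auto simp: D)
        then have "?N #> conjugate G (conjugate G g h) (inv h) = ?N #> conjugate G g (inv h)"
          using True by (intro coset) simp_all
        then show ?case using h True by (simp add: D conjugate_inverse_cancel)
      next
        case (eng h1 h2)
        then have h: "h1 \<in> carrier G" "?N #> conjugate G g h1 = ?N #> g"
          "h2 \<in> carrier G" "?N #> conjugate G g h2 = ?N #> g" by (auto simp: D)
        then have "?N #> conjugate G (conjugate G g h1) h2 = ?N #> conjugate G g h2"
          using True by (intro coset) simp_all
        then show ?case using h True by (simp add: D conjugate_conjugate)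
      qed
    qed
    then show ?thesis
      using True iff upper_central_Suc_iff[OF upper_central_normal, of g i]
      by (auto simp: D_def simp del: upper_central.simps)
  qed (use upper_central_Suc_iff[OF upper_central_normal, of g i] in blast)
qed

text \<open>The full order makes the exponents of a word unique up to \<open>sim\<close>, see
  \<open>psi_eq_iff\<close>.\<close>

locale macdonald_2_full = macdonald_2 +
  assumes order_G: "order G = 16 * nat p ^ 7"
begin

text \<open>By Bezout, 2 p^2 is a multiple of the central exponent modulo 4 p^3, so facts about the
  latter carry over to 2 p^2.\<close>

lemma A_q: "\<exists>v. \<forall>x. A [^] (2 * p ^ 2 * x) = A [^] (central_exp \<alpha> * (v * x)) \<and>
    B [^] (2 * p ^ 2 * x) = B [^] (central_exp \<alpha> * (v * x)) \<and> [central_exp \<alpha> * v = 2 * p ^ 2] (mod 4 * p ^ 3)"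
proof -
  obtain v w where vw: "v * central_exp \<alpha> + w * (4 * p ^ 3) = 2 * p ^ 2"
    using bezout_int[of "central_exp \<alpha>" "4 * p ^ 3"] by (auto simp: gcd_central_exp_M)
  then have eq: "2 * p ^ 2 = central_exp \<alpha> * v + 4 * p ^ 3 * w" by (simp add: algebra_simps)
  then have cong: "[central_exp \<alpha> * v = 2 * p ^ 2] (mod 4 * p ^ 3)"
    by (simp add: cong_iff_dvd_diff)
  then have "[2 * p ^ 2 * x = central_exp \<alpha> * (v * x)] (mod 4 * p ^ 3)" for x
    using cong_scalar_right[OF cong_sym[OF cong], of x] by (simp add: mult.assoc)
  then show ?thesis using cong int_pow_cong[OF A A_M] int_pow_cong[OF B B_M] by blast
qed

lemma A_q_central:
  assumes "g \<in> carrier G"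
  shows "A [^] (2 * p ^ 2 * x) \<otimes> g = g \<otimes> A [^] (2 * p ^ 2 * x)"
proof -
  obtain v where "A [^] (2 * p ^ 2 * x) = A [^] (central_exp \<alpha> * (v * x))" using A_q by blast
  also have "\<dots> = (A [^] central_exp \<alpha>) [^] (v * x)" by (simp add: int_pow_pow)
  finally show ?thesis using int_pow_commute[OF _ assms A_central_exp_central[OF assms]] by simp
qed

text \<open>The extra power of \<alpha> in \<open>B_central_exp\<close> disappears: \<alpha> is 1
  modulo 2 p and is multiplied by 2 p^2.\<close>

lemma B_q: "B [^] (2 * p ^ 2 * x) = A [^] (- (2 * p ^ 2 * x))"
proof -
  obtain v where v: "B [^] (2 * p ^ 2 * x) = B [^] (central_exp \<alpha> * (v * x))"
    "[central_exp \<alpha> * v = 2 * p ^ 2] (mod 4 * p ^ 3)" using A_q by blast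
  define n where "n = Suc (nat \<bar>\<alpha>\<bar>)"
  have "B [^] (central_exp \<alpha> * (v * x)) = (B [^] central_exp \<alpha>) [^] (v * x)" by (simp add: int_pow_pow)
  also have "\<dots> = A [^] (- (central_exp \<alpha> * v * \<alpha> ^ n * x))"
    unfolding B_central_exp n_def[symmetric] by (simp add: int_pow_pow mult_ac)
  also have "\<dots> = A [^] (- (2 * p ^ 2 * x))"
  proof (rule int_pow_cong[OF A A_M])
    obtain z where "\<alpha> ^ n = 1 + int n * (2 * p * u) + int (n choose 2) * (2 * p * u) ^ 2 + z * (2 * p * u) ^ 3"
      using power_expansion[of "2 * p * u" n] by blast
    then have "2 * p ^ 2 * \<alpha> ^ n = 2 * p ^ 2 + 4 * p ^ 3 * (int n * u + 2 * int (n choose 2) * p * u ^ 2 + 4 * z * p ^ 2 * u ^ 3)"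
      by (simp add: poly_simps)
    then have "[2 * p ^ 2 * \<alpha> ^ n = 2 * p ^ 2] (mod 4 * p ^ 3)" by (simp add: cong_iff_dvd_diff)
    then have "[central_exp \<alpha> * v * \<alpha> ^ n = 2 * p ^ 2] (mod 4 * p ^ 3)"
      using cong_scalar_right[OF v(2), of "\<alpha> ^ n"] cong_trans by blast
    then show "[- (central_exp \<alpha> * v * \<alpha> ^ n * x) = - (2 * p ^ 2 * x)] (mod 4 * p ^ 3)"
      by (intro cong_minus_minus_iff[THEN iffD2] cong_scalar_right)
  qed
  finally show ?thesis using v by simp
qed

text \<open>The term with \<open>tri\<close> contributes 2 p^3 u y modulo 4 p^3, and u is odd;
  \<open>tet\<close> is a multiple of p and contributes nothing.\<close>

lemma sigma_q: "\<exists>z. \<sigma> n = int n + 2 * p ^ 3 * y + 4 * p ^ 3 * z" if n: "int n = 2 * p ^ 2 * y"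
proof -
  obtain z where z: "\<sigma> n = int n + 2 * p * u * tri (int n) + 4 * p ^ 2 * u ^ 2 * tet (int n) + 4 * p ^ 3 * z"
    using geom_sum_alpha by blast
  have n': "int n = 0 + 2 * p * (p * y)" "int n = 2 * (p ^ 2 * y)" by (simp_all add: n power2_eq_square)
  obtain w where w: "tet (int n) = p * w" unfolding n'(1) using tet_shift[of 0 "p * y"] by auto
  have t: "tri (int n) = p ^ 2 * y * (2 * (p ^ 2 * y) + 1)" unfolding n'(2) by (rule tri_double)
  obtain e where e: "u = 2 * e + 1" using odd_u by (rule oddE)
  have "\<sigma> n = int n + 2 * p ^ 3 * y + 4 * p ^ 3 * (e * y + u * p ^ 2 * y ^ 2 + u ^ 2 * w + z)"
    unfolding z t w by (simp add: e poly_simps)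
  then show ?thesis by blast
qed

text \<open>The exponent in \<open>C_pow_eq_A_pow\<close> is -2 p^3 modulo 4 p^3, which is the same
  as 2 p^3.\<close>

lemma C_q: "C [^] (2 * p ^ 2 * x) = A [^] (2 * p ^ 3 * x)"
proof -
  define n where "n = nat (2 * p ^ 2)"
  have n: "int n = 2 * p ^ 2 * 1" using p_pos by (simp add: n_def)
  obtain z where z: "\<sigma> n = int n + 2 * p ^ 3 * 1 + 4 * p ^ 3 * z" using sigma_q[OF n] by blast
  have "C [^] int n = A [^] (int n - \<sigma> n)"
    using A_q_central[OF B, of 1] n by (intro C_pow_eq_A_pow) simp
  also have "\<dots> = A [^] (2 * p ^ 3)"
    unfolding z by (rule int_pow_cong[OF A A_M]) (simp add: cong_iff_dvd_diff)
  finally have "C [^] (2 * p ^ 2) = A [^] (2 * p ^ 3)" using n by simp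
  then show ?thesis by (metis A C_closed int_pow_pow)
qed

section \<open>Words and the uniqueness of their exponents\<close>

definition psi :: "int \<times> int \<times> int \<Rightarrow> 'a" where
  "psi = (\<lambda>(i, k, j). A [^] i \<otimes> C [^] k \<otimes> B [^] j)"

lemma psi_closed [simp, intro]: "psi v \<in> carrier G"
  by (simp add: psi_def split: prod.splits)

lemma psi_sim: "psi v = psi w" if "sim v w"
proof -
  obtain i k j i' k' j' where vw: "v = (i, k, j)" "w = (i', k', j')" by (metis prod_cases3)
  with that obtain x y z where xyz: "k = k' + 2 * p ^ 2 * x" "j = j' + 2 * p ^ 2 * y"
    "i = i' + 2 * p ^ 2 * y - 2 * p ^ 3 * x + 4 * p ^ 3 * z" using simE by metis
  have B: "B [^] j = A [^] (2 * p ^ 2 * (- y)) \<otimes> B [^] j'"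
    using A_q_central[of "B [^] j'" "- y"] by (simp add: xyz int_pow_mult B_q)
  have "2 * p ^ 3 * x = 2 * p ^ 2 * (p * x)" by (simp add: power2_eq_square power3_eq_cube)
  then have Cq: "C [^] (2 * p ^ 2 * x) = A [^] (2 * p ^ 2 * (p * x))" using C_q[of x] by (simp only:)
  then have C: "C [^] k = A [^] (2 * p ^ 2 * (p * x)) \<otimes> C [^] k'"
    using A_q_central[of "C [^] k'" "p * x"] unfolding xyz int_pow_mult[OF C_closed] Cq by simp
  have "A [^] i \<otimes> C [^] k \<otimes> B [^] j
      = A [^] i \<otimes> A [^] (2 * p ^ 2 * (p * x)) \<otimes> (C [^] k' \<otimes> A [^] (2 * p ^ 2 * (- y))) \<otimes> B [^] j'"
    unfolding B C by (simp add: m_assoc)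
  also have "\<dots> = A [^] i \<otimes> A [^] (2 * p ^ 2 * (p * x)) \<otimes> A [^] (2 * p ^ 2 * (- y)) \<otimes> C [^] k' \<otimes> B [^] j'"
    unfolding A_q_central[OF int_pow_closed[OF C_closed], symmetric] by (simp add: m_assoc)
  also have "A [^] i \<otimes> A [^] (2 * p ^ 2 * (p * x)) \<otimes> A [^] (2 * p ^ 2 * (- y)) = A [^] i'"
  proof -
    have "A [^] (i + 2 * p ^ 2 * (p * x) + 2 * p ^ 2 * (- y)) = A [^] i'"
      by (rule int_pow_cong[OF A A_M]) (simp add: xyz cong_iff_dvd_diff power2_eq_square power3_eq_cube)
    then show ?thesis by (simp only: int_pow_mult A int_pow_closed)
  qed
  finally show ?thesis by (simp add: vw psi_def)
qed

lemma psi_surj: "g \<in> carrier G \<Longrightarrow> \<exists>v. g = psi v"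
  using normal_form[of g] by (auto simp: psi_def)

lemma key_idem: "key (sec (key v)) = key v"
  by (rule key_sec) simp

text \<open>\<open>psi\<close> induces a map from \<open>box\<close> onto the group, and both have
  16 p^7 elements.\<close>

lemma psi_eq_iff: "psi v = psi w \<longleftrightarrow> sim v w"
proof
  define f where "f = (\<lambda>x. psi (sec x))"
  have psi_f: "psi v = f (key v)" for v
    unfolding f_def by (rule psi_sim) (rule key_idem[symmetric])
  have "f ` box = carrier G"
  proof
    show "carrier G \<subseteq> f ` box" using psi_surj psi_f by blast
  qed (auto simp: f_def)
  moreover have "card box = card (carrier G)" using card_box order_G by (simp add: order_def)
  ultimately have "inj_on f box" using finite_box by (intro eq_card_imp_inj_on) simp_all
  moreover assume "psi v = psi w"
  ultimately show "sim v w" unfolding psi_f by (auto dest: inj_onD)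
qed (rule psi_sim)

text \<open>The inverse of \<alpha> modulo 4 p^3: the geometric series in -2 p u stops after the
  square.\<close>

definition beta :: int where "beta = 1 - 2 * p * u + 4 * p ^ 2 * u ^ 2"

lemma alpha_beta_pow: "[\<alpha> ^ k * beta ^ k = 1] (mod 4 * p ^ 3)"
proof -
  have "\<alpha> * beta = 1 + 4 * p ^ 3 * (2 * u ^ 3)"
    by (simp add: beta_def poly_simps)
  then have "[\<alpha> * beta = 1] (mod 4 * p ^ 3)" by (simp add: cong_iff_dvd_diff)
  from cong_pow[OF this, of k] show ?thesis by (simp add: power_mult_distrib)
qed

text \<open>As w is odd, \<open>beta ^ k - 1\<close> is divisible by the same powers of 2 as 2 p k,
  as far as this is visible modulo 4 p^3.\<close>

lemma beta_pow: "\<exists>w z. odd w \<and> beta ^ k - 1 = 2 * p * int k * w + 4 * p ^ 3 * z"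
proof -
  define u' where "u' = - u + 2 * p * u ^ 2"
  have "odd u'" using odd_u by (simp add: u'_def)
  have b: "beta = 1 + 2 * p * u'" by (simp add: beta_def u'_def algebra_simps power2_eq_square)
  obtain z where "beta ^ k = 1 + int k * (2 * p * u') + int (k choose 2) * (2 * p * u') ^ 2 + z * (2 * p * u') ^ 3"
    unfolding b using power_expansion by blast
  then have "beta ^ k - 1 = 2 * p * int k * u' + 2 * p ^ 2 * u' ^ 2 * (2 * int (k choose 2)) + 4 * p ^ 3 * (2 * z * u' ^ 3)"
    by (simp add: poly_simps)
  also have "\<dots> = 2 * p * int k * (u' + p * u' ^ 2 * (int k - 1)) + 4 * p ^ 3 * (2 * z * u' ^ 3)"
    unfolding two_choose_2 by (simp add: poly_simps)
  finally have "beta ^ k - 1 = 2 * p * int k * (u' + p * u' ^ 2 * (int k - 1)) + 4 * p ^ 3 * (2 * z * u' ^ 3)" .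
  moreover have "even p" by (simp add: p_def)
  then have "odd (u' + p * u' ^ 2 * (int k - 1))" using \<open>odd u'\<close> by simp
  ultimately show ?thesis by blast
qed

lemma pow2_dvd_odd_cancel:
  assumes "odd w" "x = 2 ^ n"
  shows "x dvd (k::int) * w \<longleftrightarrow> x dvd k"
proof -
  have "coprime x w" using assms by simp
  then show ?thesis by (simp add: coprime_dvd_mult_left_iff)
qed

lemma M_dvd_beta_pow: "4 * p ^ 3 dvd beta ^ k - 1 \<longleftrightarrow> 2 * p ^ 2 dvd int k"
  and q_dvd_beta_pow: "2 * p ^ 2 dvd beta ^ k - 1 \<longleftrightarrow> p dvd int k"
proof -
  obtain w z where wz: "odd w" "beta ^ k - 1 = 2 * p * int k * w + 4 * p ^ 3 * z" using beta_pow by blast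
  have "4 * p ^ 3 dvd beta ^ k - 1 \<longleftrightarrow> 4 * p ^ 3 dvd 2 * p * int k * w"
    unfolding wz(2) by (simp add: dvd_add_left_iff)
  also have "\<dots> \<longleftrightarrow> (2 * p) * (2 * p ^ 2) dvd (2 * p) * (int k * w)"
    by (simp add: power2_eq_square power3_eq_cube mult_ac)
  also have "\<dots> \<longleftrightarrow> 2 * p ^ 2 dvd int k"
    using p_pos pow2_dvd_odd_cancel[OF wz(1) q_power] by (simp only: dvd_mult_cancel_left) simp
  finally show "4 * p ^ 3 dvd beta ^ k - 1 \<longleftrightarrow> 2 * p ^ 2 dvd int k" .
  have "4 * p ^ 3 = 2 * p ^ 2 * (2 * p)" by (simp add: power2_eq_square power3_eq_cube)
  then have "2 * p ^ 2 dvd beta ^ k - 1 \<longleftrightarrow> 2 * p ^ 2 dvd 2 * p * int k * w"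
    unfolding wz(2) by (simp add: dvd_add_left_iff)
  also have "\<dots> \<longleftrightarrow> (2 * p) * p dvd (2 * p) * (int k * w)"
    by (simp add: power2_eq_square mult_ac)
  also have "\<dots> \<longleftrightarrow> p dvd int k"
    using p_pos pow2_dvd_odd_cancel[OF wz(1) p_power] by (simp only: dvd_mult_cancel_left) simp
  finally show "2 * p ^ 2 dvd beta ^ k - 1 \<longleftrightarrow> p dvd int k" .
qed

section \<open>Conjugates of words by the generators\<close>

lemma C_A_pow: "C [^] int k \<otimes> A [^] (i::int) = A [^] (beta ^ k * i) \<otimes> C [^] int k"
proof -
  have "A [^] (beta ^ k * i) \<otimes> C [^] k = C [^] k \<otimes> A [^] (\<alpha> ^ k * (beta ^ k * i))"
    by (rule A_C_pow)
  also have "A [^] (\<alpha> ^ k * (beta ^ k * i)) = A [^] i"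
    using cong_scalar_right[OF alpha_beta_pow, of k i] by (intro int_pow_cong[OF A A_M]) (simp add: mult.assoc)
  finally show ?thesis by (simp add: int_pow_int)
qed

lemma conj_B_C_beta: "conjugate G (B [^] (j::int)) (C [^] int k) = B [^] (beta ^ k * j)"
proof -
  have "conjugate G (B [^] (\<alpha> ^ k * (beta ^ k * j))) (C [^] k) = B [^] (beta ^ k * j)"
    by (rule conj_B_C_pow)
  moreover have "B [^] (\<alpha> ^ k * (beta ^ k * j)) = B [^] j"
    using cong_scalar_right[OF alpha_beta_pow, of k j] by (intro int_pow_cong[OF B B_M]) (simp add: mult.assoc)
  ultimately show ?thesis by (simp add: int_pow_int)
qed

lemma conj_psi_A:
  "conjugate G (psi (i, int k, int j)) A = psi (i - 1 + beta ^ k, int k - int j, \<sigma> j)"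
proof -
  have "conjugate G (psi (i, int k, int j)) A
      = A [^] (- 1::int) \<otimes> A [^] i \<otimes> (C [^] int k \<otimes> A [^] (1::int)) \<otimes> conjugate G (B [^] int j) A"
    by (simp add: psi_def conjugate_def m_assoc int_pow_neg del: int_pow_int)
  also have "\<dots> = A [^] (- 1::int) \<otimes> A [^] i \<otimes> A [^] (beta ^ k) \<otimes> (C [^] int k \<otimes> C [^] (- int j)) \<otimes> B [^] (\<sigma> j)"
    unfolding C_A_pow conj_B_pow_A by (simp add: m_assoc del: int_pow_int)
  also have "\<dots> = psi (i - 1 + beta ^ k, int k - int j, \<sigma> j)"
    by (simp add: psi_def int_pow_mult[symmetric] algebra_simps del: int_pow_int)
  finally show ?thesis .
qed

lemma conj_psi_B:
  "conjugate G (psi (int i, int k, j)) B = psi (beta ^ i * (\<sigma> i), int k + int i, j + 1 - beta ^ k)"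
proof -
  have "inv B \<otimes> C [^] int k = C [^] int k \<otimes> conjugate G (B [^] (- 1::int)) (C [^] int k)"
    by (simp add: conjugate_def m_assoc int_pow_neg del: int_pow_int)
  also have "\<dots> = C [^] int k \<otimes> B [^] (- (beta ^ k))" unfolding conj_B_C_beta by simp
  finally have BC: "inv B \<otimes> C [^] int k = C [^] int k \<otimes> B [^] (- (beta ^ k))" .
  have "conjugate G (psi (int i, int k, j)) B = conjugate G (A [^] int i) B \<otimes> (inv B \<otimes> C [^] int k) \<otimes> B [^] j \<otimes> B [^] (1::int)"
    by (simp add: psi_def conjugate_def m_assoc del: int_pow_int)
  also have "\<dots> = (C [^] int i \<otimes> A [^] (\<sigma> i)) \<otimes> C [^] int k \<otimes> (B [^] (- (beta ^ k)) \<otimes> B [^] j \<otimes> B [^] (1::int))"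
    unfolding BC conj_A_pow_B by (simp add: m_assoc del: int_pow_int)
  also have "\<dots> = A [^] (beta ^ i * (\<sigma> i)) \<otimes> (C [^] int i \<otimes> C [^] int k) \<otimes> (B [^] (- (beta ^ k)) \<otimes> B [^] j \<otimes> B [^] (1::int))"
    unfolding C_A_pow by (simp add: m_assoc del: int_pow_int)
  also have "\<dots> = psi (beta ^ i * (\<sigma> i), int k + int i, j + 1 - beta ^ k)"
  proof -
    have "B [^] (- (beta ^ k)) \<otimes> B [^] j \<otimes> B [^] (1::int) = B [^] (j + 1 - beta ^ k)"
      by (simp only: int_pow_mult[OF B, symmetric]) (simp add: algebra_simps)
    then show ?thesis
      by (simp only: psi_def prod.case int_pow_mult[OF C_closed, symmetric] add.commute[of "int i"])
  qed
  finally show ?thesis .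
qed

text \<open>The conjugation formulas take natural exponents. Reduction modulo 4 p^3 provides them
  and preserves divisibility by every divisor of 4 p^3.\<close>

lemma psi_nat: obtains i' k' j' where "psi (i, k, j) = psi (int i', int k', int j')"
  "4 * p ^ 3 dvd int i' - i" "4 * p ^ 3 dvd int k' - k" "4 * p ^ 3 dvd int j' - j"
proof -
  let ?M = "4 * p ^ 3"
  have eq: "int (nat (x mod ?M)) = x - ?M * (x div ?M)" for x
    using p_pos by (simp add: minus_mult_div_eq_mod)
  have "sim (i, k, j) (int (nat (i mod ?M)), int (nat (k mod ?M)), int (nat (j mod ?M)))"
    unfolding eq
    by (rule simI[where x = "2 * p * (k div ?M)" and y = "2 * p * (j div ?M)"
          and z = "(i div ?M) - (j div ?M) + p * (k div ?M)"])
      (simp_all add: poly_simps)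
  then have "psi (i, k, j) = psi (int (nat (i mod ?M)), int (nat (k mod ?M)), int (nat (j mod ?M)))"
    by (rule psi_sim)
  then show ?thesis by (rule that) (simp_all only: eq, simp_all)
qed

text \<open>\<open>C_sub e\<close> is \<open>Z_1\<close> for \<open>e = 2 p^2\<close> and \<open>Z_2\<close> for \<open>e = p\<close>.\<close>

definition C_sub :: "int \<Rightarrow> 'a set" where
  "C_sub e = {A [^] (2 * p ^ 2 * x) \<otimes> C [^] (e * y) | x y. True}"

text \<open>As \<alpha>^p is 1 modulo 2 p^2, conjugation by w = C^p multiplies A by a central
  element. Then so does conjugation of w by A, and in this form the statement passes to all integer
  powers of w before it is turned back into one about A.\<close>

lemma conj_A_C_p: "\<exists>s. \<forall>i y. conjugate G (A [^] i) (C [^] (p * y)) = A [^] (i + 2 * p ^ 2 * (s * y * i))"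
proof -
  define n where "n = nat p"
  have n: "int n = p" using p_pos by (simp add: n_def)
  obtain z where "\<alpha> ^ n = 1 + int n * (2 * p * u) + int (n choose 2) * (2 * p * u) ^ 2 + z * (2 * p * u) ^ 3"
    using power_expansion[of "2 * p * u" n] by blast
  then have "\<alpha> ^ n = 1 + 2 * p ^ 2 * (u + 2 * int (n choose 2) * u ^ 2 + 4 * z * p * u ^ 3)"
    by (simp add: n poly_simps)
  then obtain s where s: "\<alpha> ^ n = 1 + 2 * p ^ 2 * s" by blast
  define w where "w = C [^] p"
  have w: "w \<in> carrier G" by (simp add: w_def)
  have central: "A [^] (2 * p ^ 2 * x) \<otimes> g = g \<otimes> A [^] (2 * p ^ 2 * x)" if "g \<in> carrier G" for g x
    using that by (rule A_q_central)
  have Aw: "conjugate G A w = A \<otimes> A [^] (2 * p ^ 2 * s)"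
    using conj_A_C_pow[of 1 n] by (simp add: w_def n s int_pow_mult flip: int_pow_int)
  have "conjugate G w A = w \<otimes> inv (conjugate G A w) \<otimes> A"
    using w by (simp add: conjugate_def m_assoc inv_mult_group)
  also have "\<dots> = w \<otimes> A [^] (2 * p ^ 2 * (- s))"
    unfolding Aw using w by (simp add: inv_mult_group m_assoc int_pow_neg)
  finally have wA: "conjugate G w A = w \<otimes> A [^] (2 * p ^ 2 * (- s))" .
  have "conjugate G (w [^] y) A = w [^] y \<otimes> A [^] (2 * p ^ 2 * (- s * y))" for y :: int
  proof -
    have "conjugate G (w [^] y) A = (w \<otimes> A [^] (2 * p ^ 2 * (- s))) [^] y"
      using w by (simp only: conjugate_int_pow A wA)
    also have "\<dots> = w [^] y \<otimes> A [^] (2 * p ^ 2 * (- s * y))"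
      using int_pow_mult_distrib[OF central[OF w, symmetric] w int_pow_closed[OF A], of "- s" y]
      by (simp only: int_pow_pow A mult.assoc)
    finally show ?thesis .
  qed
  from this[of "- y" for y] have wyA: "conjugate G (w [^] (- y)) A = w [^] (- y) \<otimes> A [^] (2 * p ^ 2 * (s * y))" for y
    by simp
  have "conjugate G A (w [^] y) = A [^] (1 + 2 * p ^ 2 * (s * y))" for y :: int
  proof -
    have "conjugate G A (w [^] y) = A \<otimes> conjugate G (w [^] (- y)) A \<otimes> w [^] y"
      using w by (simp add: conjugate_def m_assoc int_pow_neg)
    also have "\<dots> = A \<otimes> (w [^] (- y) \<otimes> (A [^] (2 * p ^ 2 * (s * y)) \<otimes> w [^] y))"
      unfolding wyA using w by (simp add: m_assoc)
    also have "\<dots> = A \<otimes> A [^] (2 * p ^ 2 * (s * y))"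
      unfolding central[OF int_pow_closed[OF w]] using w by (simp add: int_pow_neg)
    finally show ?thesis by (simp add: int_pow_mult)
  qed
  then have iy: "conjugate G (A [^] i) (w [^] y) = A [^] ((1 + 2 * p ^ 2 * (s * y)) * i)" for i y :: int
    using w by (simp add: conjugate_int_pow int_pow_pow)
  have "conjugate G (A [^] i) (C [^] (p * y)) = A [^] (i + 2 * p ^ 2 * (s * y * i))" for i y :: int
    using iy[of i y] by (simp add: w_def int_pow_pow algebra_simps)
  then show ?thesis by blast
qed

lemma C_p_psi:
  "\<exists>s. \<forall>y i k j. C [^] (p * y) \<otimes> psi (i, k, j) = psi (i + 2 * p ^ 2 * (s * y * i), k + p * y, j)"
proof -
  obtain s where s: "\<And>i y. conjugate G (A [^] i) (C [^] (p * y)) = A [^] (i + 2 * p ^ 2 * (s * y * i))"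
    using conj_A_C_p by blast
  have "C [^] (p * y) \<otimes> psi (i, k, j) = psi (i + 2 * p ^ 2 * (- s * y * i), k + p * y, j)" for y i k j
  proof -
    have "C [^] (p * y) \<otimes> A [^] i = conjugate G (A [^] i) (C [^] (p * (- y))) \<otimes> C [^] (p * y)"
      by (simp add: conjugate_def m_assoc int_pow_neg)
    then have *: "C [^] (p * y) \<otimes> A [^] i = A [^] (i + 2 * p ^ 2 * (- s * y * i)) \<otimes> C [^] (p * y)"
      unfolding s by simp
    have "C [^] (p * y) \<otimes> psi (i, k, j) = (C [^] (p * y) \<otimes> A [^] i) \<otimes> C [^] k \<otimes> B [^] j"
      by (simp add: psi_def m_assoc)
    also have "\<dots> = A [^] (i + 2 * p ^ 2 * (- s * y * i)) \<otimes> (C [^] (p * y) \<otimes> C [^] k) \<otimes> B [^] j"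
      unfolding * by (simp add: m_assoc)
    finally show ?thesis by (simp add: psi_def int_pow_mult[symmetric] add.commute)
  qed
  then show ?thesis by blast
qed

lemma A_psi: "A [^] x \<otimes> psi (i, k, j) = psi (x + i, k, j)"
  by (simp add: psi_def m_assoc int_pow_mult)

lemma psi_0: "psi (0, 0, 0) = \<one>"
  by (simp add: psi_def)

text \<open>The conditions on the exponents decouple because moving C^(e y) past A^i and the
  identifications made by \<open>sim\<close> change i only by multiples of 2 p^2, which the first
  factor of \<open>C_sub\<close> absorbs.\<close>

lemma in_C_sub_coset_iff:
  assumes "p dvd e" "e dvd 2 * p ^ 2"
  shows "psi (i', k', j') \<in> C_sub e #> psi (i, k, j) \<longleftrightarrow>
    2 * p ^ 2 dvd i' - i \<and> e dvd k' - k \<and> 2 * p ^ 2 dvd j' - j"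
proof -
  obtain f where f: "e = p * f" using assms(1) by blast
  obtain s where s: "\<And>y i k j. C [^] (p * y) \<otimes> psi (i, k, j) = psi (i + 2 * p ^ 2 * (s * y * i), k + p * y, j)"
    using C_p_psi by blast
  have mult: "A [^] (2 * p ^ 2 * x) \<otimes> C [^] (e * y) \<otimes> psi (i, k, j)
      = psi (i + 2 * p ^ 2 * (x + s * (f * y) * i), k + e * y, j)" for x y
  proof -
    have "A [^] (2 * p ^ 2 * x) \<otimes> C [^] (e * y) \<otimes> psi (i, k, j)
        = A [^] (2 * p ^ 2 * x) \<otimes> (C [^] (p * (f * y)) \<otimes> psi (i, k, j))"
      by (simp add: m_assoc f mult.assoc)
    also have "\<dots> = psi (2 * p ^ 2 * x + (i + 2 * p ^ 2 * (s * (f * y) * i)), k + p * (f * y), j)"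
      unfolding s A_psi ..
    finally show ?thesis by (simp add: f algebra_simps)
  qed
  show ?thesis
  proof
    assume "psi (i', k', j') \<in> C_sub e #> psi (i, k, j)"
    then obtain x y where "psi (i', k', j') = A [^] (2 * p ^ 2 * x) \<otimes> C [^] (e * y) \<otimes> psi (i, k, j)"
      by (auto simp: C_sub_def r_coset_def)
    then have "sim (i', k', j') (i + 2 * p ^ 2 * (x + s * (f * y) * i), k + e * y, j)"
      unfolding mult psi_eq_iff .
    then obtain a b d where *: "k' = k + e * y + 2 * p ^ 2 * a" "j' = j + 2 * p ^ 2 * b"
      "i' = i + 2 * p ^ 2 * (x + s * (f * y) * i) + 2 * p ^ 2 * b - 2 * p ^ 3 * a + 4 * p ^ 3 * d"
      by (rule simE)
    have "i' - i = 2 * p ^ 2 * (x + s * (f * y) * i + b - p * a + 2 * p * d)"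
      unfolding * by (simp add: poly_simps)
    moreover have "e dvd k' - k" using assms(2) unfolding * by (simp add: dvd_add)
    ultimately show "2 * p ^ 2 dvd i' - i \<and> e dvd k' - k \<and> 2 * p ^ 2 dvd j' - j"
      using * by simp
  next
    assume "2 * p ^ 2 dvd i' - i \<and> e dvd k' - k \<and> 2 * p ^ 2 dvd j' - j"
    then obtain a b d where "i' - i = 2 * p ^ 2 * a" "k' - k = e * b" "j' - j = 2 * p ^ 2 * d"
      by (elim conjE dvdE) blast
    then have *: "i' = i + 2 * p ^ 2 * a" "k' = k + e * b" "j' = j + 2 * p ^ 2 * d" by simp_all
    \<comment> \<open>The term -d compensates B^(2 p^2 d) = A^(-2 p^2 d), and the term with s the
      passage of C^(e b) past A^i.\<close>
    have "sim (i', k', j') (i + 2 * p ^ 2 * ((a - d - s * (f * b) * i) + s * (f * b) * i), k + e * b, j)"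
      by (rule simI[where x = 0 and y = d and z = 0]) (simp_all add: * algebra_simps)
    then have "psi (i', k', j') = A [^] (2 * p ^ 2 * (a - d - s * (f * b) * i)) \<otimes> C [^] (e * b) \<otimes> psi (i, k, j)"
      unfolding mult by (rule psi_sim)
    then show "psi (i', k', j') \<in> C_sub e #> psi (i, k, j)"
      unfolding C_sub_def r_coset_def by blast
  qed
qed

lemma in_C_sub_iff:
  assumes "p dvd e" "e dvd 2 * p ^ 2"
  shows "psi (i, k, j) \<in> C_sub e \<longleftrightarrow> 2 * p ^ 2 dvd i \<and> e dvd k \<and> 2 * p ^ 2 dvd j"
proof -
  have "C_sub e \<subseteq> carrier G" by (auto simp: C_sub_def)
  then have "C_sub e #> psi (0, 0, 0) = C_sub e" by (simp add: psi_0 coset_mult_one)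
  then show ?thesis using in_C_sub_coset_iff[OF assms, of i k j 0 0 0] by simp
qed

section \<open>The first three terms of the upper central series\<close>

lemma upper_central_Suc_psi:
  "psi (int i, int k, int j) \<in> upper_central G (Suc l) \<longleftrightarrow>
    psi (int i - 1 + beta ^ k, int k - int j, \<sigma> j) \<in> upper_central G l #> psi (int i, int k, int j) \<and>
    psi (beta ^ i * (\<sigma> i), int k + int i, int j + 1 - beta ^ k) \<in> upper_central G l #> psi (int i, int k, int j)"
  by (simp add: upper_central_Suc_generators conj_psi_A conj_psi_B del: upper_central.simps)

lemma subset_eqI_psi:
  assumes "D \<subseteq> carrier G" "E \<subseteq> carrier G"
    and "\<And>i k j. psi (int i, int k, int j) \<in> D \<longleftrightarrow> psi (int i, int k, int j) \<in> E"
  shows "D = E"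
proof -
  have "\<exists>i k j. g = psi (int i, int k, int j)" if "g \<in> carrier G" for g
    using psi_surj[OF that] psi_nat by (metis prod_cases3)
  then show ?thesis using assms by blast
qed

lemma upper_central_carrier: "upper_central G l \<subseteq> carrier G"
  using upper_central_normal normal_imp_subgroup subgroup.subset by blast

lemma sigma_dvd: "\<exists>z. \<sigma> n = int n + 2 * p * u * tri (int n) + 2 * p ^ 2 * z"
proof -
  obtain z where "\<sigma> n = int n + 2 * p * u * tri (int n) + 4 * p ^ 2 * u ^ 2 * tet (int n) + 4 * p ^ 3 * z"
    using geom_sum_alpha by blast
  then show ?thesis
    by (intro exI[of _ "2 * u ^ 2 * tet (int n) + 2 * p * z"]) (simp add: poly_simps)
qed

lemma upper_central_1: "upper_central G 1 = C_sub (2 * p ^ 2)"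
proof (rule subset_eqI_psi)
  have dvd: "p dvd 2 * p ^ 2" by (simp add: power2_eq_square)
  fix i k j :: nat
  have one: "{\<one>} #> psi (int i, int k, int j) = {psi (int i, int k, int j)}"
    by (simp add: r_coset_def)
  show "psi (int i, int k, int j) \<in> upper_central G 1 \<longleftrightarrow> psi (int i, int k, int j) \<in> C_sub (2 * p ^ 2)"
  proof
    assume "psi (int i, int k, int j) \<in> upper_central G 1"
    then have sims: "sim (int i - 1 + beta ^ k, int k - int j, \<sigma> j) (int i, int k, int j)"
      "sim (beta ^ i * (\<sigma> i), int k + int i, int j + 1 - beta ^ k) (int i, int k, int j)"
      using upper_central_Suc_psi[of i k j 0] by (simp_all only: One_nat_def upper_central.simps(1) one singleton_iff psi_eq_iff)
    obtain x y z where A: "int k - int j = int k + 2 * p ^ 2 * x" "\<sigma> j = int j + 2 * p ^ 2 * y"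
      "int i - 1 + beta ^ k = int i + 2 * p ^ 2 * y - 2 * p ^ 3 * x + 4 * p ^ 3 * z"
      using simE[OF sims(1)] by metis
    obtain x' where B: "int k + int i = int k + 2 * p ^ 2 * x'"
      using simE[OF sims(2)] by metis
    \<comment> \<open>The exponents of C alone give divisibility of j, from conjugation by A, and of
      i, from conjugation by B. The exponents of A then decide about k.\<close>
    have j: "int j = 2 * p ^ 2 * (- x)" using A(1) by simp
    obtain w where "\<sigma> j = int j + 2 * p ^ 3 * (- x) + 4 * p ^ 3 * w"
      using sigma_q[OF j] by blast
    then have "2 * p ^ 2 * y = 2 * p ^ 3 * (- x) + 4 * p ^ 3 * w" using A(2) by simp
    then have "beta ^ k - 1 = 4 * p ^ 3 * (z + w - x)" using A(3) by (simp add: algebra_simps)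
    then have "4 * p ^ 3 dvd beta ^ k - 1" by (rule dvdI)
    then have "2 * p ^ 2 dvd int k" using M_dvd_beta_pow by blast
    then show "psi (int i, int k, int j) \<in> C_sub (2 * p ^ 2)"
      using j B by (simp add: in_C_sub_iff[OF dvd])
  next
    assume "psi (int i, int k, int j) \<in> C_sub (2 * p ^ 2)"
    then obtain x y where xy: "psi (int i, int k, int j) = A [^] (2 * p ^ 2 * x) \<otimes> C [^] (2 * p ^ 2 * y)"
      unfolding C_sub_def by blast
    have "2 * p ^ 3 * y = 2 * p ^ 2 * (p * y)" by (simp add: power2_eq_square power3_eq_cube)
    then have "C [^] (2 * p ^ 2 * y) = A [^] (2 * p ^ 2 * (p * y))" using C_q[of y] by (simp only:)
    then have g: "psi (int i, int k, int j) = A [^] (2 * p ^ 2 * (x + p * y))"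
      using xy by (simp only: int_pow_mult[OF A] distrib_left)
    have "conjugate G (psi (int i, int k, int j)) x = psi (int i, int k, int j)" if "x \<in> carrier G" for x
      using that unfolding g by (simp add: conjugate_eq_iff_commute A_q_central)
    then show "psi (int i, int k, int j) \<in> upper_central G 1"
      using upper_central_Suc_generators[of "psi (int i, int k, int j)" 0] by (simp add: one del: upper_central.simps(2))
  qed
qed (use upper_central_carrier in \<open>auto simp: C_sub_def\<close>)

text \<open>Compared with Z_1, \<open>beta ^ k - 1\<close> has to vanish only modulo 2 p^2, which
  weakens the condition on k from 2 p^2 to p.\<close>

lemma upper_central_2: "upper_central G 2 = C_sub p"
proof (rule subset_eqI_psi)
  have dvd: "p dvd 2 * p ^ 2" by (simp add: power2_eq_square)
  fix i k j :: nat
  have two: "upper_central G 2 = upper_central G (Suc 1)"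
    by (simp add: numeral_2_eq_2 del: upper_central.simps)
  have "psi (int i, int k, int j) \<in> upper_central G 2 \<longleftrightarrow>
      (2 * p ^ 2 dvd beta ^ k - 1 \<and> 2 * p ^ 2 dvd - int j \<and> 2 * p ^ 2 dvd \<sigma> j - int j) \<and>
      (2 * p ^ 2 dvd beta ^ i * (\<sigma> i) - int i \<and> 2 * p ^ 2 dvd int i \<and> 2 * p ^ 2 dvd 1 - beta ^ k)"
    unfolding two using upper_central_Suc_psi[of i k j 1]
    by (simp add: upper_central_1[unfolded One_nat_def] in_C_sub_coset_iff[OF dvd dvd_refl] del: upper_central.simps)
  also have "\<dots> \<longleftrightarrow> 2 * p ^ 2 dvd int i \<and> p dvd int k \<and> 2 * p ^ 2 dvd int j"
  proof -
    have sigma: "2 * p ^ 2 dvd \<sigma> n - int n" if n: "2 * p ^ 2 dvd int n" for n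
    proof -
      obtain y where y: "int n = 2 * p ^ 2 * y" using n by blast
      obtain z where "\<sigma> n = int n + 2 * p ^ 3 * y + 4 * p ^ 3 * z" using sigma_q[OF y] by blast
      then have "\<sigma> n - int n = 2 * p ^ 2 * (p * y + 2 * p * z)"
        by (simp add: poly_simps)
      then show ?thesis by simp
    qed
    have "2 * p ^ 2 dvd beta ^ i * (\<sigma> i) - int i" if "2 * p ^ 2 dvd int i"
    proof -
      have "2 * p ^ 2 dvd \<sigma> i" using dvd_add[OF sigma[OF that] that] by simp
      then show ?thesis using that by (rule dvd_diff[OF dvd_mult])
    qed
    then show ?thesis
      using sigma[of j] q_dvd_beta_pow[of k] dvd_minus_iff[of "2 * p ^ 2" "beta ^ k - 1"] by auto
  qed
  finally show "psi (int i, int k, int j) \<in> upper_central G 2 \<longleftrightarrow> psi (int i, int k, int j) \<in> C_sub p"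
    by (simp add: in_C_sub_iff[OF dvd_refl dvd])
qed (use upper_central_carrier in \<open>auto simp: C_sub_def\<close>)

text \<open>Modulo 2 p^2 the difference is 2 p u \<open>tri n\<close>, so p has to divide n (n + 1)
  / 2. As n + 1 is odd, this means that 2 p divides n; the factor 2 p in the description of Z_3
  comes from here.\<close>

lemma q_dvd_sigma_iff:
  assumes "p dvd int n"
  shows "2 * p ^ 2 dvd \<sigma> n - int n \<longleftrightarrow> 2 * p dvd int n"
proof -
  obtain z where "\<sigma> n = int n + 2 * p * u * tri (int n) + 2 * p ^ 2 * z"
    using sigma_dvd by blast
  then have "2 * p ^ 2 dvd \<sigma> n - int n \<longleftrightarrow> 2 * p * p dvd 2 * p * (tri (int n) * u)"
    by (simp add: dvd_add_left_iff power2_eq_square mult_ac)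
  also have "\<dots> \<longleftrightarrow> p dvd tri (int n)"
    using p_pos pow2_dvd_odd_cancel[OF odd_u p_power] by (simp only: dvd_mult_cancel_left) simp
  also have "\<dots> \<longleftrightarrow> 2 * p dvd int n * (int n + 1)"
    unfolding two_tri[symmetric] by simp
  also have "\<dots> \<longleftrightarrow> 2 * p dvd int n"
  proof (rule pow2_dvd_odd_cancel)
    have "2 dvd p" by (simp add: p_def)
    then have "even (int n)" using assms by (rule dvd_trans)
    then show "odd (int n + 1)" by simp
    show "2 * p = 2 ^ Suc c" by (simp add: p_power)
  qed
  finally show ?thesis .
qed

abbreviation "Z3 \<equiv> upper_central G 3"

text \<open>The exponents of C show that p divides i and j, and \<open>q_dvd_sigma_iff\<close>
  sharpens this to 2 p.\<close>

lemma psi_nat_in_upper_central_3: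
  "psi (int i, int k, int j) \<in> Z3 \<longleftrightarrow> 2 * p dvd int i \<and> p dvd int k \<and> 2 * p dvd int j"
proof -
  have dvd: "p dvd 2 * p ^ 2" by (simp add: power2_eq_square)
  have three: "Z3 = upper_central G (Suc 2)"
    by (simp add: numeral_3_eq_3 numeral_2_eq_2 del: upper_central.simps)
  have "psi (int i, int k, int j) \<in> Z3 \<longleftrightarrow>
      (2 * p ^ 2 dvd beta ^ k - 1 \<and> p dvd - int j \<and> 2 * p ^ 2 dvd \<sigma> j - int j) \<and>
      (2 * p ^ 2 dvd beta ^ i * (\<sigma> i) - int i \<and> p dvd int i \<and> 2 * p ^ 2 dvd 1 - beta ^ k)"
    unfolding three using upper_central_Suc_psi[of i k j 2]
    by (simp add: upper_central_2 in_C_sub_coset_iff[OF dvd_refl dvd] del: upper_central.simps)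
  also have "\<dots> \<longleftrightarrow> 2 * p dvd int i \<and> p dvd int k \<and> 2 * p dvd int j"
  proof -
    have "2 * p ^ 2 dvd beta ^ i * (\<sigma> i) - int i \<longleftrightarrow> 2 * p dvd int i" if i: "p dvd int i"
    proof -
      have "2 * p ^ 2 dvd beta ^ i - 1" using i q_dvd_beta_pow by blast
      moreover have "beta ^ i * (\<sigma> i) - int i = (\<sigma> i - int i) * beta ^ i + (beta ^ i - 1) * int i"
        by (simp add: algebra_simps)
      ultimately have "2 * p ^ 2 dvd beta ^ i * (\<sigma> i) - int i
          \<longleftrightarrow> 2 * p ^ 2 dvd (\<sigma> i - int i) * beta ^ i"
        by (simp only: dvd_add_left_iff dvd_mult2)
      also have "\<dots> \<longleftrightarrow> 2 * p ^ 2 dvd \<sigma> i - int i"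
        by (rule pow2_dvd_odd_cancel[OF _ q_power]) (simp add: beta_def)
      finally show ?thesis using q_dvd_sigma_iff[OF i] by simp
    qed
    moreover have "p dvd x" if "2 * p dvd x" for x using that by (rule dvd_mult_right)
    ultimately show ?thesis
      using q_dvd_sigma_iff[of j] q_dvd_beta_pow[of k] dvd_minus_iff[of "2 * p ^ 2" "beta ^ k - 1"] by auto
  qed
  finally show ?thesis .
qed

lemma psi_in_upper_central_3:
  "psi (i, k, j) \<in> Z3 \<longleftrightarrow> 2 * p dvd i \<and> p dvd k \<and> 2 * p dvd j"
proof -
  obtain i' k' j' where nat: "psi (i, k, j) = psi (int i', int k', int j')"
    "4 * p ^ 3 dvd int i' - i" "4 * p ^ 3 dvd int k' - k" "4 * p ^ 3 dvd int j' - j"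
    by (rule psi_nat)
  have iff: "d dvd x' \<longleftrightarrow> d dvd x" if "4 * p ^ 3 dvd x' - x" "d dvd 4 * p ^ 3" for d x x' :: int
    using dvd_add_right_iff[OF dvd_trans[OF that(2,1)], of x] by simp
  have "2 * p dvd 4 * p ^ 3" "p dvd 4 * p ^ 3" by (simp_all add: power3_eq_cube)
  then show ?thesis
    unfolding nat(1) psi_nat_in_upper_central_3 using iff nat(2-4) by blast
qed

end

section \<open>The third center and its quotient\<close>

context group
begin

text \<open>The hypotheses say that c is the commutator of a and b and commutes with both, so each
  exchange of a b with an a costs one factor c^(-1).\<close>

lemma class2_commute:
  assumes a: "a \<in> carrier G" and b: "b \<in> carrier G" and c: "c \<in> carrier G"
    and ca: "c \<otimes> a = a \<otimes> c" and cb: "c \<otimes> b = b \<otimes> c" and ba: "b \<otimes> a = a \<otimes> b \<otimes> inv c"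
  shows "b [^] (j::int) \<otimes> a [^] (i::int) = a [^] i \<otimes> b [^] j \<otimes> c [^] (- (i * j))"
proof -
  have c_a: "c [^] k \<otimes> a = a \<otimes> c [^] k" and c_b: "c [^] k \<otimes> b = b \<otimes> c [^] k" for k :: int
    using a b c ca cb by (simp_all add: int_pow_commute)
  have "conjugate G b a = b \<otimes> c [^] (- 1::int)"
    using a b c ba by (simp add: conjugate_def m_assoc int_pow_neg)
  then have "conjugate G (b [^] j) a = (b \<otimes> c [^] (- 1::int)) [^] j"
    using a b by (simp add: conjugate_int_pow)
  also have "\<dots> = b [^] j \<otimes> c [^] (- j)"
    using int_pow_mult_distrib[OF c_b[symmetric] b int_pow_closed[OF c], of "- 1" j] c
    by (simp add: int_pow_pow)
  finally have "a \<otimes> (b [^] j \<otimes> c [^] (- j)) = a \<otimes> conjugate G (b [^] j) a" by simp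
  also have "\<dots> = b [^] j \<otimes> a" using a b by (simp add: conjugate_def m_assoc)
  finally have ba': "b [^] j \<otimes> a = a \<otimes> (b [^] j \<otimes> c [^] (- j))" by simp
  have c_bj: "b [^] j \<otimes> c [^] k = c [^] k \<otimes> b [^] j" for k :: int
    using int_pow_commute2[OF c b cb] by simp
  have "conjugate G a (inv (b [^] j)) = a \<otimes> c [^] (- j)"
    using a b c ba' by (simp add: conjugate_def c_bj m_assoc)
  then have "conjugate G (a [^] i) (inv (b [^] j)) = (a \<otimes> c [^] (- j)) [^] i"
    using a b by (simp add: conjugate_int_pow)
  also have "\<dots> = a [^] i \<otimes> c [^] (- (i * j))"
    using int_pow_mult_distrib[OF c_a[symmetric] a int_pow_closed[OF c], of "- j" i] c
    by (simp add: int_pow_pow mult.commute)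
  finally have "b [^] j \<otimes> a [^] i \<otimes> inv (b [^] j) = a [^] i \<otimes> c [^] (- (i * j))"
    using a b by (simp add: conjugate_def)
  then have "b [^] j \<otimes> a [^] i = a [^] i \<otimes> c [^] (- (i * j)) \<otimes> b [^] j"
    using a b c by (metis int_pow_closed inv_solve_right m_closed)
  then show ?thesis using a b c by (simp add: m_assoc c_bj)
qed

lemma class2_mult:
  fixes i i' k k' j j' :: int
  assumes a: "a \<in> carrier G" and b: "b \<in> carrier G" and c: "c \<in> carrier G"
    and ca: "c \<otimes> a = a \<otimes> c" and cb: "c \<otimes> b = b \<otimes> c" and ba: "b \<otimes> a = a \<otimes> b \<otimes> inv c"
  shows "(a [^] i \<otimes> c [^] k \<otimes> b [^] j) \<otimes> (a [^] i' \<otimes> c [^] k' \<otimes> b [^] j')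
    = a [^] (i + i') \<otimes> c [^] (k + k' - j * i') \<otimes> b [^] (j + j' :: int)"
proof -
  have c_a: "c [^] k \<otimes> a [^] i = a [^] i \<otimes> c [^] k" for i k :: int
    using a c ca by (simp add: int_pow_commute2)
  have c_b: "b [^] j \<otimes> c [^] k = c [^] k \<otimes> b [^] j" for j k :: int
    using int_pow_commute2[OF c b cb] by simp
  have "(a [^] i \<otimes> c [^] k \<otimes> b [^] j) \<otimes> (a [^] i' \<otimes> c [^] k' \<otimes> b [^] j')
      = a [^] i \<otimes> c [^] k \<otimes> (b [^] j \<otimes> a [^] i') \<otimes> c [^] k' \<otimes> b [^] j'"
    using a b c by (simp add: m_assoc)
  also have "\<dots> = a [^] i \<otimes> (c [^] k \<otimes> a [^] i') \<otimes> (b [^] j \<otimes> c [^] (k' - i' * j)) \<otimes> b [^] j'"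
    using a b c int_pow_mult[OF c, of "- (i' * j)" k'] unfolding class2_commute[OF a b c ca cb ba]
    by (simp add: m_assoc)
  also have "\<dots> = a [^] i \<otimes> a [^] i' \<otimes> (c [^] k \<otimes> c [^] (k' - i' * j)) \<otimes> (b [^] j \<otimes> b [^] j')"
    unfolding c_a c_b using a b c by (simp add: m_assoc)
  also have "\<dots> = a [^] (i + i') \<otimes> c [^] (k + k' - j * i') \<otimes> b [^] (j + j')"
    using a b c by (simp only: int_pow_mult[symmetric]) (simp add: algebra_simps)
  finally show ?thesis .
qed

lemma class2_pow:
  fixes i k j :: int and n :: nat
  assumes a: "a \<in> carrier G" and b: "b \<in> carrier G" and c: "c \<in> carrier G"
    and ca: "c \<otimes> a = a \<otimes> c" and cb: "c \<otimes> b = b \<otimes> c" and ba: "b \<otimes> a = a \<otimes> b \<otimes> inv c"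
  shows "(a [^] i \<otimes> c [^] k \<otimes> b [^] j) [^] n
    = a [^] (int n * i) \<otimes> c [^] (int n * k - int (n choose 2) * i * j) \<otimes> b [^] (int n * j :: int)"
proof (induction n)
  case (Suc n)
  have "int n * k - int (n choose 2) * i * j + k - int n * j * i
      = int (Suc n) * k - int (Suc n choose 2) * i * j"
    unfolding choose_2_Suc by (simp add: algebra_simps)
  moreover have "int n * i + i = int (Suc n) * i" "int n * j + j = int (Suc n) * j" by (simp_all add: algebra_simps)
  ultimately show ?case
    unfolding nat_pow_Suc Suc class2_mult[OF a b c ca cb ba] by (simp only:)
qed (use a b c in \<open>simp add: binomial_eq_0\<close>)

end

section \<open>Commutativity and order of the third center\<close>

context macdonald_2_full
begin

text \<open>The correction in \<open>conj_A_C_p\<close> has an exponent divisible by 2 p^2 times 2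
  p, hence is trivial.\<close>

lemma A_C_commute: "A [^] (2 * p * x) \<otimes> C [^] (p * y) = C [^] (p * y) \<otimes> A [^] (2 * p * x)"
proof -
  obtain s where s: "conjugate G (A [^] (2 * p * x)) (C [^] (p * y)) = A [^] (2 * p * x + 2 * p ^ 2 * (s * y * (2 * p * x)))"
    using conj_A_C_p by blast
  also have "\<dots> = A [^] (2 * p * x)"
  proof (rule int_pow_cong[OF A A_M])
    have "2 * p * x + 2 * p ^ 2 * (s * y * (2 * p * x)) - 2 * p * x = 4 * p ^ 3 * (s * y * x)"
      by (simp add: power2_eq_square power3_eq_cube)
    then show "[2 * p * x + 2 * p ^ 2 * (s * y * (2 * p * x)) = 2 * p * x] (mod 4 * p ^ 3)"
      by (simp only: cong_iff_dvd_diff dvd_triv_left)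
  qed
  finally show ?thesis by (simp only: conjugate_eq_iff_commute A C_closed int_pow_closed)
qed

lemma macdonald_2_full_swap: "macdonald_2_full G B A p u r c"
  by (intro macdonald_2_full.intro macdonald_2.intro macdonald_2_axioms.intro macdonald_2_full_axioms.intro
      swap.macdonald_axioms model_params_axioms A_M B_M order_G)

lemma B_C_commute: "B [^] (2 * p * x) \<otimes> C [^] (p * y) = C [^] (p * y) \<otimes> B [^] (2 * p * x)"
proof -
  have C: "macdonald.C G B A = inv C"
    using macdonald.C_def[OF swap.macdonald_axioms] by (simp add: commutator_BA)
  have "B [^] (2 * p * x) \<otimes> inv C [^] (p * (- y)) = inv C [^] (p * (- y)) \<otimes> B [^] (2 * p * x)"
    using macdonald_2_full.A_C_commute[OF macdonald_2_full_swap, of x "- y"] unfolding C .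
  then show ?thesis by (simp add: int_pow_inv int_pow_neg)
qed

text \<open>For z = B^(2 p), conjugation by A gives z z1 and conjugation by C gives z w, where w is
  central and z1 commutes with C. Hence A C and C A conjugate z to the same element, and A^(2 p u),
  by which A C and C A differ, commutes with it. It also commutes with z1 and w, hence with z, and u
  is invertible modulo 4 p^3.\<close>

lemma A_B_commute: "A [^] (2 * p * x) \<otimes> B [^] (2 * p * y) = B [^] (2 * p * y) \<otimes> A [^] (2 * p * x)"
proof -
  define z where "z = B [^] (2 * p)"
  have z: "z \<in> carrier G" by (simp add: z_def)
  define n where "n = nat (2 * p)"
  have n: "int n = 2 * p" using p_pos by (simp add: n_def)
  obtain w' where w': "\<sigma> n = int n + 2 * p * u * tri (int n) + 2 * p ^ 2 * w'" using sigma_dvd by blast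
  have "tri (int n) = p * (2 * p + 1)" using two_tri[of "int n"] by (simp add: n)
  \<comment> \<open>The excess over 2 p is a multiple of 2 p^2, so conjugating z by A introduces
    only powers of C^p and of the central A^(2 p^2).\<close>
  then have "\<sigma> n = 2 * p + 2 * p ^ 2 * (u * (2 * p + 1) + w')"
    unfolding w' by (simp add: n algebra_simps power2_eq_square)
  then obtain t where sigma: "\<sigma> n = 2 * p + 2 * p ^ 2 * t" by blast
  define z1 where "z1 = C [^] (p * (- 2)) \<otimes> A [^] (2 * p ^ 2 * (- t))"
  have z1: "z1 \<in> carrier G" by (simp add: z1_def)
  have zA: "conjugate G z A = z \<otimes> z1"
  proof -
    have "conjugate G z A = C [^] (p * (- 2)) \<otimes> (B [^] (2 * p * 1) \<otimes> B [^] (2 * p ^ 2 * t))"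
      using conj_B_pow_A[of n] by (simp add: z_def n sigma int_pow_mult mult.commute[of p])
    also have "\<dots> = (C [^] (p * (- 2)) \<otimes> B [^] (2 * p * 1)) \<otimes> A [^] (2 * p ^ 2 * (- t))"
      unfolding B_q by (simp add: m_assoc)
    also have "\<dots> = z \<otimes> z1"
      unfolding B_C_commute[symmetric] by (simp add: m_assoc z_def z1_def)
    finally show ?thesis .
  qed
  define e where "e = - u + 2 * p * u ^ 2"
  define w where "w = A [^] (2 * p ^ 2 * (- (2 * e)))"
  have w: "w \<in> carrier G" by (simp add: w_def)
  have wc: "w \<otimes> g = g \<otimes> w" if "g \<in> carrier G" for g
    unfolding w_def using that by (rule A_q_central)
  have zC: "conjugate G z C = z \<otimes> w"
  proof -
    have "conjugate G z C = B [^] (beta ^ 1 * (2 * p))"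
      using conj_B_C_beta[of "2 * p" 1] by (simp add: z_def)
    also have "beta ^ 1 * (2 * p) = 2 * p + 2 * p ^ 2 * (2 * e)"
      by (simp add: beta_def e_def algebra_simps power2_eq_square)
    finally show ?thesis
      unfolding int_pow_mult[OF B] B_q by (simp only: z_def w_def mult_minus_right)
  qed
  have z1C: "conjugate G z1 C = z1"
  proof -
    have "C [^] (p * (- 2)) \<otimes> C = C \<otimes> C [^] (p * (- 2))" by (rule int_pow_commute) simp_all
    moreover have "z1 \<otimes> C = C [^] (p * (- 2)) \<otimes> (A [^] (2 * p ^ 2 * (- t)) \<otimes> C)"
      by (simp only: z1_def m_assoc C_closed A int_pow_closed)
    moreover have "\<dots> = C [^] (p * (- 2)) \<otimes> C \<otimes> A [^] (2 * p ^ 2 * (- t))"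
      unfolding A_q_central[OF C_closed] by (simp only: m_assoc C_closed A int_pow_closed)
    ultimately have "z1 \<otimes> C = C \<otimes> z1"
      by (simp only: z1_def m_assoc C_closed A int_pow_closed)
    then show ?thesis using z1 by (simp add: conjugate_eq_iff_commute)
  qed
  have wA: "conjugate G w A = w" using w wc[OF A] by (simp add: conjugate_eq_iff_commute)
  have "conjugate G z (A \<otimes> C) = z \<otimes> w \<otimes> z1"
    using z z1 w by (simp add: conjugate_conjugate[symmetric] zA conjugate_mult zC z1C)
  moreover have CA: "conjugate G z (C \<otimes> A) = z \<otimes> z1 \<otimes> w"
    using z z1 w by (simp add: conjugate_conjugate[symmetric] zC conjugate_mult zA wA)
  moreover have "A \<otimes> C = C \<otimes> A \<otimes> A [^] (2 * p * u)"
    using A_C[of 1] by (simp add: m_assoc int_pow_mult)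
  ultimately have "conjugate G (z \<otimes> z1 \<otimes> w) (A [^] (2 * p * u)) = z \<otimes> z1 \<otimes> w"
    using z z1 w wc[OF z1] by (simp add: conjugate_conjugate[symmetric] m_assoc)
  moreover have "conjugate G w (A [^] (2 * p * u)) = w"
    using w wc by (simp add: conjugate_eq_iff_commute)
  moreover have "conjugate G z1 (A [^] (2 * p * u)) = z1"
  proof -
    have "z1 \<otimes> A [^] (2 * p * u) = C [^] (p * (- 2)) \<otimes> (A [^] (2 * p ^ 2 * (- t)) \<otimes> A [^] (2 * p * u))"
      by (simp add: z1_def m_assoc)
    also have "\<dots> = A [^] (2 * p * u) \<otimes> C [^] (p * (- 2)) \<otimes> A [^] (2 * p ^ 2 * (- t))"
      unfolding A_q_central[OF int_pow_closed[OF A]] A_C_commute by (simp add: m_assoc)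
    finally show ?thesis using z1 by (simp add: conjugate_eq_iff_commute z1_def m_assoc)
  qed
  ultimately have "conjugate G z (A [^] (2 * p * u)) \<otimes> (z1 \<otimes> w) = z \<otimes> (z1 \<otimes> w)"
    using z z1 w by (simp add: conjugate_mult m_assoc)
  then have "conjugate G z (A [^] (2 * p * u)) = z" using z z1 w by simp
  then have comm: "z \<otimes> A [^] (2 * p * u) = A [^] (2 * p * u) \<otimes> z"
    using z by (simp add: conjugate_eq_iff_commute)
  have "coprime u (4 * p ^ 3)" unfolding M_power coprime_power_right_iff using odd_u by simp
  then obtain v where v: "[u * v = 1] (mod 4 * p ^ 3)" using cong_solve_coprime_int by blast
  have "(A [^] (2 * p * u)) [^] (v * x) = A [^] (2 * p * x)"
  proof -
    have "[2 * p * u * (v * x) = 2 * p * x] (mod 4 * p ^ 3)"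
      using cong_scalar_left[OF v, of "2 * p * x"] by (simp add: mult_ac)
    then show ?thesis by (simp only: int_pow_pow A int_pow_cong[OF A A_M])
  qed
  moreover have "z [^] y = B [^] (2 * p * y)" by (simp add: z_def int_pow_pow)
  ultimately show ?thesis
    using int_pow_commute2[OF int_pow_closed[OF A] z comm[symmetric], of "v * x" y] by simp
qed

lemma upper_central_3_eq: "Z3 = {psi (2 * p * x, p * y, 2 * p * z) | x y z. True}"
proof
  show "Z3 \<subseteq> {psi (2 * p * x, p * y, 2 * p * z) | x y z. True}"
  proof
    fix g assume g: "g \<in> Z3"
    then have "g \<in> carrier G" using upper_central_carrier by blast
    then obtain i k j where "g = psi (i, k, j)" using psi_surj by (metis prod_cases3)
    then show "g \<in> {psi (2 * p * x, p * y, 2 * p * z) | x y z. True}"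
      using g by (auto simp: psi_in_upper_central_3 elim!: dvdE)
  qed
qed (auto simp: psi_in_upper_central_3)

lemma upper_central_3_mult:
  "psi (2 * p * x, p * y, 2 * p * z) \<otimes> psi (2 * p * x', p * y', 2 * p * z')
    = psi (2 * p * (x + x'), p * (y + y'), 2 * p * (z + z'))"
proof -
  have "psi (2 * p * x, p * y, 2 * p * z) \<otimes> psi (2 * p * x', p * y', 2 * p * z')
      = A [^] (2 * p * x) \<otimes> C [^] (p * y) \<otimes> (B [^] (2 * p * z) \<otimes> A [^] (2 * p * x')) \<otimes> C [^] (p * y') \<otimes> B [^] (2 * p * z')"
    by (simp add: psi_def m_assoc)
  also have "\<dots> = A [^] (2 * p * x) \<otimes> (C [^] (p * y) \<otimes> A [^] (2 * p * x')) \<otimes> (B [^] (2 * p * z) \<otimes> C [^] (p * y')) \<otimes> B [^] (2 * p * z')"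
    unfolding A_B_commute[symmetric] by (simp add: m_assoc)
  also have "\<dots> = (A [^] (2 * p * x) \<otimes> A [^] (2 * p * x')) \<otimes> (C [^] (p * y) \<otimes> C [^] (p * y')) \<otimes> (B [^] (2 * p * z) \<otimes> B [^] (2 * p * z'))"
    unfolding A_C_commute[symmetric] B_C_commute by (simp add: m_assoc)
  finally show ?thesis by (simp add: psi_def int_pow_mult[symmetric] distrib_left)
qed

lemma subgroup_upper_central: "subgroup (upper_central G l) G"
  using upper_central_normal by (rule normal_imp_subgroup)

lemma comm_group_upper_central_3: "comm_group (G\<lparr>carrier := Z3\<rparr>)"
proof -
  interpret Z: group "G\<lparr>carrier := Z3\<rparr>"
    using subgroup_upper_central by (rule subgroup_imp_group)
  show ?thesis
  proof (rule Z.group_comm_groupI)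
    fix g h assume "g \<in> carrier (G\<lparr>carrier := Z3\<rparr>)" "h \<in> carrier (G\<lparr>carrier := Z3\<rparr>)"
    then have "g \<in> Z3" "h \<in> Z3" by simp_all
    then obtain x y z x' y' z' where "g = psi (2 * p * x, p * y, 2 * p * z)" "h = psi (2 * p * x', p * y', 2 * p * z')"
      unfolding upper_central_3_eq by blast
    then show "g \<otimes>\<^bsub>G\<lparr>carrier := Z3\<rparr>\<^esub> h = h \<otimes>\<^bsub>G\<lparr>carrier := Z3\<rparr>\<^esub> g"
      by (simp add: upper_central_3_mult add.commute)
  qed
qed

text \<open>The keys of Z_3 are the triples (2 p x, p y, 2 p z) in \<open>box\<close>, with 2 p^2, 2
  p and p choices for x, y and z.\<close>

lemma card_upper_central_3: "card (Z3) = 4 * nat p ^ 4"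
proof -
  define f where "f = (\<lambda>(x, y, z). psi (sec (2 * p * x, p * y, 2 * p * z)))"
  define D where "D = {0..<2 * p ^ 2} \<times> {0..<2 * p} \<times> {0..<p}"
  have D_box: "(2 * p * x, p * y, 2 * p * z) \<in> box" if "(x, y, z) \<in> D" for x y z
  proof -
    have "2 * p * x < 2 * p * (2 * p ^ 2)" "p * y < p * (2 * p)" "2 * p * z < 2 * p * p"
      using that p_pos by (auto simp: D_def)
    then show ?thesis using that p_pos by (auto simp: D_def box_def power2_eq_square power3_eq_cube mult_ac)
  qed
  have "inj_on f D"
  proof (rule inj_onI)
    fix v v' assume vv: "v \<in> D" "v' \<in> D" "f v = f v'"
    obtain x y z x' y' z' where v: "v = (x, y, z)" "v' = (x', y', z')" by (metis prod_cases3)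
    have "key (sec (2 * p * x, p * y, 2 * p * z)) = key (sec (2 * p * x', p * y', 2 * p * z'))"
      using vv(3) by (simp add: v f_def psi_eq_iff)
    then show "v = v'"
      using vv(1,2) p_pos by (simp add: v key_sec[OF D_box])
  qed
  moreover have "f ` D = Z3"
  proof
    \<comment> \<open>A key has the first entry i - j + p k. For k divisible by p the shift p k is a
      multiple of 2 p, so keys satisfy the same divisibility conditions as exponents.\<close>
    have even_p: "2 * p dvd p * p" by (simp add: p_def)
    show "f ` D \<subseteq> Z3"
    proof
      fix g assume "g \<in> f ` D"
      then obtain x y z where "g = psi (2 * p * x + 2 * p * z - p * (p * y), p * y, 2 * p * z)"
        by (auto simp: f_def sec_def)
      moreover have "2 * p dvd p * (p * y)" using dvd_mult2[OF even_p, of y] by (simp only: mult.assoc)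
      ultimately show "g \<in> Z3" by (simp add: psi_in_upper_central_3)
    qed
    show "Z3 \<subseteq> f ` D"
    proof
      fix g assume g: "g \<in> Z3"
      then have "g \<in> carrier G" using upper_central_carrier by blast
      then obtain v where v: "g = psi v" using psi_surj by blast
      obtain w k j where wkj: "key v = (w, k, j)" by (metis prod_cases3)
      have g_eq: "g = psi (sec (w, k, j))" unfolding v wkj[symmetric] by (rule psi_sim) (rule key_idem[symmetric])
      then have dvd: "2 * p dvd w + j - p * k" "p dvd k" "2 * p dvd j"
        using g by (simp_all add: sec_def psi_in_upper_central_3)
      then obtain y z where yz: "k = p * y" "j = 2 * p * z" by blast
      have "2 * p dvd p * k" using dvd_mult2[OF even_p, of y] by (simp only: yz mult.assoc)
      then have "2 * p dvd w" using dvd(1,3) by (metis diff_add_cancel dvd_add_left_iff)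
      then obtain x where x: "w = 2 * p * x" by blast
      have "(w, k, j) \<in> box" unfolding wkj[symmetric] by simp
      then have "0 \<le> 2 * p * x" "2 * p * x < 2 * p * (2 * p ^ 2)" "0 \<le> p * y" "p * y < p * (2 * p)"
        "0 \<le> 2 * p * z" "2 * p * z < 2 * p * p"
        by (simp_all add: box_def x yz power2_eq_square power3_eq_cube)
      then have "(x, y, z) \<in> D" using p_pos by (simp add: D_def zero_le_mult_iff)
      then show "g \<in> f ` D" using g_eq by (intro image_eqI[of _ _ "(x, y, z)"]) (simp_all add: f_def x yz)
    qed
  qed
  ultimately have "card (Z3) = card D" by (metis card_image)
  also have "\<dots> = nat (2 * p ^ 2) * (nat (2 * p) * nat p)" by (simp add: D_def card_cartesian_product)
  also have "\<dots> = 4 * nat p ^ 4"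
    using p_pos by (simp add: nat_mult_distrib nat_power_eq power2_eq_square power4_eq_xxxx)
  finally show ?thesis .
qed

section \<open>The quotient by the third center and the exponent of the group\<close>

abbreviation "Q \<equiv> G Mod Z3"
definition proj :: "'a \<Rightarrow> 'a set" where "proj g = Z3 #> g"

lemma group_Q: "group Q"
  using upper_central_normal by (rule normal.factorgroup_is_group)

lemma proj_hom: "group_hom G Q proj"
proof -
  have "proj = (\<lambda>g. Z3 #> g)" by (simp add: proj_def fun_eq_iff)
  then have "proj \<in> hom G Q" by (simp only: normal.r_coset_hom_Mod[OF upper_central_normal])
  then show ?thesis by (intro group_hom.intro group_hom_axioms.intro is_group group_Q)
qed

lemma proj_eq_one_iff: "g \<in> carrier G \<Longrightarrow> proj g = \<one>\<^bsub>Q\<^esub> \<longleftrightarrow> g \<in> Z3"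
  unfolding proj_def one_FactGroup
  using coset_join1[OF _ _ subgroup_upper_central, of 3 g] coset_join2[OF _ subgroup_upper_central, of g 3] by (intro iffI)

lemma proj_psi: "proj (psi (i, k, j)) = proj A [^]\<^bsub>Q\<^esub> i \<otimes>\<^bsub>Q\<^esub> proj C [^]\<^bsub>Q\<^esub> k \<otimes>\<^bsub>Q\<^esub> proj B [^]\<^bsub>Q\<^esub> j"
proof -
  interpret h: group_hom G Q proj by (rule proj_hom)
  show ?thesis by (simp only: psi_def prod.case h.hom_mult h.hom_int_pow A B C_closed int_pow_closed m_closed)
qed

lemma proj_closed [simp]: "g \<in> carrier G \<Longrightarrow> proj g \<in> carrier Q"
  using group_hom.hom_closed[OF proj_hom] .

lemma proj_torsion:
  "proj A [^]\<^bsub>Q\<^esub> (2 * p) = \<one>\<^bsub>Q\<^esub>" "proj B [^]\<^bsub>Q\<^esub> (2 * p) = \<one>\<^bsub>Q\<^esub>" "proj C [^]\<^bsub>Q\<^esub> p = \<one>\<^bsub>Q\<^esub>"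
proof -
  interpret h: group_hom G Q proj by (rule proj_hom)
  have "psi (2 * p, 0, 0) \<in> Z3" "psi (0, 0, 2 * p) \<in> Z3" "psi (0, p, 0) \<in> Z3"
    by (simp_all add: psi_in_upper_central_3)
  then have "A [^] (2 * p) \<in> Z3" "B [^] (2 * p) \<in> Z3" "C [^] p \<in> Z3"
    by (simp_all add: psi_def)
  then have "proj (A [^] (2 * p)) = \<one>\<^bsub>Q\<^esub>" "proj (B [^] (2 * p)) = \<one>\<^bsub>Q\<^esub>" "proj (C [^] p) = \<one>\<^bsub>Q\<^esub>"
    by (simp_all only: proj_eq_one_iff A B C_closed int_pow_closed)
  then show "proj A [^]\<^bsub>Q\<^esub> (2 * p) = \<one>\<^bsub>Q\<^esub>" "proj B [^]\<^bsub>Q\<^esub> (2 * p) = \<one>\<^bsub>Q\<^esub>" "proj C [^]\<^bsub>Q\<^esub> p = \<one>\<^bsub>Q\<^esub>"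
    by (simp_all only: h.hom_int_pow A B C_closed)
qed

text \<open>\<open>beta\<close> is 1 modulo 2 p, and 2 p kills A and B in the quotient, so C becomes
  central there.\<close>

lemma proj_relations:
  "proj C \<otimes>\<^bsub>Q\<^esub> proj A = proj A \<otimes>\<^bsub>Q\<^esub> proj C" "proj C \<otimes>\<^bsub>Q\<^esub> proj B = proj B \<otimes>\<^bsub>Q\<^esub> proj C"
  "proj B \<otimes>\<^bsub>Q\<^esub> proj A = proj A \<otimes>\<^bsub>Q\<^esub> proj B \<otimes>\<^bsub>Q\<^esub> inv\<^bsub>Q\<^esub> proj C"
proof -
  interpret h: group_hom G Q proj by (rule proj_hom)
  have "beta - 1 = 2 * p * (2 * p * u ^ 2 - u)" by (simp add: beta_def algebra_simps power2_eq_square)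
  then have beta: "[beta = 1] (mod 2 * p)" by (simp add: cong_iff_dvd_diff)
  have pow_beta: "x [^]\<^bsub>Q\<^esub> beta = x" if "x \<in> carrier Q" "x [^]\<^bsub>Q\<^esub> (2 * p) = \<one>\<^bsub>Q\<^esub>" for x
    using h.H.int_pow_cong[OF that beta] that by (simp only: h.H.int_pow_1)
  have "C \<otimes> A = A [^] beta \<otimes> C" using C_A_pow[of 1 1] by simp
  then have "proj C \<otimes>\<^bsub>Q\<^esub> proj A = proj A [^]\<^bsub>Q\<^esub> beta \<otimes>\<^bsub>Q\<^esub> proj C"
    by (simp only: h.hom_mult[symmetric] h.hom_int_pow[symmetric] A C_closed int_pow_closed)
  then show "proj C \<otimes>\<^bsub>Q\<^esub> proj A = proj A \<otimes>\<^bsub>Q\<^esub> proj C"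
    by (simp only: pow_beta proj_torsion A proj_closed)
  have "conjugate G B C = B [^] beta" using conj_B_C_beta[of 1 1] by simp
  then have "B \<otimes> C = C \<otimes> B [^] beta" by (metis B C_closed conjugate_def inv_mult_cancel(2) m_assoc inv_closed m_closed)
  then have "proj B \<otimes>\<^bsub>Q\<^esub> proj C = proj C \<otimes>\<^bsub>Q\<^esub> proj B [^]\<^bsub>Q\<^esub> beta"
    by (simp only: h.hom_mult[symmetric] h.hom_int_pow[symmetric] B C_closed int_pow_closed)
  then show "proj C \<otimes>\<^bsub>Q\<^esub> proj B = proj B \<otimes>\<^bsub>Q\<^esub> proj C"
    by (simp only: pow_beta proj_torsion B proj_closed)
  have "B \<otimes> A = A \<otimes> B \<otimes> inv C"
    by (simp add: C_def commutator_def inv_mult_group m_assoc)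
  then show "proj B \<otimes>\<^bsub>Q\<^esub> proj A = proj A \<otimes>\<^bsub>Q\<^esub> proj B \<otimes>\<^bsub>Q\<^esub> inv\<^bsub>Q\<^esub> proj C"
    by (simp only: h.hom_mult[symmetric] h.hom_inv[symmetric] A B C_closed m_closed inv_closed)
qed

lemmas proj_class2 = proj_closed[OF A] proj_closed[OF B] proj_closed[OF C_closed] proj_relations

text \<open>The class-two power formula corrects the exponent of C by a multiple of 2 p over 2,
  which is p (2 p - 1), and C^p is trivial in the quotient.\<close>

lemma pow_2p_in_upper_central_3:
  assumes "g \<in> carrier G"
  shows "g [^] nat (2 * p) \<in> Z3"
proof -
  interpret h: group_hom G Q proj by (rule proj_hom)
  define n where "n = nat (2 * p)"
  have n: "int n = 2 * p" using p_pos by (simp add: n_def)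
  obtain i k j where g: "g = psi (i, k, j)" using psi_surj[OF assms] by (metis prod_cases3)
  have n2: "int (n choose 2) = p * (2 * p - 1)" using two_choose_2[of n] by (simp add: n)
  have "proj (g [^] n) = proj A [^]\<^bsub>Q\<^esub> (2 * p * i) \<otimes>\<^bsub>Q\<^esub> proj C [^]\<^bsub>Q\<^esub> (2 * p * k - p * (2 * p - 1) * i * j) \<otimes>\<^bsub>Q\<^esub> proj B [^]\<^bsub>Q\<^esub> (2 * p * j)"
    unfolding h.hom_nat_pow[OF assms] unfolding g proj_psi
    using h.H.class2_pow[OF proj_class2, of i k j n] by (simp only: n n2)
  also have "2 * p * k - p * (2 * p - 1) * i * j = p * (2 * k - (2 * p - 1) * i * j)" by (simp add: algebra_simps)
  finally have "proj (g [^] n) = \<one>\<^bsub>Q\<^esub>"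
    by (simp only: h.H.int_pow_eq_one_mult[OF proj_closed[OF A] proj_torsion(1)]
        h.H.int_pow_eq_one_mult[OF proj_closed[OF B] proj_torsion(2)]
        h.H.int_pow_eq_one_mult[OF proj_closed[OF C_closed] proj_torsion(3)] h.H.r_one h.H.one_closed)
  then show ?thesis using assms by (simp only: proj_eq_one_iff n_def nat_pow_closed)
qed

lemma upper_central_3_pow:
  assumes "g \<in> Z3"
  shows "g [^] nat (2 * p ^ 2) = \<one>"
proof -
  obtain x y z where g: "g = psi (2 * p * x, p * y, 2 * p * z)" using assms unfolding upper_central_3_eq by blast
  have "g [^] n = psi (2 * p * (int n * x), p * (int n * y), 2 * p * (int n * z))" for n :: nat
  proof (induction n)
    case 0
    show ?case by (simp add: psi_0)
  next
    case (Suc n)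
    show ?case unfolding nat_pow_Suc Suc unfolding g upper_central_3_mult by (simp add: algebra_simps)
  qed
  from this[of "nat (2 * p ^ 2)"] have "g [^] nat (2 * p ^ 2)
      = psi (2 * p * (2 * p ^ 2 * x), p * (2 * p ^ 2 * y), 2 * p * (2 * p ^ 2 * z))"
    using p_pos by (simp del: pow_nat)
  moreover have "sim (2 * p * (2 * p ^ 2 * x), p * (2 * p ^ 2 * y), 2 * p * (2 * p ^ 2 * z)) (0, 0, 0)"
    by (rule simI[where x = "p * y" and y = "2 * p * z" and z = "x - z + r * y"])
      (simp_all add: p_def poly_simps)
  ultimately show ?thesis by (simp only: psi_sim psi_0)
qed

text \<open>The bounds 2 p for the quotient and 2 p^2 for Z_3 multiply to 4 p^3, and A has this
  order.\<close>

lemma group_exponent_eq: "group_exponent G = 4 * nat p ^ 3"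
proof -
  let ?P = "\<lambda>n::nat. n > 0 \<and> (\<forall>g\<in>carrier G. g [^] n = \<one>)"
  define N where "N = 4 * nat p ^ 3"
  have N: "int N = 4 * p ^ 3" using p_pos by (simp add: N_def)
  have "nat (2 * p) * nat (2 * p ^ 2) = N"
    using p_pos by (simp add: N_def nat_mult_distrib nat_power_eq power2_eq_square power3_eq_cube)
  then have "g [^] N = \<one>" if "g \<in> carrier G" for g
    using upper_central_3_pow[OF pow_2p_in_upper_central_3[OF that]] that by (simp only: nat_pow_pow)
  then have PN: "?P N" using p_pos by (simp add: N_def)
  have "N \<le> n" if "?P n" for n
  proof -
    have "psi (int n, 0, 0) = psi (0, 0, 0)" using that by (simp add: psi_def int_pow_int)
    then have "4 * p ^ 3 dvd int n" by (simp add: psi_eq_iff key_def mod_eq_0_iff_dvd)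
    then have "N dvd n" unfolding N[symmetric] by simp
    then show ?thesis using that by (simp add: dvd_imp_le)
  qed
  with PN have "(LEAST n. ?P n) = N" by (rule Least_equality)
  moreover have "\<exists>n. ?P n" using PN by (rule exI)
  ultimately show ?thesis unfolding group_exponent_def N_def by (simp only: if_True)
qed

end

section \<open>Heisenberg groups\<close>

text \<open>The arguments follow the rows: x and z from the first, y from the second.\<close>

definition heis_mat :: "'r \<Rightarrow> 'r \<Rightarrow> 'r \<Rightarrow> ('r, 'b) ring_scheme \<Rightarrow> nat \<Rightarrow> nat \<Rightarrow> 'r" where
  "heis_mat x z y R = (\<lambda>i\<in>{..<3}. \<lambda>j\<in>{..<3}. if i = j then \<one>\<^bsub>R\<^esub> else
     if i = 0 \<and> j = 1 then x else if i = 0 \<and> j = 2 then z else if i = 1 \<and> j = 2 then y else \<zero>\<^bsub>R\<^esub>)"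

lemma less_3_cases: "i < 3 \<longleftrightarrow> i = 0 \<or> i = 1 \<or> i = (2::nat)"
  by auto

lemma heis_mat_entries [simp]:
  "heis_mat x z y R 0 (Suc 0) = x" "heis_mat x z y R 0 2 = z" "heis_mat x z y R (Suc 0) 2 = y"
  by (simp_all add: heis_mat_def)

lemma heis_mat_inject: "heis_mat x z y R = heis_mat x' z' y' R \<longleftrightarrow> x = x' \<and> z = z' \<and> y = y'"
  by (metis heis_mat_entries)

lemma (in ring) carrier_Heis:
  "carrier (Heis R) = {heis_mat x z y R | x z y. x \<in> carrier R \<and> z \<in> carrier R \<and> y \<in> carrier R}"
proof
  show "carrier (Heis R) \<subseteq> {heis_mat x z y R | x z y. x \<in> carrier R \<and> z \<in> carrier R \<and> y \<in> carrier R}"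
  proof
    fix M assume M: "M \<in> carrier (Heis R)"
    then have PiE: "M \<in> {..<3} \<rightarrow>\<^sub>E ({..<3} \<rightarrow>\<^sub>E carrier R)"
      and diag: "\<forall>i<3. M i i = \<one>" and low: "\<forall>i<3. \<forall>j<i. M i j = \<zero>"
      by (auto simp: unitriangular_group_def)
    have row: "M i \<in> {..<3} \<rightarrow>\<^sub>E carrier R" if "i < 3" for i using PiE that by auto
    have entry: "M i j \<in> carrier R" if "i < 3" "j < 3" for i j using row[OF that(1)] that(2) by auto
    have "M = heis_mat (M 0 1) (M 0 2) (M 1 2) R"
    proof (intro ext)
      fix i j :: nat
      show "M i j = heis_mat (M 0 1) (M 0 2) (M 1 2) R i j"
      proof (cases "i < 3")
        case True
        show ?thesis
        proof (cases "j < 3")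
          case True
          then show ?thesis using \<open>i < 3\<close> diag low by (auto simp: less_3_cases heis_mat_def)
        next
          case False
          then show ?thesis using row[OF \<open>i < 3\<close>] \<open>i < 3\<close> by (auto simp: heis_mat_def PiE_def extensional_def)
        qed
      next
        case False
        then show ?thesis using PiE by (auto simp: heis_mat_def PiE_def extensional_def)
      qed
    qed
    moreover have "M 0 1 \<in> carrier R" "M 0 2 \<in> carrier R" "M 1 2 \<in> carrier R" by (simp_all add: entry)
    ultimately show "M \<in> {heis_mat x z y R | x z y. x \<in> carrier R \<and> z \<in> carrier R \<and> y \<in> carrier R}"
      by blast
  qed
next
  show "{heis_mat x z y R | x z y. x \<in> carrier R \<and> z \<in> carrier R \<and> y \<in> carrier R} \<subseteq> carrier (Heis R)"
  proof clarify
    fix x z y assume xzy: "x \<in> carrier R" "z \<in> carrier R" "y \<in> carrier R"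
    have "heis_mat x z y R \<in> {..<3} \<rightarrow>\<^sub>E ({..<3} \<rightarrow>\<^sub>E carrier R)"
      using xzy by (simp add: heis_mat_def restrict_PiE_iff)
    moreover have "\<forall>i<3. heis_mat x z y R i i = \<one>" "\<forall>i<3. \<forall>j<i. heis_mat x z y R i j = \<zero>"
      by (auto simp: heis_mat_def less_3_cases)
    ultimately show "heis_mat x z y R \<in> carrier (Heis R)" by (simp add: unitriangular_group_def)
  qed
qed

lemma one_Heis: "\<one>\<^bsub>Heis R\<^esub> = heis_mat \<zero>\<^bsub>R\<^esub> \<zero>\<^bsub>R\<^esub> \<zero>\<^bsub>R\<^esub> R"
  by (auto simp: unitriangular_group_def heis_mat_def fun_eq_iff)

lemma (in ring) mult_Heis:
  assumes "x \<in> carrier R" "z \<in> carrier R" "y \<in> carrier R" "x' \<in> carrier R" "z' \<in> carrier R" "y' \<in> carrier R"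
  shows "heis_mat x z y R \<otimes>\<^bsub>Heis R\<^esub> heis_mat x' z' y' R
    = heis_mat (x \<oplus> x') (z \<oplus> z' \<oplus> x \<otimes> y') (y \<oplus> y') R"
proof -
  have three: "{..<3} = {0, 1, 2::nat}" by auto
  have sum: "(\<Oplus>k\<in>{..<3}. f k) = f 0 \<oplus> (f 1 \<oplus> f 2)" if "f 0 \<in> carrier R" "f 1 \<in> carrier R" "f 2 \<in> carrier R" for f :: "nat \<Rightarrow> 'a"
    unfolding three using that by (simp add: Pi_def)
  have mem: "heis_mat a b d R i j \<in> carrier R" if "a \<in> carrier R" "b \<in> carrier R" "d \<in> carrier R" "i < 3" "j < 3" for a b d i j
    using that by (simp add: heis_mat_def)
  have entry: "(\<Oplus>k\<in>{..<3}. heis_mat x z y R i k \<otimes> heis_mat x' z' y' R k j)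
      = heis_mat (x \<oplus> x') (z \<oplus> z' \<oplus> x \<otimes> y') (y \<oplus> y') R i j" if "i < 3" "j < 3" for i j
    using that assms
    by (subst sum) (auto simp: mem less_3_cases heis_mat_def a_ac)
  show ?thesis
  proof (intro ext)
    fix i j :: nat
    show "(heis_mat x z y R \<otimes>\<^bsub>Heis R\<^esub> heis_mat x' z' y' R) i j
        = heis_mat (x \<oplus> x') (z \<oplus> z' \<oplus> x \<otimes> y') (y \<oplus> y') R i j"
    proof (cases "i < 3 \<and> j < 3")
      case True
      then show ?thesis using entry[of i j] by (simp add: unitriangular_group_def)
    next
      case False
      then show ?thesis by (auto simp: unitriangular_group_def heis_mat_def)
    qed
  qed
qed

lemma (in ring) group_Heis: "group (Heis R)"
proof (rule groupI)
  show "\<one>\<^bsub>Heis R\<^esub> \<in> carrier (Heis R)" by (auto simp: one_Heis carrier_Heis)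
  fix M assume M: "M \<in> carrier (Heis R)"
  then obtain x z y where xyz: "x \<in> carrier R" "z \<in> carrier R" "y \<in> carrier R" "M = heis_mat x z y R"
    by (auto simp: carrier_Heis)
  then show "\<one>\<^bsub>Heis R\<^esub> \<otimes>\<^bsub>Heis R\<^esub> M = M" by (simp add: one_Heis mult_Heis)
  have "heis_mat (\<ominus> x) (x \<otimes> y \<oplus> \<ominus> z) (\<ominus> y) R \<otimes>\<^bsub>Heis R\<^esub> M = \<one>\<^bsub>Heis R\<^esub>"
    using xyz by (simp add: one_Heis mult_Heis heis_mat_inject l_neg) (simp add: l_minus a_ac l_neg r_neg r_neg1 r_neg2)
  moreover have "heis_mat (\<ominus> x) (x \<otimes> y \<oplus> \<ominus> z) (\<ominus> y) R \<in> carrier (Heis R)"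
    using xyz by (auto simp: carrier_Heis heis_mat_inject)
  ultimately show "\<exists>N\<in>carrier (Heis R). N \<otimes>\<^bsub>Heis R\<^esub> M = \<one>\<^bsub>Heis R\<^esub>" by blast
  fix M' assume "M' \<in> carrier (Heis R)"
  then obtain x' z' y' where xyz': "x' \<in> carrier R" "z' \<in> carrier R" "y' \<in> carrier R" "M' = heis_mat x' z' y' R"
    by (auto simp: carrier_Heis)
  then show "M \<otimes>\<^bsub>Heis R\<^esub> M' \<in> carrier (Heis R)"
    using xyz by (auto simp: mult_Heis carrier_Heis heis_mat_inject)
  fix M'' assume "M'' \<in> carrier (Heis R)"
  then obtain x'' z'' y'' where xyz'': "x'' \<in> carrier R" "z'' \<in> carrier R" "y'' \<in> carrier R" "M'' = heis_mat x'' z'' y'' R"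
    by (auto simp: carrier_Heis)
  show "M \<otimes>\<^bsub>Heis R\<^esub> M' \<otimes>\<^bsub>Heis R\<^esub> M'' = M \<otimes>\<^bsub>Heis R\<^esub> (M' \<otimes>\<^bsub>Heis R\<^esub> M'')"
    using xyz xyz' xyz'' by (simp add: mult_Heis heis_mat_inject l_distr r_distr a_ac)
qed

text \<open>The matrix group maps onto the given one, and by \<open>one_iff\<close> the kernel
  consists of the matrices with trivial x and y and with z divisible by p. These are the n-th powers
  of central matrices.\<close>

lemma (in group) Heis_Mod_iso:
  fixes p N :: int and n :: nat
  defines "H \<equiv> Heis (residue_ring N)"
  assumes a: "a \<in> carrier G" and b: "b \<in> carrier G" and c: "c \<in> carrier G"
    and ca: "c \<otimes> a = a \<otimes> c" and cb: "c \<otimes> b = b \<otimes> c" and ba: "b \<otimes> a = a \<otimes> b \<otimes> inv c"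
    and N: "N = 2 * p" "p > 0" "int n = p"
    and surj: "\<And>g. g \<in> carrier G \<Longrightarrow> \<exists>(i::int) (k::int) (j::int). g = a [^] i \<otimes> c [^] k \<otimes> b [^] j"
    and one_iff: "\<And>i k j :: int. a [^] i \<otimes> c [^] k \<otimes> b [^] j = \<one> \<longleftrightarrow> N dvd i \<and> p dvd k \<and> N dvd j"
  shows "G \<cong> H Mod generate H {z [^]\<^bsub>H\<^esub> n | z. z \<in> center H}"
proof -
  define R where "R = residue_ring N"
  interpret R: residues N R using N by unfold_locales (simp_all add: R_def)
  have H: "H = Heis R" by (simp add: H_def R_def)
  interpret H: group H unfolding H by (rule R.group_Heis)
  have carrier_R: "carrier R = {0..<N}" by (auto simp: R_def residue_ring_def)
  have R_simps: "x \<oplus>\<^bsub>R\<^esub> y = (x + y) mod N" "x \<otimes>\<^bsub>R\<^esub> y = (x * y) mod N" "\<zero>\<^bsub>R\<^esub> = 0" for x y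
    by (simp_all add: R_def residue_ring_def)
  define mk where "mk x z y = heis_mat (x mod N) (z mod N) (y mod N) R" for x z y
  have mk_carrier: "mk x z y \<in> carrier H" for x z y
    using N by (auto simp: mk_def H R.carrier_Heis carrier_R heis_mat_inject)
  have mk_cases: "\<exists>x z y. M = mk x z y \<and> x \<in> {0..<N} \<and> z \<in> {0..<N} \<and> y \<in> {0..<N}" if M: "M \<in> carrier H" for M
  proof -
    obtain x z y where xzy: "M = heis_mat x z y R" "x \<in> {0..<N}" "z \<in> {0..<N}" "y \<in> {0..<N}"
      using M unfolding H R.carrier_Heis carrier_R by blast
    then have "M = mk x z y" by (simp add: mk_def)
    then show ?thesis using xzy by blast
  qed
  have mk_mult: "mk x z y \<otimes>\<^bsub>H\<^esub> mk x' z' y' = mk (x + x') (z + z' + x * y') (y + y')" for x z y x' z' y'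
    using N by (simp add: mk_def H R.mult_Heis carrier_R R_simps heis_mat_inject mod_simps)
  have mk_eq: "mk x z y = mk x' z' y' \<longleftrightarrow> N dvd x - x' \<and> N dvd z - z' \<and> N dvd y - y'" for x z y x' z' y'
    by (simp add: mk_def heis_mat_inject mod_eq_dvd_iff)
  have mk_one: "\<one>\<^bsub>H\<^esub> = mk 0 0 0" by (simp add: mk_def H one_Heis R_simps)
  have aN: "a [^] N = \<one>" and bN: "b [^] N = \<one>" and cp: "c [^] p = \<one>"
    using one_iff[of N 0 0] one_iff[of 0 0 N] one_iff[of 0 p 0] a b c by simp_all
  have cN: "c [^] N = \<one>" using int_pow_eq_one_mult[OF c cp, of 2] by (simp add: N mult.commute)
  \<comment> \<open>A matrix product adds x y' to the corner, while \<open>class2_mult\<close>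
    subtracts the product of the exponent of b on the left and of a on the right from that of c. So
    x becomes the exponent of b, y that of a, and z changes sign.\<close>
  define f :: "(nat \<Rightarrow> nat \<Rightarrow> int) \<Rightarrow> 'a"
    where "f M = a [^] M 1 2 \<otimes> c [^] (- M 0 2) \<otimes> b [^] M 0 1" for M
  have f_mk: "f (mk x z y) = a [^] y \<otimes> c [^] (- z) \<otimes> b [^] x" for x z y
  proof -
    have cong: "[l mod N = l] (mod N)" for l by (simp add: cong_def)
    have "a [^] (y mod N) = a [^] y" by (rule int_pow_cong[OF a aN cong])
    moreover have "b [^] (x mod N) = b [^] x" by (rule int_pow_cong[OF b bN cong])
    moreover have "c [^] (- (z mod N)) = c [^] (- z)"
      by (rule int_pow_cong[OF c cN]) (simp add: cong_minus_minus_iff cong)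
    ultimately show ?thesis by (simp only: f_def mk_def heis_mat_entries One_nat_def)
  qed
  have f_hom: "f \<in> hom H G"
  proof (rule homI)
    fix M M' assume "M \<in> carrier H" "M' \<in> carrier H"
    then obtain x z y x' z' y' where M: "M = mk x z y" "M' = mk x' z' y'" using mk_cases by metis
    show "f (M \<otimes>\<^bsub>H\<^esub> M') = f M \<otimes> f M'"
      unfolding M mk_mult f_mk class2_mult[OF a b c ca cb ba] by (simp add: algebra_simps)
    show "f M \<in> carrier G" unfolding M f_mk using a b c by simp
  qed
  interpret f: group_hom H G f by unfold_locales (rule f_hom)
  have f_surj: "f ` carrier H = carrier G"
  proof
    show "carrier G \<subseteq> f ` carrier H"
    proof
      fix g assume "g \<in> carrier G"
      then obtain i k j where "g = a [^] (i::int) \<otimes> c [^] (k::int) \<otimes> b [^] (j::int)" using surj by blast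
      then have "g = f (mk j (- k) i)" by (simp add: f_mk)
      then show "g \<in> f ` carrier H" using mk_carrier by blast
    qed
  qed (use f.hom_closed in blast)
  let ?U = "generate H {z [^]\<^bsub>H\<^esub> n | z. z \<in> center H}"
  have mk_pow: "mk 0 z 0 [^]\<^bsub>H\<^esub> l = mk 0 (int l * z) 0" for z and l :: nat
    by (induction l) (simp_all add: mk_one mk_mult algebra_simps)
  have kernel_eq: "kernel H G f = ?U"
  proof
    show "?U \<subseteq> kernel H G f"
    proof (rule H.generate_subgroup_incl)
      show "{z [^]\<^bsub>H\<^esub> n | z. z \<in> center H} \<subseteq> kernel H G f"
      proof clarify
        fix M assume M: "M \<in> center H"
        then have "M \<in> carrier H" by (simp add: center_def)
        then obtain x z y where xzy: "M = mk x z y" using mk_cases by blast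
        \<comment> \<open>Commuting with two elementary matrices already forces x and y to vanish
          modulo N.\<close>
        have "mk x z y \<otimes>\<^bsub>H\<^esub> mk 1 0 0 = mk 1 0 0 \<otimes>\<^bsub>H\<^esub> mk x z y"
          "mk x z y \<otimes>\<^bsub>H\<^esub> mk 0 0 1 = mk 0 0 1 \<otimes>\<^bsub>H\<^esub> mk x z y"
          using M mk_carrier by (auto simp: center_def xzy)
        then have "N dvd y" "N dvd x" by (simp_all add: mk_mult mk_eq)
        then have M_eq: "M = mk 0 z 0" by (simp add: xzy mk_eq)
        have "f (M [^]\<^bsub>H\<^esub> n) = c [^] (p * (- z))"
          unfolding M_eq mk_pow f_mk using c N by simp
        also have "\<dots> = \<one>" using int_pow_eq_one_mult[OF c cp] .
        finally show "M [^]\<^bsub>H\<^esub> n \<in> kernel H G f"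
          using M_eq mk_carrier by (simp add: kernel_def)
      qed
    qed (rule f.subgroup_kernel)
    show "kernel H G f \<subseteq> ?U"
    proof
      fix M assume M: "M \<in> kernel H G f"
      then have "M \<in> carrier H" by (simp add: kernel_def)
      then obtain x z y where xzy: "M = mk x z y" using mk_cases by blast
      then have "a [^] y \<otimes> c [^] (- z) \<otimes> b [^] x = \<one>" using M by (simp add: kernel_def f_mk)
      then have dvd: "N dvd y" "p dvd z" "N dvd x" using one_iff by auto
      then obtain l where l: "z = p * l" by blast
      have "mk 0 l 0 \<in> center H"
      proof -
        have "mk 0 l 0 \<otimes>\<^bsub>H\<^esub> M' = M' \<otimes>\<^bsub>H\<^esub> mk 0 l 0" if "M' \<in> carrier H" for M'
          using mk_cases[OF that] by (auto simp: mk_mult add.commute)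
        then show ?thesis using mk_carrier by (simp add: center_def)
      qed
      moreover have "M = mk 0 l 0 [^]\<^bsub>H\<^esub> n"
        using dvd by (simp add: xzy mk_pow mk_eq l N)
      ultimately show "M \<in> ?U" by (intro generate.incl) blast
    qed
  qed
  have "H Mod ?U \<cong> G"
    using f.FactGroup_iso[OF f_surj] unfolding kernel_eq .
  moreover have "group (H Mod ?U)"
    using f.normal_kernel unfolding kernel_eq by (rule normal.factorgroup_is_group)
  ultimately show ?thesis by (rule group.iso_sym[rotated])
qed

lemma (in macdonald_2_full) Mod_upper_central_3_iso:
  assumes H: "H = Heis (residue_ring (2 * p))"
  shows "G Mod Z3 \<cong> H Mod generate H {z [^]\<^bsub>H\<^esub> nat p | z. z \<in> center H}"
proof -
  interpret Q: group Q by (rule group_Q)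
  show ?thesis
    unfolding H
  proof (rule Q.Heis_Mod_iso[OF proj_class2])
    show "int (nat p) = p" using p_pos by simp
    show "\<exists>(i::int) (k::int) (j::int). g = proj A [^]\<^bsub>Q\<^esub> i \<otimes>\<^bsub>Q\<^esub> proj C [^]\<^bsub>Q\<^esub> k \<otimes>\<^bsub>Q\<^esub> proj B [^]\<^bsub>Q\<^esub> j"
      if g: "g \<in> carrier Q" for g
    proof -
      obtain h where h: "h \<in> carrier G" "g = proj h" using g by (auto simp: carrier_FactGroup proj_def)
      obtain i k j where "h = psi (i, k, j)" using psi_surj[OF h(1)] by (metis prod_cases3)
      then show ?thesis unfolding h(2) using proj_psi by blast
    qed
    show "proj A [^]\<^bsub>Q\<^esub> i \<otimes>\<^bsub>Q\<^esub> proj C [^]\<^bsub>Q\<^esub> k \<otimes>\<^bsub>Q\<^esub> proj B [^]\<^bsub>Q\<^esub> j = \<one>\<^bsub>Q\<^esub>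
        \<longleftrightarrow> 2 * p dvd i \<and> p dvd k \<and> 2 * p dvd j" for i k j :: int
      unfolding proj_psi[symmetric] proj_eq_one_iff[OF psi_closed] psi_in_upper_central_3 ..
  qed (use p_pos in simp_all)
qed

section \<open>The presentation of the third center\<close>

lemma (in group) commuting_generators_normal_form:
  assumes x: "x \<in> carrier G" and y: "y \<in> carrier G" and z: "z \<in> carrier G"
    and xy: "x \<otimes> y = y \<otimes> x" and xz: "x \<otimes> z = z \<otimes> x" and yz: "y \<otimes> z = z \<otimes> y"
    and gen: "carrier G = generate G {x, y, z}" and g: "g \<in> carrier G"
  shows "\<exists>(i::int) (j::int) (k::int). g = x [^] i \<otimes> y [^] j \<otimes> z [^] k"
proof -
  have mult: "(x [^] i \<otimes> y [^] j \<otimes> z [^] k) \<otimes> (x [^] i' \<otimes> y [^] j' \<otimes> z [^] k')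
      = x [^] (i + i') \<otimes> y [^] (j + j') \<otimes> z [^] (k + k')" for i j k i' j' k' :: int
  proof -
    have "(x [^] i \<otimes> y [^] j \<otimes> z [^] k) \<otimes> (x [^] i' \<otimes> y [^] j' \<otimes> z [^] k')
        = x [^] i \<otimes> y [^] j \<otimes> (z [^] k \<otimes> x [^] i') \<otimes> y [^] j' \<otimes> z [^] k'"
      using x y z by (simp add: m_assoc)
    also have "\<dots> = x [^] i \<otimes> (y [^] j \<otimes> x [^] i') \<otimes> (z [^] k \<otimes> y [^] j') \<otimes> z [^] k'"
      unfolding int_pow_commute2[OF x z xz, symmetric] using x y z by (simp add: m_assoc)
    also have "\<dots> = (x [^] i \<otimes> x [^] i') \<otimes> (y [^] j \<otimes> y [^] j') \<otimes> (z [^] k \<otimes> z [^] k')"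
      unfolding int_pow_commute2[OF y z yz, symmetric] int_pow_commute2[OF x y xy, symmetric]
      using x y z by (simp add: m_assoc)
    finally show ?thesis using x y z by (simp only: int_pow_mult)
  qed
  have pows: "x [^] (l::int) = x [^] l \<otimes> y [^] (0::int) \<otimes> z [^] (0::int)"
    "y [^] l = x [^] (0::int) \<otimes> y [^] l \<otimes> z [^] (0::int)"
    "z [^] l = x [^] (0::int) \<otimes> y [^] (0::int) \<otimes> z [^] l" for l
    using x y z by simp_all
  have ex: "\<exists>(i::int) (j::int) (k::int). h [^] l = x [^] i \<otimes> y [^] j \<otimes> z [^] k"
    if "h \<in> {x, y, z}" for h and l :: int
    using that pows[of l] by blast
  have "g \<in> generate G {x, y, z}" using g gen by simp
  then show ?thesis
  proof (induction rule: generate.induct)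
    case one
    have "\<one> = x [^] (0::int) \<otimes> y [^] (0::int) \<otimes> z [^] (0::int)" by simp
    then show ?case by blast
  next
    case (incl h)
    then have "h \<in> carrier G" using x y z by auto
    then show ?case using ex[OF incl, of 1] by simp
  next
    case (inv h)
    then have "h \<in> carrier G" using x y z by auto
    then have "inv h = h [^] (- 1::int)" by (simp add: int_pow_neg)
    then show ?case using ex[OF inv, of "- 1"] by simp
  next
    case (eng h1 h2)
    then show ?case using mult by metis
  qed
qed

definition Z3_rels :: "nat \<Rightarrow> (gens_xyz free_word \<times> gens_xyz free_word) set" where
  "Z3_rels m = (let F = free_group; x = fw_gen gX; y = fw_gen gY; z = fw_gen gZ in
          {(x \<otimes>\<^bsub>F\<^esub> y, y \<otimes>\<^bsub>F\<^esub> x),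
           (x \<otimes>\<^bsub>F\<^esub> z, z \<otimes>\<^bsub>F\<^esub> x),
           (y \<otimes>\<^bsub>F\<^esub> z, z \<otimes>\<^bsub>F\<^esub> y),
           (x [^]\<^bsub>F\<^esub> (2 ^ (2 * m - 2) :: nat), z [^]\<^bsub>F\<^esub> (2 ^ m :: nat)),
           (x [^]\<^bsub>F\<^esub> (2 ^ (m - 1) :: nat) \<otimes>\<^bsub>F\<^esub> y [^]\<^bsub>F\<^esub> (2 ^ (m - 1) :: nat), \<one>\<^bsub>F\<^esub>),
           (x [^]\<^bsub>F\<^esub> (2 ^ (2 * m - 1) :: nat), \<one>\<^bsub>F\<^esub>)})"

lemma range_gens_xyz: "range f = {f gX, f gY, f gZ}"
proof -
  have U: "UNIV = {gX, gY, gZ}" using gens_xyz.exhaust by blast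
  show ?thesis unfolding U by simp
qed

text \<open>By commutativity every element is x^i y^j z^k. The relations trade y^(2^(m - 1)) and
  z^(2^m) for powers of x and bound the exponent of x. The product of the three bounds is 2^(4 m -
  2), the order of Z_3.\<close>

lemma card_presented_Z3:
  fixes m :: nat
  defines "R \<equiv> presented_group (Z3_rels m)"
  shows "finite (carrier R)" "card (carrier R) \<le> 2 ^ (2 * m - 1) * 2 ^ (m - 1) * 2 ^ m"
proof -
  interpret R: group R unfolding R_def by (rule group_presented_group)
  interpret F: group free_group by (rule group_free_group)
  interpret h: group_hom free_group R "pres_class (Z3_rels m)"
    by unfold_locales (simp add: R_def pres_class_hom)
  define x where "x = pres_class (Z3_rels m) (fw_gen gX)"
  define y where "y = pres_class (Z3_rels m) (fw_gen gY)"
  define z where "z = pres_class (Z3_rels m) (fw_gen gZ)"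
  have x: "x \<in> carrier R" and y: "y \<in> carrier R" and z: "z \<in> carrier R"
    by (simp_all add: x_def y_def z_def h.hom_closed)
  have rel: "pres_class (Z3_rels m) v = pres_class (Z3_rels m) w" if "(v, w) \<in> Z3_rels m" for v w
    using that by (rule pres_class_eq)
  have xy: "x \<otimes>\<^bsub>R\<^esub> y = y \<otimes>\<^bsub>R\<^esub> x" and xz: "x \<otimes>\<^bsub>R\<^esub> z = z \<otimes>\<^bsub>R\<^esub> x" and yz: "y \<otimes>\<^bsub>R\<^esub> z = z \<otimes>\<^bsub>R\<^esub> y"
    unfolding x_def y_def z_def
    by (simp_all only: h.hom_mult[symmetric] carrier_free_group UNIV_I)
      (rule rel, simp add: Z3_rels_def Let_def)+
  have xzp: "x [^]\<^bsub>R\<^esub> (2 ^ (2 * m - 2) :: nat) = z [^]\<^bsub>R\<^esub> (2 ^ m :: nat)"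
    and x_one: "x [^]\<^bsub>R\<^esub> (2 ^ (2 * m - 1) :: nat) = \<one>\<^bsub>R\<^esub>"
    and xyp: "x [^]\<^bsub>R\<^esub> (2 ^ (m - 1) :: nat) \<otimes>\<^bsub>R\<^esub> y [^]\<^bsub>R\<^esub> (2 ^ (m - 1) :: nat) = \<one>\<^bsub>R\<^esub>"
    unfolding x_def y_def z_def
    by (simp_all only: h.hom_mult[symmetric] h.hom_nat_pow[symmetric] h.hom_one[symmetric] carrier_free_group UNIV_I)
      (rule rel, simp add: Z3_rels_def Let_def)+
  define a where "a = (2 ^ (2 * m - 1) :: int)"
  define b where "b = (2 ^ (m - 1) :: int)"
  define d where "d = (2 ^ m :: int)"
  have a: "x [^]\<^bsub>R\<^esub> a = \<one>\<^bsub>R\<^esub>" using x_one by (simp add: a_def flip: int_pow_int)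
  have b: "y [^]\<^bsub>R\<^esub> b = x [^]\<^bsub>R\<^esub> (- b)"
  proof -
    have "x [^]\<^bsub>R\<^esub> b \<otimes>\<^bsub>R\<^esub> y [^]\<^bsub>R\<^esub> b = \<one>\<^bsub>R\<^esub>" using xyp by (simp add: b_def flip: int_pow_int)
    then show ?thesis using x y by (metis R.int_pow_closed R.int_pow_neg R.inv_equality R.inv_inv)
  qed
  have d: "z [^]\<^bsub>R\<^esub> d = x [^]\<^bsub>R\<^esub> (2 ^ (2 * m - 2) :: int)" using xzp by (simp add: d_def flip: int_pow_int)
  let ?f = "\<lambda>(i::int, j::int, k::int). x [^]\<^bsub>R\<^esub> i \<otimes>\<^bsub>R\<^esub> y [^]\<^bsub>R\<^esub> j \<otimes>\<^bsub>R\<^esub> z [^]\<^bsub>R\<^esub> k"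
  let ?D = "{0..<a} \<times> {0..<b} \<times> {0..<d}"
  have sub: "carrier R \<subseteq> ?f ` ?D"
  proof
    fix g assume g: "g \<in> carrier R"
    have gen: "carrier R = generate R {x, y, z}"
      using generate_presented_group[of "Z3_rels m"] by (simp add: range_gens_xyz R_def x_def y_def z_def)
    obtain i j k :: int where ijk: "g = x [^]\<^bsub>R\<^esub> i \<otimes>\<^bsub>R\<^esub> y [^]\<^bsub>R\<^esub> j \<otimes>\<^bsub>R\<^esub> z [^]\<^bsub>R\<^esub> k"
      using R.commuting_generators_normal_form[OF x y z xy xz yz gen g] by blast
    have "y [^]\<^bsub>R\<^esub> j = y [^]\<^bsub>R\<^esub> (b * (j div b)) \<otimes>\<^bsub>R\<^esub> y [^]\<^bsub>R\<^esub> (j mod b)"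
      using y by (simp add: R.int_pow_mult[symmetric])
    also have "y [^]\<^bsub>R\<^esub> (b * (j div b)) = x [^]\<^bsub>R\<^esub> (- b * (j div b))"
      using x y b by (metis R.int_pow_pow)
    finally have yj: "y [^]\<^bsub>R\<^esub> j = x [^]\<^bsub>R\<^esub> (- b * (j div b)) \<otimes>\<^bsub>R\<^esub> y [^]\<^bsub>R\<^esub> (j mod b)" .
    have "z [^]\<^bsub>R\<^esub> k = z [^]\<^bsub>R\<^esub> (d * (k div d)) \<otimes>\<^bsub>R\<^esub> z [^]\<^bsub>R\<^esub> (k mod d)"
      using z by (simp add: R.int_pow_mult[symmetric])
    also have "z [^]\<^bsub>R\<^esub> (d * (k div d)) = x [^]\<^bsub>R\<^esub> (2 ^ (2 * m - 2) * (k div d))"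
      using x z d by (metis R.int_pow_pow)
    finally have zk: "z [^]\<^bsub>R\<^esub> k = x [^]\<^bsub>R\<^esub> (2 ^ (2 * m - 2) * (k div d)) \<otimes>\<^bsub>R\<^esub> z [^]\<^bsub>R\<^esub> (k mod d)" .
    define l where "l = i - b * (j div b) + 2 ^ (2 * m - 2) * (k div d)"
    have "g = x [^]\<^bsub>R\<^esub> i \<otimes>\<^bsub>R\<^esub> x [^]\<^bsub>R\<^esub> (- b * (j div b)) \<otimes>\<^bsub>R\<^esub> (y [^]\<^bsub>R\<^esub> (j mod b) \<otimes>\<^bsub>R\<^esub> x [^]\<^bsub>R\<^esub> (2 ^ (2 * m - 2) * (k div d))) \<otimes>\<^bsub>R\<^esub> z [^]\<^bsub>R\<^esub> (k mod d)"
      unfolding ijk yj zk using x y z by (simp add: R.m_assoc)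
    also have "\<dots> = (x [^]\<^bsub>R\<^esub> i \<otimes>\<^bsub>R\<^esub> x [^]\<^bsub>R\<^esub> (- b * (j div b)) \<otimes>\<^bsub>R\<^esub> x [^]\<^bsub>R\<^esub> (2 ^ (2 * m - 2) * (k div d))) \<otimes>\<^bsub>R\<^esub> y [^]\<^bsub>R\<^esub> (j mod b) \<otimes>\<^bsub>R\<^esub> z [^]\<^bsub>R\<^esub> (k mod d)"
      unfolding R.int_pow_commute2[OF x y xy, symmetric] using x y z by (simp add: R.m_assoc)
    also have "x [^]\<^bsub>R\<^esub> i \<otimes>\<^bsub>R\<^esub> x [^]\<^bsub>R\<^esub> (- b * (j div b)) \<otimes>\<^bsub>R\<^esub> x [^]\<^bsub>R\<^esub> (2 ^ (2 * m - 2) * (k div d)) = x [^]\<^bsub>R\<^esub> l"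
      by (simp only: l_def R.int_pow_mult[OF x, symmetric]) simp
    also have "x [^]\<^bsub>R\<^esub> l = x [^]\<^bsub>R\<^esub> (l mod a)"
      by (rule R.int_pow_cong[OF x a]) (simp add: cong_def)
    finally show "g \<in> ?f ` ?D"
      by (intro image_eqI[of _ _ "(l mod a, j mod b, k mod d)"]) (simp_all add: a_def b_def d_def)
  qed
  show "finite (carrier R)" by (rule finite_subset[OF sub]) simp
  have "card (carrier R) \<le> card ?D" using sub by (intro surj_card_le) simp_all
  then show "card (carrier R) \<le> 2 ^ (2 * m - 1) * 2 ^ (m - 1) * 2 ^ m"
    by (simp add: card_cartesian_product a_def b_def d_def nat_power_eq mult.assoc)
qed

text \<open>For A^(2 p), B^(2 p) and C^p the last three relations are \<open>C_q\<close>,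
  \<open>B_q\<close> and \<open>A_M\<close>. The induced map is onto, and the presented group is not
  larger than Z_3 by \<open>card_presented_Z3\<close>.\<close>

lemma (in macdonald_2_full) upper_central_3_presentation:
  assumes m: "p = 2 ^ (m - 1)" "m > 1"
  shows "G\<lparr>carrier := Z3\<rparr> \<cong> presented_group (Z3_rels m)"
proof -
  let ?Z = "G\<lparr>carrier := Z3\<rparr>"
  let ?R = "presented_group (Z3_rels m)"
  interpret Z: group ?Z using subgroup_upper_central by (rule subgroup_imp_group)
  interpret R: group ?R by (rule group_presented_group)
  interpret F: group free_group by (rule group_free_group)
  define f where "f = (\<lambda>g. case g of gX \<Rightarrow> A [^] (2 * p) | gY \<Rightarrow> B [^] (2 * p) | gZ \<Rightarrow> C [^] p)"
  have f: "f gX = A [^] (2 * p)" "f gY = B [^] (2 * p)" "f gZ = C [^] p" by (simp_all add: f_def)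
  have "psi (2 * p, 0, 0) \<in> Z3" "psi (0, 0, 2 * p) \<in> Z3" "psi (0, p, 0) \<in> Z3"
    by (simp_all add: psi_in_upper_central_3)
  then have fZ: "f gX \<in> Z3" "f gY \<in> Z3" "f gZ \<in> Z3"
    by (simp_all add: psi_def f)
  then have range: "range f \<subseteq> carrier ?Z" by (simp add: range_gens_xyz)
  interpret e: group_hom free_group ?Z "fw_eval ?Z f"
    by unfold_locales (rule Z.fw_eval_hom[OF range])
  have pow: "x [^]\<^bsub>?Z\<^esub> (n::nat) = x [^] n" for x n
    by (simp add: nat_pow_def)
  have p2: "2 * p = 2 ^ m" "p * p = 2 ^ (2 * m - 2)" "2 * (p * p) = 2 ^ (2 * m - 1)"
  proof -
    obtain l where l: "m = Suc l" using m(2) by (cases m) auto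
    have p: "p = 2 ^ l" using m(1) by (simp add: l)
    have "2 * m - 2 = l + l" "2 * m - 1 = Suc (l + l)" by (simp_all add: l)
    then show "2 * p = 2 ^ m" "p * p = 2 ^ (2 * m - 2)" "2 * (p * p) = 2 ^ (2 * m - 1)"
      by (simp_all only: p l power_add power_Suc)
  qed
  have A_pow: "f gX [^] (n::nat) = A [^] (2 * p * int n)" for n by (simp add: f int_pow_pow flip: int_pow_int)
  have B_pow: "f gY [^] (n::nat) = B [^] (2 * p * int n)" for n by (simp add: f int_pow_pow flip: int_pow_int)
  have C_pow: "f gZ [^] (n::nat) = C [^] (p * int n)" for n by (simp add: f int_pow_pow flip: int_pow_int)
  have rel1: "f gX \<otimes> f gY = f gY \<otimes> f gX" using A_B_commute[of 1 1] by (simp add: f)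
  have rel2: "f gX \<otimes> f gZ = f gZ \<otimes> f gX" using A_C_commute[of 1 1] by (simp add: f)
  have rel3: "f gY \<otimes> f gZ = f gZ \<otimes> f gY" using B_C_commute[of 1 1] by (simp add: f)
  have rel4: "f gX [^] (2 ^ (2 * m - 2) :: nat) = f gZ [^] (2 ^ m :: nat)"
  proof -
    have "int (2 ^ (2 * m - 2)) = p * p" "int (2 ^ m) = 2 * p" by (simp_all add: p2)
    then show ?thesis
      unfolding A_pow C_pow using C_q[of 1] by (simp add: power2_eq_square power3_eq_cube mult_ac)
  qed
  have rel5: "f gX [^] (2 ^ (m - 1) :: nat) \<otimes> f gY [^] (2 ^ (m - 1) :: nat) = \<one>"
  proof -
    have "int (2 ^ (m - 1)) = p" by (simp add: m(1))
    then show ?thesis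
      unfolding A_pow B_pow using B_q[of 1] by (simp add: power2_eq_square int_pow_neg mult.assoc)
  qed
  have rel6: "f gX [^] (2 ^ (2 * m - 1) :: nat) = \<one>"
  proof -
    have "int (2 ^ (2 * m - 1)) = 2 * (p * p)"
      by (simp only: p2(3) of_nat_power of_nat_numeral)
    then show ?thesis
      unfolding A_pow using A_M by (simp add: power3_eq_cube mult.assoc)
  qed
  have "fw_eval ?Z f v = fw_eval ?Z f w" if "(v, w) \<in> Z3_rels m" for v w
    using that rel1 rel2 rel3 rel4 rel5 rel6 unfolding Z3_rels_def Let_def
    by (elim insertE emptyE Pair_inject)
      (simp_all add: e.hom_nat_pow Z.fw_eval_gen[OF range] pow mult_free_group[symmetric] fZ)
  from presented_group_universal[OF Z.is_group range this] obtain h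
    where h: "h \<in> hom ?R ?Z" "\<And>a. h (pres_class (Z3_rels m) (fw_gen a)) = f a" by metis
  interpret h: group_hom ?R ?Z h by unfold_locales (rule h(1))
  have "Z3 \<subseteq> h ` carrier ?R"
  proof
    let ?g = "\<lambda>a. pres_class (Z3_rels m) (fw_gen a)"
    have g: "?g a \<in> carrier ?R" for a by (auto simp: carrier_presented_group)
    fix w assume "w \<in> Z3"
    then obtain x y z where "w = psi (2 * p * x, p * y, 2 * p * z)" unfolding upper_central_3_eq by blast
    then have "w = f gX [^] x \<otimes> f gZ [^] y \<otimes> f gY [^] z"
      by (simp add: psi_def f int_pow_pow)
    also have "\<dots> = h (?g gX [^]\<^bsub>?R\<^esub> x \<otimes>\<^bsub>?R\<^esub> ?g gZ [^]\<^bsub>?R\<^esub> y \<otimes>\<^bsub>?R\<^esub> ?g gY [^]\<^bsub>?R\<^esub> z)"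
      using g by (simp add: h.hom_int_pow h(2) int_pow_consistent[OF subgroup_upper_central fZ(1), symmetric]
          int_pow_consistent[OF subgroup_upper_central fZ(2), symmetric]
          int_pow_consistent[OF subgroup_upper_central fZ(3), symmetric])
    finally show "w \<in> h ` carrier ?R"
      by (rule image_eqI) (simp only: R.m_closed R.int_pow_closed g)
  qed
  then have surj: "h ` carrier ?R = carrier ?Z" using h.hom_closed by auto
  have "card (carrier ?R) \<le> card (carrier ?Z)"
  proof -
    have "(2::nat) ^ (2 * m - 1) * 2 ^ (m - 1) * 2 ^ m = 4 * nat p ^ 4"
    proof -
      obtain l where l: "m = Suc l" using m(2) by (cases m) auto
      have "2 * m - 1 = Suc (l + l)" "m - 1 = l" by (simp_all add: l)
      moreover have "nat p = 2 ^ l" using m(1) by (simp add: l nat_power_eq)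
      ultimately show ?thesis by (simp only: l power_add power_Suc) (simp add: power4_eq_xxxx)
    qed
    then show ?thesis using card_presented_Z3(2)[of m] by (simp add: card_upper_central_3)
  qed
  then have "inj_on h (carrier ?R)"
    using surj card_presented_Z3(1)[of m] surj_card_le[of "carrier ?R" "carrier ?Z" h]
    by (intro eq_card_imp_inj_on) simp_all
  then have "h \<in> iso ?R ?Z" using h(1) surj by (simp add: iso_def bij_betw_def)
  then have "?R \<cong> ?Z" by (rule is_isoI)
  then show ?thesis by (rule R.iso_sym)
qed

theorem proposition9p2:
  fixes \<alpha> :: int and m :: nat and S :: "gens_AB free_word set set"
    and J :: "gens_AB free_word set monoid"
  assumes "\<alpha> \<notin> {0, 1, 2}"
    and "m = multiplicity 2 (\<alpha> - 1)"
    and "m > 1"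
    and "sylow_subgroup 2 (Macdonald \<alpha>) S"
    and "J = (Macdonald \<alpha>)\<lparr>carrier := S\<rparr>"
  shows "comm_group (J\<lparr>carrier := upper_central J 3\<rparr>)
    \<and> order (J\<lparr>carrier := upper_central J 3\<rparr>) = 2 ^ (4 * m - 2)
    \<and> (let F = free_group; x = fw_gen gX; y = fw_gen gY; z = fw_gen gZ in
        J\<lparr>carrier := upper_central J 3\<rparr> \<cong>
        presented_group
          {(x \<otimes>\<^bsub>F\<^esub> y, y \<otimes>\<^bsub>F\<^esub> x),
           (x \<otimes>\<^bsub>F\<^esub> z, z \<otimes>\<^bsub>F\<^esub> x),
           (y \<otimes>\<^bsub>F\<^esub> z, z \<otimes>\<^bsub>F\<^esub> y),
           (x [^]\<^bsub>F\<^esub> (2 ^ (2 * m - 2) :: nat), z [^]\<^bsub>F\<^esub> (2 ^ m :: nat)),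
           (x [^]\<^bsub>F\<^esub> (2 ^ (m - 1) :: nat) \<otimes>\<^bsub>F\<^esub> y [^]\<^bsub>F\<^esub> (2 ^ (m - 1) :: nat), \<one>\<^bsub>F\<^esub>),
           (x [^]\<^bsub>F\<^esub> (2 ^ (2 * m - 1) :: nat), \<one>\<^bsub>F\<^esub>)})
    \<and> (let H = Heis (residue_ring (2 ^ m));
           U = generate H {c [^]\<^bsub>H\<^esub> (2 ^ (m - 1) :: nat) | c. c \<in> center H}
       in J Mod upper_central J 3 \<cong> H Mod U)
    \<and> group_exponent J = 2 ^ (3 * m - 1)"
proof -
  define l where "l = m - 1"
  define p :: int where p_l: "p = 2 ^ l"
  have l: "l \<ge> 1" "m = Suc l" using assms(3) by (simp_all add: l_def)
  obtain u where u: "\<alpha> - 1 = 2 ^ m * u" "odd u"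
    using multiplicity_decompose'[of "\<alpha> - 1" 2] assms(1,2) by auto
  have \<alpha>: "\<alpha> = 1 + 2 * p * u" using u(1) by (simp add: p_l l(2) algebra_simps)
  \<comment> \<open>As m > 1, p = 2^(m - 1) is even, and 2^(l - 1) is its half.\<close>
  have "l = Suc (l - 1)" using l(1) by simp
  then have "p = 2 * 2 ^ (l - 1)" unfolding p_l by (metis power_Suc)
  then interpret model_params p u "2 ^ (l - 1)" l by (rule model_params.intro[OF _ p_l u(2)])
  obtain a b where "macdonald_2 J a b p u (2 ^ (l - 1)) l" "order J = 16 * nat p ^ 7"
    using sylow_Macdonald[of S J] assms(4,5) unfolding \<alpha> by blast
  then interpret J: macdonald_2_full J a b p u "2 ^ (l - 1)" l
    by (intro macdonald_2_full.intro macdonald_2_full_axioms.intro)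
  have nat_p: "nat p = 2 ^ l" by (simp add: p_l nat_power_eq)
  have "order (J\<lparr>carrier := upper_central J 3\<rparr>) = 2 ^ (4 * m - 2)"
  proof -
    have "4 * m - 2 = 2 + l * 4" by (simp add: l(2))
    then show ?thesis
      using J.card_upper_central_3 by (simp only: order_def nat_p power_add power_mult) simp
  qed
  moreover have "J\<lparr>carrier := upper_central J 3\<rparr> \<cong> presented_group (Z3_rels m)"
    using J.upper_central_3_presentation[of m] assms(3) by (simp add: p_l l_def)
  moreover have "J Mod upper_central J 3 \<cong> Heis (residue_ring (2 ^ m)) Mod
      generate (Heis (residue_ring (2 ^ m))) {c [^]\<^bsub>Heis (residue_ring (2 ^ m))\<^esub> (2 ^ (m - 1) :: nat) | c. c \<in> center (Heis (residue_ring (2 ^ m)))}"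
  proof -
    have "2 * p = 2 ^ m" "nat p = 2 ^ (m - 1)" using nat_p by (simp_all add: p_l l(2))
    then show ?thesis using J.Mod_upper_central_3_iso[OF refl] by (simp only:)
  qed
  moreover have "group_exponent J = 2 ^ (3 * m - 1)"
  proof -
    have "3 * m - 1 = 2 + l * 3" by (simp add: l(2))
    then show ?thesis using J.group_exponent_eq by (simp only: nat_p power_add power_mult) simp
  qed
  ultimately show ?thesis
    using J.comm_group_upper_central_3 unfolding Let_def Z3_rels_def by blast
qed

end
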